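(* Let $N\in\{3,4\}$, let $\Omega\subset\mathbb{R}^N$ be a bounded smooth domain, let $\lambda,\mu\in\mathbb{R}$, and put $2^*=\frac{2N}{N-2}$. The problem $$-\Delta u=|u|^{2^*-2}u+\lambda u+\mu u\log u^2\ \text{ in }\Omega,\qquad u=0\ \text{ on }\partial\Omega,$$ possesses a positive solution provided one of the following conditions holds: (i) $N=3$ and $(\lambda,\mu)\in B_0\cup C_0$; (ii) $N=4$, $(\lambda,\mu)\in B_0\cup C_0$ and $\dfrac{32\,e^{\lambda/\mu}}{\rho_{\max}^2}<1$, where $\rho_{\max}:=\sup\{r>0:\ \exists x\in\Omega\text{ such that }B(x,r)\subset\Omega\}$.
   Context: A positive solution is a weak solution $u\in H^1_0(\Omega)$ with $u>0$ in $\Omega$ (convention: $s\log s^2=0$ at $s=0$). $B(x,r)$ is the ball of center $x$ and radius $r$, and $|\Omega|$ is the Lebesgue measure of $\Omega$. Let $$S=\inf_{u\in H^1(\mathbb{R}^N)\setminus\{0\}}\frac{\int_{\mathbb{R}^N}|\nabla u|^2dx}{(\int_{\mathbb{R}^N}|u|^{2^*}dx)^{2/2^*}},\qquad \lambda_1(\Omega)=\inf_{u\in H^1_0(\Omega)\setminus\{0\}}\frac{\int_\Omega|\nabla u|^2dx}{\int_\Omega|u|^2dx}.$$ Define $$B_0=\Big\{(\lambda,\mu):\lambda\in[0,\lambda_1(\Omega)),\ \mu<0,\ \tfrac1N\Big(\tfrac{\lambda_1(\Omega)-\lambda}{\lambda_1(\Omega)}\Big)^{N/2}S^{N/2}+\tfrac{\mu}{2}|\Omega|>0\Big\},$$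 $$C_0=\Big\{(\lambda,\mu):\lambda\in\mathbb{R},\ \mu<0,\ \tfrac1N S^{N/2}+\tfrac{\mu}{2}e^{-\lambda/\mu}|\Omega|>0\Big\}.$$ *)

theory Defs
  imports "HOL-Analysis.Analysis"
begin

section \<open>Smooth functions and smooth domains\<close>

text \<open>On an open set \<open>S\<close>, \<open>Ck_on k S f\<close> says that \<open>f\<close> is of class \<open>C\<^sup>k\<close>: level \<open>k + 1\<close> asks that
  every directional derivative of \<open>f\<close> is of class \<open>C\<^sup>k\<close>.\<close>

primrec Ck_on ::
  "nat \<Rightarrow> 'a::real_normed_vector set \<Rightarrow> ('a \<Rightarrow> 'b::real_normed_vector) \<Rightarrow> bool" where
  "Ck_on 0 S f \<longleftrightarrow> continuous_on S f"
| "Ck_on (Suc k) S f \<longleftrightarrow>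
     (\<forall>x\<in>S. f differentiable (at x)) \<and> (\<forall>v. Ck_on k S (\<lambda>x. frechet_derivative f (at x) v))"

definition smooth_on :: "'a::real_normed_vector set \<Rightarrow> ('a \<Rightarrow> 'b::real_normed_vector) \<Rightarrow> bool" where
  "smooth_on S f \<longleftrightarrow> (\<forall>k. Ck_on k S f)"

text \<open>The boundary is locally straightened by a smooth diffeomorphism \<open>\<Phi> : U \<rightarrow> V\<close> that maps
  \<open>\<Omega>\<close> to one side of a coordinate hyperplane and its boundary to that hyperplane.\<close>

definition smooth_boundary :: "(real^'n) set \<Rightarrow> bool" where
  "smooth_boundary \<Omega> \<longleftrightarrow>
     (\<forall>x\<in>frontier \<Omega>. \<exists>U V (\<Phi> :: real^'n \<Rightarrow> real^'n) \<Psi> k.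
        open U \<and> x \<in> U \<and> open V \<and> homeomorphism U V \<Phi> \<Psi> \<and> smooth_on U \<Phi> \<and> smooth_on V \<Psi> \<and>
        \<Phi> ` (U \<inter> \<Omega>) = V \<inter> {y. y $ k > 0} \<and>
        \<Phi> ` (U \<inter> frontier \<Omega>) = V \<inter> {y. y $ k = 0})"

definition bounded_smooth_domain :: "(real^'n) set \<Rightarrow> bool" where
  "bounded_smooth_domain \<Omega> \<longleftrightarrow>
     open \<Omega> \<and> connected \<Omega> \<and> \<Omega> \<noteq> {} \<and> bounded \<Omega> \<and> smooth_boundary \<Omega>"

section \<open>Sobolev spaces\<close>

definition test_functions :: "(real^'n) set \<Rightarrow> (real^'n \<Rightarrow> real) set" where
  "test_functions \<Omega> =
     {\<phi>. smooth_on UNIV \<phi> \<and> compact (closure {x. \<phi> x \<noteq> 0}) \<and> closure {x. \<phi> x \<noteq> 0} \<subseteq> \<Omega>}"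

text \<open>Elements of the spaces below are functions on the whole of \<open>\<real>\<^sup>N\<close>; only their values on \<open>\<Omega>\<close>,
  up to a null set, matter.\<close>

definition L2_on :: "(real^'n) set \<Rightarrow> (real^'n \<Rightarrow> 'b::euclidean_space) set" where
  "L2_on \<Omega> = {f. f \<in> borel_measurable (lebesgue_on \<Omega>) \<and>
                  integrable (lebesgue_on \<Omega>) (\<lambda>x. (norm (f x))\<^sup>2)}"

definition is_weak_gradient ::
  "(real^'n) set \<Rightarrow> (real^'n \<Rightarrow> real) \<Rightarrow> (real^'n \<Rightarrow> real^'n) \<Rightarrow> bool" where
  "is_weak_gradient \<Omega> u g \<longleftrightarrow>
     (\<forall>\<phi>\<in>test_functions \<Omega>. \<forall>i.
        (LINT x|lebesgue_on \<Omega>. u x * frechet_derivative \<phi> (at x) (axis i 1))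
          = - (LINT x|lebesgue_on \<Omega>. g x $ i * \<phi> x))"

definition H1 :: "(real^'n) set \<Rightarrow> (real^'n \<Rightarrow> real) set" where
  "H1 \<Omega> = {u \<in> L2_on \<Omega>. \<exists>g\<in>L2_on \<Omega>. is_weak_gradient \<Omega> u g}"

text \<open>For \<open>u \<in> H1 \<Omega>\<close> the choice is unique up to a null subset of \<open>\<Omega>\<close>.\<close>

definition wgrad :: "(real^'n) set \<Rightarrow> (real^'n \<Rightarrow> real) \<Rightarrow> real^'n \<Rightarrow> real^'n" where
  "wgrad \<Omega> u = (SOME g. g \<in> L2_on \<Omega> \<and> is_weak_gradient \<Omega> u g)"

definition H1_norm :: "(real^'n) set \<Rightarrow> (real^'n \<Rightarrow> real) \<Rightarrow> real" where
  "H1_norm \<Omega> u =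
     sqrt ((LINT x|lebesgue_on \<Omega>. (norm (wgrad \<Omega> u x))\<^sup>2) + (LINT x|lebesgue_on \<Omega>. (u x)\<^sup>2))"

definition H10 :: "(real^'n) set \<Rightarrow> (real^'n \<Rightarrow> real) set" where
  "H10 \<Omega> = {u \<in> H1 \<Omega>. \<exists>\<phi> :: nat \<Rightarrow> real^'n \<Rightarrow> real. (\<forall>n. \<phi> n \<in> test_functions \<Omega>) \<and>
                (\<lambda>n. H1_norm \<Omega> (\<lambda>x. \<phi> n x - u x)) \<longlonglongrightarrow> 0}"

section \<open>The constants\<close>

definition two_star :: "nat \<Rightarrow> real" where
  "two_star N = 2 * real N / (real N - 2)"

definition ae_zero :: "(real^'n) set \<Rightarrow> (real^'n \<Rightarrow> real) \<Rightarrow> bool" where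
  "ae_zero \<Omega> u \<longleftrightarrow> (AE x in lebesgue_on \<Omega>. u x = 0)"

text \<open>The dimension of the space is the cardinality of the index type \<open>'n\<close>.\<close>

definition sobolev_S :: "'n::finite itself \<Rightarrow> real" where
  "sobolev_S TYPE('n) =
     (INF u\<in>{u \<in> H1 (UNIV :: (real^'n) set). \<not> ae_zero UNIV u}.
        (LINT x|lebesgue. (norm (wgrad UNIV u x))\<^sup>2) /
        (LINT x|lebesgue. \<bar>u x\<bar> powr two_star CARD('n)) powr (2 / two_star CARD('n)))"

definition lambda1 :: "(real^'n) set \<Rightarrow> real" where
  "lambda1 \<Omega> =
     (INF u\<in>{u \<in> H10 \<Omega>. \<not> ae_zero \<Omega> u}.
        (LINT x|lebesgue_on \<Omega>. (norm (wgrad \<Omega> u x))\<^sup>2) / (LINT x|lebesgue_on \<Omega>. \<bar>u x\<bar>\<^sup>2))"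

definition B0 :: "(real^'n) set \<Rightarrow> (real \<times> real) set" where
  "B0 \<Omega> = {(lam, \<mu>). lam \<in> {0..<lambda1 \<Omega>} \<and> \<mu> < 0 \<and>
     1 / real CARD('n) * ((lambda1 \<Omega> - lam) / lambda1 \<Omega>) powr (real CARD('n) / 2)
         * sobolev_S TYPE('n) powr (real CARD('n) / 2)
       + \<mu> / 2 * measure lebesgue \<Omega> > 0}"

definition C0 :: "(real^'n) set \<Rightarrow> (real \<times> real) set" where
  "C0 \<Omega> = {(lam, \<mu>). \<mu> < 0 \<and>
     1 / real CARD('n) * sobolev_S TYPE('n) powr (real CARD('n) / 2)
       + \<mu> / 2 * exp (- lam / \<mu>) * measure lebesgue \<Omega> > 0}"

definition rho_max :: "(real^'n) set \<Rightarrow> real" where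
  "rho_max \<Omega> = Sup {r. r > 0 \<and> (\<exists>x\<in>\<Omega>. ball x r \<subseteq> \<Omega>)}"

section \<open>The boundary value problem\<close>

text \<open>Since \<open>ln 0 = 0\<close>, the expression \<open>s * ln (s\<^sup>2)\<close> vanishes at \<open>s = 0\<close>.\<close>

definition nonlinearity :: "nat \<Rightarrow> real \<Rightarrow> real \<Rightarrow> real \<Rightarrow> real" where
  "nonlinearity N lam \<mu> s = \<bar>s\<bar> powr (two_star N - 2) * s + lam * s + \<mu> * (s * ln (s\<^sup>2))"

text \<open>Integrability is demanded explicitly because the integral of a non-integrable function
  is \<open>0\<close> by convention.\<close>

definition weak_solution :: "(real^'n) set \<Rightarrow> real \<Rightarrow> real \<Rightarrow> (real^'n \<Rightarrow> real) \<Rightarrow> bool" where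
  "weak_solution \<Omega> lam \<mu> u \<longleftrightarrow> u \<in> H10 \<Omega> \<and>
     (\<forall>v\<in>H10 \<Omega>.
        integrable (lebesgue_on \<Omega>) (\<lambda>x. nonlinearity CARD('n) lam \<mu> (u x) * v x) \<and>
        (LINT x|lebesgue_on \<Omega>. wgrad \<Omega> u x \<bullet> wgrad \<Omega> v x)
          = (LINT x|lebesgue_on \<Omega>. nonlinearity CARD('n) lam \<mu> (u x) * v x))"

text \<open>Functions represent their almost-everywhere classes, so \<open>u > 0\<close> on all of \<open>\<Omega>\<close> refers to a
  suitable representative.\<close>

definition positive_solution :: "(real^'n) set \<Rightarrow> real \<Rightarrow> real \<Rightarrow> (real^'n \<Rightarrow> real) \<Rightarrow> bool" where
  "positive_solution \<Omega> lam \<mu> u \<longleftrightarrow> weak_solution \<Omega> lam \<mu> u \<and> (\<forall>x\<in>\<Omega>. u x > 0)"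

end

theory Submission
  imports Defs "HOL-Real_Asymp.Real_Asymp"
begin

text \<open>The solution is found as a monotone limit rather than as a critical point of mountain pass type.
  Since \<open>\<mu> < 0\<close>, the conditions \<open>B0\<close> and \<open>C0\<close> say that the energy
  \<open>J(u) = 1/2 \<integral> |\<nabla>u|\<^sup>2 - \<integral> G(u)\<close> is bounded below by some \<open>b > 0\<close> on a sphere \<open>\<integral> |\<nabla>u|\<^sup>2 = rho\<close>, and a
  positive solution already lies in the ball that this sphere encloses. For large \<open>K\<close> the function
  \<open>h(s) = g(s) + K s\<close> is nondecreasing, so \<open>T u = (- \<Delta> + K)\<^sup>-\<^sup>1 h(u)\<close> is order preserving; it also
  minimizes a convex majorant of \<open>J\<close> that touches \<open>J\<close> at \<open>u\<close>, so \<open>J\<close> does not exceed \<open>J(u)\<close> on the segment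
  from \<open>u\<close> to \<open>T u\<close> and the iterates of \<open>T\<close> cannot cross the sphere. The slope of \<open>h\<close> at the origin
  is infinite, hence tiny multiples of bump functions are subsolutions. Starting from a supremum of
  such functions that is positive on all of \<open>\<Omega>\<close>, the iterates increase, are bounded in \<open>L\<^sup>p\<close> for the
  critical exponent \<open>p\<close> by the Sobolev inequality, and therefore converge in \<open>H\<^sub>0\<^sup>1\<close> to a solution that is
  positive everywhere. Neither compact embeddings nor the maximum principle are used.\<close>

text \<open>Growth is critical, so a bounded sequence may lose mass in the limit; the order
  structure takes the place of compactness. The increasing iterates have a limit \<open>v\<close> in
  L^(2q), and \<open>h(v) * v\<close> is an integrable majorant of the products to be controlled, so
  dominated convergence makes the iterates Cauchy in energy. \<open>B0\<close> and \<open>C0\<close>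
  are treated by one device: \<open>lam\<close> is split into \<open>\<sigma>\<close> and
  \<open>lam - \<sigma>\<close>. The part \<open>\<sigma>\<close> is paid from the gradient term, of
  which a fraction \<open>\<theta>\<close> is left; the rest is merged with the logarithm and costs
  the constant \<open>\<mu> / 2 * exp (- (lam - \<sigma>) / \<mu>)\<close> per unit of volume. For
  \<open>B0\<close> one takes \<open>\<sigma> = lam\<close>, for \<open>C0\<close> one takes
  \<open>\<sigma> = 0\<close> and \<open>\<theta> = 1\<close>. With t the squared gradient norm, the
  energy is then at least \<open>\<theta>\<close> t / 2 - (t / S)^q / (2q) plus that constant times
  the volume. The maximum over t lies at t^(q-1) = \<open>\<theta>\<close> S^q, which is
  \<open>rho\<close>, and its value \<open>b\<close> is the expression required to be positive in
  the definition of the set. In dimensions 3 and 4 the critical exponent is an even integer 2q,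
  namely 6 and 4, so natural powers replace \<open>powr\<close> in all estimates.\<close>

section \<open>Calculus of \<open>Ck_on\<close> on the whole space\<close>

lemma Ck_on_const: "Ck_on k UNIV (\<lambda>x::'a::real_normed_vector. c::'b::real_normed_vector)"
  by (induction k arbitrary: c) auto

lemma Ck_on_SucD: "Ck_on (Suc k) UNIV f \<Longrightarrow> Ck_on k UNIV f"
proof (induction k arbitrary: f)
  case 0
  then show ?case
    by (auto intro!: differentiable_imp_continuous_on simp: differentiable_on_def
        intro: differentiable_at_withinI)
next
  case (Suc k)
  then show ?case by (metis Ck_on.simps(2))
qed

text \<open>Lets each closure proof supply an explicit derivative formula, so that
  \<open>frechet_derivative\<close> of a compound expression never has to be computed inside an
  induction.\<close>

lemma Ck_on_SucI:
  fixes f :: "'a::real_normed_vector \<Rightarrow> 'b::real_normed_vector"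
  assumes "\<And>x. (f has_derivative f' x) (at x)" and "\<And>v. Ck_on k UNIV (\<lambda>x. f' x v)"
  shows "Ck_on (Suc k) UNIV f"
proof -
  have "frechet_derivative f (at x) = f' x" for x
    using assms(1) frechet_derivative_at by metis
  then show ?thesis using assms by (auto intro: differentiableI)
qed

lemma Ck_on_frechet: "Ck_on (Suc k) UNIV f \<Longrightarrow> (f has_derivative frechet_derivative f (at x)) (at x)"
  by (simp add: frechet_derivative_works)

lemma Ck_on_add:
  assumes "Ck_on k UNIV f" "Ck_on k UNIV g"
  shows "Ck_on k UNIV (\<lambda>x. f x + g x)"
  using assms
proof (induction k arbitrary: f g)
  case 0
  then show ?case by (auto intro: continuous_intros)
next
  case (Suc k)
  show ?case
    by (rule Ck_on_SucI[where f' = "\<lambda>x v. frechet_derivative f (at x) v + frechet_derivative g (at x) v"])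
      (use Suc in \<open>auto intro!: has_derivative_add Ck_on_frechet[OF Suc.prems(1)] Ck_on_frechet[OF Suc.prems(2)]\<close>)
qed

lemma Ck_on_mult:
  fixes f g :: "'a::real_normed_vector \<Rightarrow> real"
  assumes "Ck_on k UNIV f" "Ck_on k UNIV g"
  shows "Ck_on k UNIV (\<lambda>x. f x * g x)"
  using assms
proof (induction k arbitrary: f g)
  case 0
  then show ?case by (auto intro: continuous_intros)
next
  case (Suc k)
  show ?case
  proof (rule Ck_on_SucI)
    show "((\<lambda>x. f x * g x) has_derivative (\<lambda>v. f x * frechet_derivative g (at x) v + frechet_derivative f (at x) v * g x)) (at x)" for x
      by (intro has_derivative_mult Ck_on_frechet[OF Suc.prems(1)] Ck_on_frechet[OF Suc.prems(2)])
    show "Ck_on k UNIV (\<lambda>x. f x * frechet_derivative g (at x) v + frechet_derivative f (at x) v * g x)" for v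
      using Suc by (intro Ck_on_add Suc.IH Ck_on_SucD[OF Suc.prems(1)] Ck_on_SucD[OF Suc.prems(2)]) auto
  qed
qed

lemma Ck_on_affine: "bounded_linear f \<Longrightarrow> Ck_on k UNIV (\<lambda>x. f x + c)"
proof (cases k)
  case 0
  assume "bounded_linear f"
  then show ?thesis using 0 by (auto intro: continuous_intros linear_continuous_on)
next
  case (Suc j)
  assume "bounded_linear f"
  then have "((\<lambda>x. f x + c) has_derivative f) (at x)" for x
    by (auto intro!: derivative_eq_intros bounded_linear_imp_has_derivative)
  then show ?thesis unfolding Suc by (rule Ck_on_SucI) (rule Ck_on_const)
qed

text \<open>The outer function comes with the whole sequence \<open>G\<close> of its derivatives:
  differentiating \<open>G j (\<phi> x)\<close> yields \<open>G (Suc j) (\<phi> x)\<close> times a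
  derivative of \<open>\<phi>\<close>, so induction on \<open>k\<close> for all \<open>j\<close> at
  once succeeds. The profiles used later have derivatives in closed form, so such sequences are at
  hand.\<close>

lemma Ck_on_compose_chain:
  fixes \<phi> :: "'a::real_normed_vector \<Rightarrow> real" and G :: "nat \<Rightarrow> real \<Rightarrow> real"
  assumes \<phi>: "smooth_on UNIV \<phi>"
    and G: "\<And>j t. (G j has_real_derivative G (Suc j) t) (at t)"
  shows "Ck_on k UNIV (\<lambda>x. G j (\<phi> x))"
proof (induction k arbitrary: j)
  case 0
  have "continuous_on UNIV \<phi>" using \<phi> unfolding smooth_on_def by (metis Ck_on.simps(1))
  moreover have "continuous_on UNIV (G j)"
    using G by (meson DERIV_isCont continuous_at_imp_continuous_on)
  ultimately show ?case
    by (auto intro: continuous_on_compose2)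
next
  case (Suc k)
  have Sk: "Ck_on (Suc m) UNIV \<phi>" for m using \<phi> unfolding smooth_on_def by blast
  show ?case
  proof (rule Ck_on_SucI)
    show "((\<lambda>x. G j (\<phi> x)) has_derivative (\<lambda>v. G (Suc j) (\<phi> x) * frechet_derivative \<phi> (at x) v)) (at x)" for x
      using has_derivative_compose[OF Ck_on_frechet[OF Sk] G[unfolded has_field_derivative_def]]
      by simp
    show "Ck_on k UNIV (\<lambda>x. G (Suc j) (\<phi> x) * frechet_derivative \<phi> (at x) v)" for v
      using Suc Sk[of k] by (intro Ck_on_mult) auto
  qed
qed

lemma smooth_on_const: "smooth_on UNIV (\<lambda>x::'a::real_normed_vector. c::'b::real_normed_vector)"
  by (simp add: smooth_on_def Ck_on_const)

lemma smooth_on_add: "smooth_on UNIV f \<Longrightarrow> smooth_on UNIV g \<Longrightarrow> smooth_on UNIV (\<lambda>x. f x + g x)"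
  by (simp add: smooth_on_def Ck_on_add)

lemma smooth_on_mult:
  fixes f g :: "'a::real_normed_vector \<Rightarrow> real"
  shows "smooth_on UNIV f \<Longrightarrow> smooth_on UNIV g \<Longrightarrow> smooth_on UNIV (\<lambda>x. f x * g x)"
  by (simp add: smooth_on_def Ck_on_mult)

lemma smooth_on_diff:
  fixes f g :: "'a::real_normed_vector \<Rightarrow> real"
  assumes "smooth_on UNIV f" "smooth_on UNIV g"
  shows "smooth_on UNIV (\<lambda>x. f x - g x)"
  using smooth_on_add[OF assms(1) smooth_on_mult[OF smooth_on_const[of "-1"] assms(2)]] by simp

lemma smooth_on_power:
  fixes f :: "'a::real_normed_vector \<Rightarrow> real"
  assumes "smooth_on UNIV f"
  shows "smooth_on UNIV (\<lambda>x. f x ^ n)"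
  by (induction n) (auto intro: smooth_on_const smooth_on_mult assms)

lemma smooth_on_frechet:
  "smooth_on UNIV f \<Longrightarrow> smooth_on UNIV (\<lambda>x. frechet_derivative f (at x) v)"
  unfolding smooth_on_def by (metis Ck_on.simps(2))

lemma smooth_on_imp_has_derivative:
  "smooth_on UNIV f \<Longrightarrow> (f has_derivative frechet_derivative f (at x)) (at x)"
  unfolding smooth_on_def using Ck_on_frechet by blast

lemma smooth_on_imp_continuous_on: "smooth_on UNIV f \<Longrightarrow> continuous_on UNIV f"
  unfolding smooth_on_def by (metis Ck_on.simps(1))

lemma smooth_on_compose_chain:
  fixes \<phi> :: "'a::real_normed_vector \<Rightarrow> real" and G :: "nat \<Rightarrow> real \<Rightarrow> real"
  assumes "smooth_on UNIV \<phi>" and "\<And>j t. (G j has_real_derivative G (Suc j) t) (at t)"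
  shows "smooth_on UNIV (\<lambda>x. G j (\<phi> x))"
  unfolding smooth_on_def by (intro allI Ck_on_compose_chain[of \<phi> G, OF assms])

section \<open>Gradients as vectors of partial derivatives\<close>

definition grad :: "(real^'n \<Rightarrow> real) \<Rightarrow> real^'n \<Rightarrow> real^'n" where
  "grad \<phi> x = (\<chi> i. frechet_derivative \<phi> (at x) (axis i 1))"

lemma grad_nth [simp]: "grad \<phi> x $ i = frechet_derivative \<phi> (at x) (axis i 1)"
  by (simp add: grad_def)

lemma frechet_eq_grad:
  assumes "\<phi> differentiable (at x)"
  shows "frechet_derivative \<phi> (at x) v = grad \<phi> x \<bullet> v"
proof -
  have lin: "linear (frechet_derivative \<phi> (at x))"
    using assms by (simp add: linear_frechet_derivative)
  have "v = (\<Sum>i\<in>UNIV. (v$i) *\<^sub>R axis i 1)"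
    using basis_expansion[of v] by (simp add: scalar_mult_eq_scaleR)
  then have "frechet_derivative \<phi> (at x) v = (\<Sum>i\<in>UNIV. (v$i) *\<^sub>R frechet_derivative \<phi> (at x) (axis i 1))"
    using linear_sum[OF lin, of "\<lambda>i. (v$i) *\<^sub>R axis i 1" UNIV] by (simp add: linear_scale[OF lin])
  then show ?thesis by (simp add: inner_vec_def mult.commute)
qed

lemma has_derivative_grad:
  assumes "smooth_on UNIV \<phi>"
  shows "(\<phi> has_derivative (\<lambda>v. grad \<phi> x \<bullet> v)) (at x)"
proof -
  note D = smooth_on_imp_has_derivative[OF assms, of x]
  then have "frechet_derivative \<phi> (at x) = (\<lambda>v. grad \<phi> x \<bullet> v)"
    by (intro ext frechet_eq_grad differentiableI)
  with D show ?thesis by (simp only:)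
qed

lemma grad_eqI:
  assumes "(\<phi> has_derivative (\<lambda>v. w \<bullet> v)) (at x)"
  shows "grad \<phi> x = w"
  by (simp add: vec_eq_iff frechet_derivative_at[OF assms, symmetric] inner_axis)

lemma continuous_on_grad: "smooth_on UNIV \<phi> \<Longrightarrow> continuous_on UNIV (grad \<phi>)"
  unfolding grad_def
  by (intro continuous_on_vec_lambda smooth_on_imp_continuous_on smooth_on_frechet)

lemma grad_compose_chain:
  assumes "smooth_on UNIV \<phi>" and "(\<eta> has_real_derivative d) (at (\<phi> x))"
  shows "grad (\<lambda>x. \<eta> (\<phi> x)) x = d *\<^sub>R grad \<phi> x"
  using has_derivative_compose[OF has_derivative_grad[OF assms(1), of x]
      assms(2)[unfolded has_field_derivative_def]]
  by (intro grad_eqI) simp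

section \<open>Bump functions\<close>

text \<open>The function exp(-1/t), extended by zero, times a polynomial in s = 1/t. The polynomial
  factor makes the family closed under differentiation: since ds/dt = - s^2, the derivative replaces
  P by s^2 (P - P').\<close>

definition flat :: "real poly \<Rightarrow> real \<Rightarrow> real" where
  "flat P t = (if t > 0 then poly P (1/t) * exp (- (1/t)) else 0)"

lemma poly_times_exp_tendsto_0: "((\<lambda>s::real. poly P s * exp (- s)) \<longlongrightarrow> 0) at_top"
proof -
  have "((\<lambda>s::real. \<Sum>i\<le>degree P. coeff P i * (s ^ i / exp s)) \<longlongrightarrow> (\<Sum>i\<le>degree P. coeff P i * 0)) at_top"
    by (intro tendsto_intros tendsto_power_div_exp_0)
  moreover have "(\<Sum>i\<le>degree P. coeff P i * (s ^ i / exp s)) = poly P s * exp (- s)" for s :: real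
    by (simp add: poly_altdef exp_minus field_simps sum_divide_distrib)
  ultimately show ?thesis by simp
qed

lemma flat_has_derivative:
  "(flat P has_real_derivative flat ([:0,0,1:] * (P - pderiv P)) t) (at t)"
proof -
  consider "t > 0" | "t < 0" | "t = 0" by linarith
  then show ?thesis
  proof cases
    case 1
    have "((\<lambda>t. poly P (1/t) * exp (- (1/t))) has_real_derivative flat ([:0,0,1:] * (P - pderiv P)) t) (at t)"
      using 1 unfolding flat_def
      by (auto intro!: derivative_eq_intros poly_DERIV[THEN DERIV_chain2] simp: field_simps power2_eq_square)
    then show ?thesis
      by (rule has_field_derivative_transform_within_open[of _ _ _ "{0<..}"])
        (use 1 in \<open>auto simp: flat_def\<close>)
  next
    case 2
    have "((\<lambda>t. 0) has_real_derivative flat ([:0,0,1:] * (P - pderiv P)) t) (at t)"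
      using 2 by (simp add: flat_def)
    then show ?thesis
      by (rule has_field_derivative_transform_within_open[of _ _ _ "{..<0}"])
        (use 2 in \<open>auto simp: flat_def\<close>)
  next
    case 3
    \<comment> \<open>At the origin the substitution s = 1/t turns the right difference quotient
      into s P(s) exp(-s); the extra factor \<open>[:0,1:]\<close> is the division by t.\<close>
    have "((\<lambda>s. poly ([:0,1:] * P) s * exp (- s)) \<longlongrightarrow> 0) at_top"
      by (rule poly_times_exp_tendsto_0)
    then have "((\<lambda>s. flat P (inverse s) / inverse s) \<longlongrightarrow> 0) at_top"
      by (rule Lim_transform_eventually)
        (auto intro!: eventually_mono[OF eventually_gt_at_top[of 0]] simp: flat_def field_simps)
    then have "((\<lambda>h. flat P h / h) \<longlongrightarrow> 0) (at_right 0)"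
      by (simp add: filterlim_at_right_to_top)
    moreover have "((\<lambda>h. flat P h / h) \<longlongrightarrow> 0) (at_left 0)"
      by (rule Lim_transform_eventually[of "\<lambda>_. 0"])
        (auto simp: flat_def eventually_at_filter)
    ultimately show ?thesis
      using 3 by (simp add: DERIV_def flat_def filterlim_split_at)
  qed
qed

primrec flat_poly :: "nat \<Rightarrow> real poly" where
  "flat_poly 0 = 1"
| "flat_poly (Suc j) = [:0,0,1:] * (flat_poly j - pderiv (flat_poly j))"

declare flat_poly.simps [simp del]

lemma flat_chain:
  "(flat (flat_poly j) has_real_derivative flat (flat_poly (Suc j)) t) (at t)"
  using flat_has_derivative by (simp add: flat_poly.simps)

lemma flat_0: "flat (flat_poly 0) t = (if t > 0 then exp (- (1/t)) else 0)"
  by (simp add: flat_def flat_poly.simps)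

lemma flat_Suc0: "flat (flat_poly (Suc 0)) t = (1/t)^2 * flat (flat_poly 0) t"
  by (simp add: flat_def flat_poly.simps power2_eq_square)

lemma flat_2: "flat (flat_poly (Suc (Suc 0))) t = ((1/t)^4 - 2 * (1/t)^3) * flat (flat_poly 0) t"
  by (simp add: flat_def flat_poly.simps pderiv_pCons pderiv_mult eval_nat_numeral algebra_simps)

text \<open>The standard mollifier profile exp(-1/(r^2 - |x - a|^2)). Its explicit form matters,
  because its Laplacian has to be compared with the function itself.\<close>

definition bump :: "real^'n \<Rightarrow> real \<Rightarrow> real^'n \<Rightarrow> real" where
  "bump a r x = flat (flat_poly 0) (r\<^sup>2 - (x - a) \<bullet> (x - a))"

lemma bump_bounds: "0 \<le> bump a r x" "bump a r x < 1"
  by (auto simp: bump_def flat_0)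

lemma bump_pos_iff: "r > 0 \<Longrightarrow> bump a r x > 0 \<longleftrightarrow> x \<in> ball a r"
  and bump_nz_iff: "r > 0 \<Longrightarrow> bump a r x \<noteq> 0 \<longleftrightarrow> x \<in> ball a r"
proof -
  assume r: "r > 0"
  have "(x - a) \<bullet> (x - a) < r\<^sup>2 \<longleftrightarrow> norm (x - a) < r"
    using r power_mono_iff[of r "norm (x - a)" 2]
    by (simp add: power2_norm_eq_inner[symmetric] not_le[symmetric])
  then show "bump a r x > 0 \<longleftrightarrow> x \<in> ball a r" "bump a r x \<noteq> 0 \<longleftrightarrow> x \<in> ball a r"
    by (auto simp: bump_def flat_0 dist_norm norm_minus_commute)
qed

lemma quadratic_has_derivative:
  "((\<lambda>x::'a::real_inner. c - (x - a) \<bullet> (x - a)) has_derivative (\<lambda>v. - 2 * ((x - a) \<bullet> v))) (at x)"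
  by (auto intro!: derivative_eq_intros simp: inner_commute)

lemma smooth_on_quadratic:
  "smooth_on UNIV (\<lambda>x::'a::real_inner. c - (x - a) \<bullet> (x - a))" (is "smooth_on _ ?q")
proof -
  have "Ck_on (Suc k) UNIV ?q" for k
  proof (rule Ck_on_SucI)
    show "(?q has_derivative (\<lambda>v. - 2 * ((x - a) \<bullet> v))) (at x)" for x
      by (rule quadratic_has_derivative)
    have "bounded_linear (\<lambda>x. -2 * (x \<bullet> v))" for v :: 'a
      by (intro bounded_linear_const_mult bounded_linear_inner_left)
    from Ck_on_affine[OF this, where c = "2 * (a \<bullet> v)" for v]
    show "Ck_on k UNIV (\<lambda>x. - 2 * ((x - a) \<bullet> v))" for v
      by (simp add: inner_diff_left algebra_simps)
  qed
  then show ?thesis unfolding smooth_on_def using Ck_on_SucD by blast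
qed

lemma smooth_on_bump: "smooth_on UNIV (bump a r)"
  unfolding bump_def by (rule smooth_on_compose_chain[where G = "\<lambda>j. flat (flat_poly j)", OF smooth_on_quadratic flat_chain])

section \<open>The Laplacian of a bump function\<close>

definition laplacian :: "(real^'n \<Rightarrow> real) \<Rightarrow> real^'n \<Rightarrow> real" where
  "laplacian \<phi> x =
     (\<Sum>i\<in>UNIV. frechet_derivative (\<lambda>y. frechet_derivative \<phi> (at y) (axis i 1)) (at x) (axis i 1))"

lemma sum_quadratic:
  fixes y :: "real^'n"
  shows "(\<Sum>i\<in>UNIV. c * (- 2) + 4 * (y $ i)\<^sup>2 * d) = 4 * (y \<bullet> y) * d - 2 * real CARD('n) * c"
proof -
  have "(\<Sum>i\<in>UNIV. 4 * (y $ i)\<^sup>2 * d) = (\<Sum>i\<in>UNIV. (4 * d) * (y $ i)\<^sup>2)"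
    by (simp only: mult_ac)
  also have "\<dots> = (4 * d) * (y \<bullet> y)"
    unfolding sum_distrib_left[symmetric] by (simp add: inner_vec_def power2_eq_square)
  finally show ?thesis unfolding sum.distrib by simp
qed

lemma laplacian_bump:
  fixes a :: "real^'n" and r :: real
  defines "q \<equiv> \<lambda>x. r\<^sup>2 - (x - a) \<bullet> (x - a)"
  shows "laplacian (bump a r) x =
    4 * ((x - a) \<bullet> (x - a)) * flat (flat_poly (Suc (Suc 0))) (q x)
      - 2 * real CARD('n) * flat (flat_poly (Suc 0)) (q x)"
proof -
  have q: "(q has_derivative (\<lambda>v. - 2 * ((x - a) \<bullet> v))) (at x)" for x
    unfolding q_def by (rule quadratic_has_derivative)
  have comp: "((\<lambda>x. flat (flat_poly j) (q x)) has_derivative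
        (\<lambda>v. flat (flat_poly (Suc j)) (q x) * (- 2 * ((x - a) \<bullet> v)))) (at x)" for j x
    using has_derivative_compose[OF q flat_chain[unfolded has_field_derivative_def]] by simp
  have d1: "frechet_derivative (bump a r) (at y) v = flat (flat_poly (Suc 0)) (q y) * (- 2 * ((y - a) \<bullet> v))"
    for y v
    using frechet_derivative_at[OF comp[of 0 y]] unfolding bump_def q_def by metis
  have "((\<lambda>y. flat (flat_poly (Suc 0)) (q y) * (- 2 * ((y - a) \<bullet> w))) has_derivative
     (\<lambda>v. flat (flat_poly (Suc 0)) (q x) * (- 2 * (v \<bullet> w)) +
      (flat (flat_poly (Suc (Suc 0))) (q x) * (- 2 * ((x - a) \<bullet> v))) * (- 2 * ((x - a) \<bullet> w)))) (at x)" for w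
    by (rule has_derivative_mult[OF comp]) (auto intro!: derivative_eq_intros)
  note * = frechet_derivative_at[OF this, symmetric]
  have "frechet_derivative (\<lambda>y. frechet_derivative (bump a r) (at y) (axis i 1)) (at x) (axis i 1)
     = flat (flat_poly (Suc 0)) (q x) * (- 2)
       + 4 * ((x - a) $ i)\<^sup>2 * flat (flat_poly (Suc (Suc 0))) (q x)" for i
    unfolding d1 *[of "axis i 1"] by (simp add: inner_axis inner_axis_axis power2_eq_square algebra_simps)
  then have "laplacian (bump a r) x = (\<Sum>i\<in>UNIV. flat (flat_poly (Suc 0)) (q x) * (- 2)
       + 4 * ((x - a) $ i)\<^sup>2 * flat (flat_poly (Suc (Suc 0))) (q x))"
    by (simp only: laplacian_def)
  then show ?thesis by (simp only: sum_quadratic)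
qed

text \<open>With s = 1/(r^2 - |x - a|^2), the quotient of the negative Laplacian by the bump is a
  polynomial in s with leading term - 4 r^2 s^4. It is therefore bounded above even at the edge of
  the ball, where s tends to infinity. This bound is what turns small multiples of bumps into
  subsolutions.\<close>

lemma laplacian_bump_ge:
  fixes a :: "real^'n"
  assumes r: "r > 0"
  obtains A where "A \<ge> 0" "\<And>x. - laplacian (bump a r) x \<le> A * bump a r x"
proof -
  \<comment> \<open>\<open>c\<close> collects the coefficients of s^3 once 2N s^2 is estimated by 2N
    (s^3 + 1), N being the dimension, and - 8 s^2 is dropped. Beyond \<open>M\<close> the term 4 r^2
    s^4 outweighs c s^3.\<close>
  define c where "c = 8 * r\<^sup>2 + 4 + 2 * real CARD('n)"
  define M where "M = c / (4 * r\<^sup>2) + 1"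
  have c0: "c \<ge> 0" and M1: "M \<ge> 1" by (auto simp: c_def M_def)
  have key: "c * s^3 - 4 * r\<^sup>2 * s^4 \<le> c * M^3" if "s > 0" for s
  proof (cases "s \<ge> M")
    case True
    then have "c / (4 * r\<^sup>2) \<le> s" by (simp add: M_def)
    then have "c \<le> 4 * r\<^sup>2 * s" using r by (simp add: field_simps)
    then have "c * s^3 \<le> 4 * r\<^sup>2 * s * s^3" using that by (intro mult_right_mono) auto
    moreover have "0 \<le> c * M^3" using c0 M1 by simp
    ultimately show ?thesis by (simp add: eval_nat_numeral)
  next
    case False
    then have "c * s^3 \<le> c * M^3" using c0 that by (intro mult_left_mono power_mono) auto
    moreover have "0 \<le> 4 * r\<^sup>2 * s^4" by simp
    ultimately show ?thesis by linarith
  qed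
  have "- laplacian (bump a r) x \<le> (c * M^3 + c) * bump a r x" for x
  proof (cases "r\<^sup>2 - (x - a) \<bullet> (x - a) > 0")
    case False
    then show ?thesis unfolding laplacian_bump bump_def by (simp add: flat_def)
  next
    case True
    define s where "s = 1 / (r\<^sup>2 - (x - a) \<bullet> (x - a))"
    have s: "s > 0" "(x - a) \<bullet> (x - a) = r\<^sup>2 - 1/s" using True by (auto simp: s_def)
    have "- laplacian (bump a r) x = - (4 * (r\<^sup>2 - 1/s) * (s^4 - 2 * s^3) - 2 * real CARD('n) * s^2) * bump a r x"
    proof -
      define Y b where "Y = (x - a) \<bullet> (x - a)" and "b = flat (flat_poly 0) (r\<^sup>2 - Y)"
      have "- laplacian (bump a r) x = - (4 * Y * ((s^4 - 2 * s^3) * b) - 2 * real CARD('n) * (s^2 * b))"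
        unfolding laplacian_bump flat_Suc0 flat_2 s_def Y_def b_def by (rule refl)
      moreover have "bump a r x = b" by (simp only: bump_def b_def Y_def)
      moreover have "Y = r\<^sup>2 - 1/s" using s(2) by (simp only: Y_def)
      ultimately show ?thesis by (simp only: left_diff_distrib mult.assoc mult_minus_left)
    qed
    also have "\<dots> \<le> (c * M^3 + c) * bump a r x"
    proof (rule mult_right_mono[OF _ bump_bounds(1)])
      have eq: "- (4 * (r\<^sup>2 - 1/s) * (s^4 - 2 * s^3) - 2 * real CARD('n) * s^2)
         = (8 * r\<^sup>2 + 4) * s^3 + 2 * real CARD('n) * s^2 - 8 * s^2 - 4 * r\<^sup>2 * s^4"
      proof -
        define w where "w = 1/s"
        have "w * s^4 = s^3" "w * s^3 = s^2" using s(1) by (simp_all add: w_def eval_nat_numeral)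
        then show ?thesis unfolding w_def[symmetric] by algebra
      qed
      have "s^2 \<le> s^3 + 1" 
      proof (cases "s \<ge> 1")
        case True then show ?thesis using power_increasing[of 2 3 s] by simp
      next
        case False then have "s^2 \<le> 1" using s by (simp add: power_le_one)
        then show ?thesis using s by (simp add: add_increasing)
      qed
      then have "2 * real CARD('n) * s^2 \<le> 2 * real CARD('n) * (s^3 + 1)"
        by (intro mult_left_mono) auto
      moreover have "0 \<le> 8 * s\<^sup>2" by simp
      ultimately have "- (4 * (r\<^sup>2 - 1/s) * (s^4 - 2 * s^3) - 2 * real CARD('n) * s^2) \<le> c * s^3 - 4 * r\<^sup>2 * s^4 + 2 * real CARD('n)"
        unfolding eq c_def distrib_left distrib_right by linarith
      also have "\<dots> \<le> c * M^3 + c" using key[OF s(1)] by (simp add: c_def add_mono)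
      finally show "- (4 * (r\<^sup>2 - 1/s) * (s^4 - 2 * s^3) - 2 * real CARD('n) * s^2) \<le> c * M^3 + c" .
    qed
    finally show ?thesis .
  qed
  moreover have "c * M^3 + c \<ge> 0" using c0 M1 by simp
  ultimately show ?thesis using that by blast
qed

section \<open>Square-integrable functions\<close>

text \<open>Square integrability as in \<open>L2_on\<close>, but over any measure, so that
  functions, gradients and pairs of the two share one set of lemmas.\<close>

definition sqint :: "'a measure \<Rightarrow> ('a \<Rightarrow> 'b::euclidean_space) \<Rightarrow> bool" where
  "sqint M f \<longleftrightarrow> f \<in> borel_measurable M \<and> integrable M (\<lambda>x. (norm (f x))\<^sup>2)"

lemma sqint_measurable: "sqint M f \<Longrightarrow> f \<in> borel_measurable M"
  and sqint_integrable: "sqint M f \<Longrightarrow> integrable M (\<lambda>x. (norm (f x))\<^sup>2)"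
  by (simp_all add: sqint_def)

lemma sqint_bound:
  assumes "sqint M g" "f \<in> borel_measurable M" "AE x in M. norm (f x) \<le> norm (g x)"
  shows "sqint M f"
proof -
  have "integrable M (\<lambda>x. (norm (f x))\<^sup>2)"
    by (rule Bochner_Integration.integrable_bound[OF sqint_integrable[OF assms(1)]])
      (use assms in \<open>auto elim!: eventually_mono intro: power_mono\<close>)
  then show ?thesis using assms by (simp add: sqint_def)
qed

lemma sqint_scaleR: "sqint M f \<Longrightarrow> sqint M (\<lambda>x. c *\<^sub>R f x)"
  by (auto simp: sqint_def power_mult_distrib)

lemma norm_add_sq_le: "(norm (a + b))\<^sup>2 \<le> 2 * (norm a)\<^sup>2 + 2 * (norm (b::'a::real_inner))\<^sup>2"
proof -
  have "(norm (a + b))\<^sup>2 + (norm (a - b))\<^sup>2 = 2 * (norm a)\<^sup>2 + 2 * (norm b)\<^sup>2"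
    by (simp add: power2_norm_eq_inner inner_add inner_diff)
  with zero_le_power2[of "norm (a - b)"] show ?thesis by linarith
qed

lemma abs_inner_le: "\<bar>a \<bullet> b\<bar> \<le> (norm a)\<^sup>2 + (norm (b::'a::real_inner))\<^sup>2"
proof -
  have "\<bar>a \<bullet> b\<bar> \<le> norm a * norm b" by (rule Cauchy_Schwarz_ineq2)
  also have "\<dots> \<le> (norm a)\<^sup>2 + (norm b)\<^sup>2"
    using sum_squares_bound[of "norm a" "norm b"] mult_nonneg_nonneg[OF norm_ge_zero norm_ge_zero, of a b] by linarith
  finally show ?thesis .
qed

lemma sqint_add:
  assumes "sqint M f" "sqint M g" shows "sqint M (\<lambda>x. f x + g x)"
proof -
  have "integrable M (\<lambda>x. (norm (f x + g x))\<^sup>2)"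
    by (rule Bochner_Integration.integrable_bound[of _ "\<lambda>x. 2 * (norm (f x))\<^sup>2 + 2 * (norm (g x))\<^sup>2"])
      (use assms norm_add_sq_le in \<open>auto simp: sqint_def\<close>)
  then show ?thesis using assms by (auto simp: sqint_def)
qed

lemma sqint_diff:
  assumes "sqint M f" "sqint M g" shows "sqint M (\<lambda>x. f x - g x)"
  using sqint_add[OF assms(1) sqint_scaleR[OF assms(2), of "-1"]] by simp

lemma sqint_inner:
  assumes "sqint M f" "sqint M g" shows "integrable M (\<lambda>x. f x \<bullet> g x)"
  by (rule Bochner_Integration.integrable_bound[of _ "\<lambda>x. (norm (f x))\<^sup>2 + (norm (g x))\<^sup>2"])
    (use assms abs_inner_le in \<open>auto simp: sqint_def\<close>)

lemma sqint_mult: "sqint M f \<Longrightarrow> sqint M g \<Longrightarrow> integrable M (\<lambda>x. f x * g x :: real)"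
  using sqint_inner[of M f g] by simp

lemma norm_fst_snd_le: "norm (fst p) \<le> norm p" "norm (snd p) \<le> norm p"
  by (cases p; simp add: norm_fst_le norm_snd_le)+

lemma sqint_fst: "sqint M F \<Longrightarrow> sqint M (\<lambda>x. fst (F x))"
  by (rule sqint_bound) (auto simp: sqint_def norm_fst_snd_le intro: borel_measurable_continuous_on[OF continuous_on_fst[OF continuous_on_id]])

lemma sqint_snd: "sqint M F \<Longrightarrow> sqint M (\<lambda>x. snd (F x))"
  by (rule sqint_bound) (auto simp: sqint_def norm_fst_snd_le intro: borel_measurable_continuous_on[OF continuous_on_snd[OF continuous_on_id]])

lemma sqint_Pair:
  assumes "sqint M f" "sqint M g" shows "sqint M (\<lambda>x. (f x, g x))"
  using assms by (auto simp: sqint_def norm_Pair)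

lemma sqint_cong_AE:
  assumes "sqint M f" "g \<in> borel_measurable M" "AE x in M. f x = g x"
  shows "sqint M g"
  by (rule sqint_bound[OF assms(1,2)]) (use assms(3) in auto)

lemma integral_norm_add_sq_le:
  assumes "sqint M f" "sqint M g"
  shows "(LINT x|M. (norm (f x + g x))\<^sup>2) \<le> 2 * (LINT x|M. (norm (f x))\<^sup>2) + 2 * (LINT x|M. (norm (g x))\<^sup>2)"
proof -
  have "(LINT x|M. (norm (f x + g x))\<^sup>2) \<le> (LINT x|M. 2 * (norm (f x))\<^sup>2 + 2 * (norm (g x))\<^sup>2)"
    by (rule integral_mono) (use assms norm_add_sq_le sqint_add[OF assms] in \<open>auto simp: sqint_integrable\<close>)
  then show ?thesis using assms by (simp add: sqint_integrable)
qed

lemma fatou_real: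
  fixes g :: "nat \<Rightarrow> 'a \<Rightarrow> real"
  assumes int: "\<And>k. integrable M (g k)" and nn: "\<And>k. AE x in M. 0 \<le> g k x"
    and lim: "AE x in M. (\<lambda>k. g k x) \<longlonglongrightarrow> h x" and h: "h \<in> borel_measurable M"
    and le: "\<And>k. (LINT x|M. g k x) \<le> C"
  shows "integrable M h" "(LINT x|M. h x) \<le> C"
proof -
  have nn': "AE x in M. \<forall>k. 0 \<le> g k x" using nn by (simp add: AE_all_countable)
  have h0: "AE x in M. 0 \<le> h x"
    using nn' lim by eventually_elim (rule LIMSEQ_le_const, auto)
  have C: "0 \<le> C" using le[of 0] integral_nonneg_AE[OF nn[of 0]] by linarith
  have "(\<integral>\<^sup>+x. ennreal (h x) \<partial>M) = (\<integral>\<^sup>+x. liminf (\<lambda>k. ennreal (g k x)) \<partial>M)"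
  proof (rule nn_integral_cong_AE)
    show "AE x in M. ennreal (h x) = liminf (\<lambda>k. ennreal (g k x))"
      using lim
    proof eventually_elim
      case (elim x)
      then have "(\<lambda>k. ennreal (g k x)) \<longlonglongrightarrow> ennreal (h x)" by (rule tendsto_ennrealI)
      then show ?case by (simp add: lim_imp_Liminf)
    qed
  qed
  also have "\<dots> \<le> liminf (\<lambda>k. \<integral>\<^sup>+x. ennreal (g k x) \<partial>M)"
    using int by (intro nn_integral_liminf) auto
  also have "\<dots> \<le> liminf (\<lambda>k::nat. ennreal C)"
    by (intro Liminf_mono eventuallyI) (simp add: nn_integral_eq_integral[OF int nn] le ennreal_leI)
  also have "\<dots> = ennreal C" by (simp add: Liminf_const)
  finally have *: "(\<integral>\<^sup>+x. ennreal (h x) \<partial>M) \<le> ennreal C" .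
  show int_h: "integrable M h"
    by (rule integrableI_nonneg[OF h h0]) (use * in \<open>auto simp: top_unique intro: le_less_trans\<close>)
  show "(LINT x|M. h x) \<le> C"
    using * C by (simp add: nn_integral_eq_integral[OF int_h h0])
qed

lemma sqint_AE_subseq:
  fixes f :: "nat \<Rightarrow> 'a \<Rightarrow> 'b::euclidean_space"
  assumes f: "\<And>n. sqint M (f n)" and g: "sqint M g"
    and lim: "(\<lambda>n. LINT x|M. (norm (f n x - g x))\<^sup>2) \<longlonglongrightarrow> 0"
  obtains r :: "nat \<Rightarrow> nat" where "strict_mono r" "AE x in M. (\<lambda>n. f (r n) x) \<longlonglongrightarrow> g x"
proof -
  have "integrable M (\<lambda>x. (norm (f n x - g x))\<^sup>2)" for n
    using sqint_diff[OF f g] by (rule sqint_integrable)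
  moreover have "(\<lambda>n. LINT x|M. norm ((norm (f n x - g x))\<^sup>2)) \<longlonglongrightarrow> 0" using lim by simp
  ultimately obtain r :: "nat \<Rightarrow> nat" where r: "strict_mono r"
    and AE: "AE x in M. (\<lambda>n. (norm (f (r n) x - g x))\<^sup>2) \<longlonglongrightarrow> 0"
    using tendsto_L1_AE_subseq[of M "\<lambda>n x. (norm (f n x - g x))\<^sup>2"] by auto
  have "AE x in M. (\<lambda>n. f (r n) x) \<longlonglongrightarrow> g x"
    using AE
  proof eventually_elim
    case (elim x)
    from tendsto_real_sqrt[OF this] have "(\<lambda>n. norm (f (r n) x - g x)) \<longlonglongrightarrow> 0" by simp
    then show ?case by (simp add: LIM_zero_iff tendsto_norm_zero_iff)
  qed
  with r show ?thesis using that by blast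
qed

text \<open>The weighted arithmetic-geometric mean bounds a norm d by 2^k d^2 + 2^(-k), so weighted
  squares control the increments themselves. In the completeness proof only squares then need to be
  integrated.\<close>

lemma fast_Cauchy_convergent:
  fixes f :: "nat \<Rightarrow> 'b::banach"
  assumes "summable (\<lambda>k. 2^k * (norm (f (Suc k) - f k))\<^sup>2)"
  shows "convergent f"
proof -
  have le: "norm (f (Suc k) - f k) \<le> 2^k * (norm (f (Suc k) - f k))\<^sup>2 + (1/2)^k" for k
  proof -
    define d where "d = norm (f (Suc k) - f k)"
    have "0 \<le> (2^k * d - 1)\<^sup>2" by simp
    then have "2 * (2^k * d) \<le> (2^k * d)\<^sup>2 + 1" by (simp add: power2_diff)
    moreover have "0 \<le> 2^k * d" by (simp add: d_def)
    ultimately have "2^k * d \<le> 2^k * (2^k * d\<^sup>2 + (1/2)^k)"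
      by (simp add: power2_eq_square algebra_simps power_divide)
    then show ?thesis unfolding d_def[symmetric] by simp
  qed
  have "summable (\<lambda>k. 2^k * (norm (f (Suc k) - f k))\<^sup>2 + (1/2::real)^k)"
    by (intro summable_add assms summable_geometric) auto
  then have "summable (\<lambda>k. f (Suc k) - f k)"
    by (rule summable_comparison_test[rotated]) (use le in auto)
  then have "convergent (\<lambda>n. \<Sum>k<n. f (Suc k) - f k)"
    by (simp add: summable_iff_convergent)
  then have "convergent (\<lambda>n. (f n - f 0) + f 0)"
    by (intro convergent_add convergent_const) (simp add: sum_lessThan_telescope)
  then show ?thesis by simp
qed

text \<open>The Riesz-Fischer argument: a fast subsequence converges almost everywhere because the
  weighted sum of squared increments has finite integral; Fatou's lemma then bounds the distance of
  \<open>f n\<close> to the pointwise limit.\<close>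

lemma sqint_complete:
  fixes f :: "nat \<Rightarrow> 'a \<Rightarrow> 'b::euclidean_space"
  assumes f: "\<And>n. sqint M (f n)"
    and cau: "\<And>e. e > 0 \<Longrightarrow> \<exists>N. \<forall>m\<ge>N. \<forall>n\<ge>N. (LINT x|M. (norm (f m x - f n x))\<^sup>2) < e"
  obtains g where "sqint M g" "(\<lambda>n. LINT x|M. (norm (f n x - g x))\<^sup>2) \<longlonglongrightarrow> 0"
proof -
  have dint: "integrable M (\<lambda>x. (norm (f m x - f n x))\<^sup>2)" for m n
    using sqint_diff[OF f f] by (rule sqint_integrable)
  have [measurable]: "f n \<in> borel_measurable M" for n using f by (simp add: sqint_def)
  \<comment> \<open>The rate 4^(-k) leaves 2^(-k) after multiplication by the weight 2^k.\<close>
  have "\<forall>k. \<exists>N. \<forall>m\<ge>N. \<forall>n\<ge>N. (LINT x|M. (norm (f m x - f n x))\<^sup>2) < (1/4)^k"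
    using cau by simp
  from choice[OF this] obtain N
    where N: "\<forall>k. \<forall>m\<ge>N k. \<forall>n\<ge>N k. (LINT x|M. (norm (f m x - f n x))\<^sup>2) < (1/4)^k" ..
  \<comment> \<open>Partial sums dominate \<open>N k\<close>, and the summand \<open>k\<close> makes
    the sequence strictly increasing.\<close>
  define r where "r k = (\<Sum>j\<le>k. N j) + k" for k
  have rN: "r k \<ge> N k" for k unfolding r_def by (simp add: member_le_sum trans_le_add1)
  have r: "strict_mono r" by (rule strict_monoI_Suc) (simp add: r_def)
  have "(\<integral>\<^sup>+x. (\<Sum>k. ennreal (2^k * (norm (f (r (Suc k)) x - f (r k) x))\<^sup>2)) \<partial>M)
      = (\<Sum>k. \<integral>\<^sup>+x. ennreal (2^k * (norm (f (r (Suc k)) x - f (r k) x))\<^sup>2) \<partial>M)"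
    by (rule nn_integral_suminf) measurable
  also have "\<dots> = (\<Sum>k. ennreal (2^k * (LINT x|M. (norm (f (r (Suc k)) x - f (r k) x))\<^sup>2)))"
    by (subst nn_integral_eq_integral) (auto intro!: dint)
  also have "\<dots> \<le> (\<Sum>k. ennreal ((1/2)^k))"
  proof (intro suminf_le ennreal_leI)
    fix k
    have "r (Suc k) \<ge> r k" using r by (simp add: strict_mono_leD)
    then have "2^k * (LINT x|M. (norm (f (r (Suc k)) x - f (r k) x))\<^sup>2) \<le> 2^k * (1/4)^k"
      using N rN[of k] by (intro mult_left_mono) (auto intro!: less_imp_le)
    also have "\<dots> = (1/2::real)^k" by (simp add: power_mult_distrib[symmetric])
    finally show "2^k * (LINT x|M. (norm (f (r (Suc k)) x - f (r k) x))\<^sup>2) \<le> (1/2)^k" .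
  qed auto
  also have "\<dots> < \<infinity>"
    by (simp add: ennreal_suminf_neq_top summable_geometric less_top)
  finally have "AE x in M. (\<Sum>k. ennreal (2^k * (norm (f (r (Suc k)) x - f (r k) x))\<^sup>2)) \<noteq> \<infinity>"
    by (intro nn_integral_PInf_AE) auto
  then have conv: "AE x in M. convergent (\<lambda>k. f (r k) x)"
    by eventually_elim (auto intro!: fast_Cauchy_convergent summable_suminf_not_top)
  define g where "g x = lim (\<lambda>k. f (r k) x)" for x
  have g_meas [measurable]: "g \<in> borel_measurable M"
    unfolding g_def by (rule borel_measurable_lim_metric) measurable
  have lim: "AE x in M. (\<lambda>k. f (r k) x) \<longlonglongrightarrow> g x"
    using conv by eventually_elim (simp add: g_def convergent_LIMSEQ_iff)
  have est: "integrable M (\<lambda>x. (norm (f n x - g x))\<^sup>2)" "(LINT x|M. (norm (f n x - g x))\<^sup>2) \<le> e"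
    if "e > 0" and n: "n \<ge> K" and K: "\<forall>m\<ge>K. \<forall>n\<ge>K. (LINT x|M. (norm (f m x - f n x))\<^sup>2) < e" for n K e
  proof -
    have L: "AE x in M. (\<lambda>k. (norm (f n x - f (r (k + K)) x))\<^sup>2) \<longlonglongrightarrow> (norm (f n x - g x))\<^sup>2"
      using lim
    proof eventually_elim
      case (elim x)
      then show ?case
        by (intro tendsto_intros LIMSEQ_ignore_initial_segment[where f = "\<lambda>k. f (r k) x"])
    qed
    have "r (k + K) \<ge> K" for k using seq_suble[OF r, of "k + K"] by simp
    then have B: "(LINT x|M. (norm (f n x - f (r (k + K)) x))\<^sup>2) \<le> e" for k
      using K n by (meson less_imp_le)
    show "integrable M (\<lambda>x. (norm (f n x - g x))\<^sup>2)" "(LINT x|M. (norm (f n x - g x))\<^sup>2) \<le> e"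
      using fatou_real[OF dint[of n "r (k + K)" for k] _ L _ B] by simp_all
  qed
  have "sqint M g"
  proof -
    obtain K where K: "\<forall>m\<ge>K. \<forall>n\<ge>K. (LINT x|M. (norm (f m x - f n x))\<^sup>2) < 1" using cau[of 1] by auto
    have "sqint M (\<lambda>x. f K x - g x)" unfolding sqint_def using est(1)[OF _ _ K, of K] by simp
    from sqint_diff[OF f[of K] this] show ?thesis by simp
  qed
  moreover have "(\<lambda>n. LINT x|M. (norm (f n x - g x))\<^sup>2) \<longlonglongrightarrow> 0"
  proof (rule LIMSEQ_I)
    fix e :: real assume "e > 0"
    then obtain K where K: "\<forall>m\<ge>K. \<forall>n\<ge>K. (LINT x|M. (norm (f m x - f n x))\<^sup>2) < e / 2" using cau[of "e/2"] by auto
    then show "\<exists>no. \<forall>n\<ge>no. norm ((LINT x|M. (norm (f n x - g x))\<^sup>2) - 0) < e"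
      using est(2)[OF _ _ K] \<open>e > 0\<close> by (intro exI[of _ K]) (auto simp: le_less_trans[of _ "e/2"])
  qed
  ultimately show ?thesis using that by blast
qed

text \<open>The common source of the Cauchy-Schwarz inequalities and of the variational inequality
  in the Riesz representation. A negative leading coefficient is refuted by a large
  \<open>t\<close>.\<close>

lemma quadratic_nonneg_discrim:
  fixes a b c :: real
  assumes "\<And>t. 0 \<le> a + 2 * t * b + t\<^sup>2 * c"
  shows "b\<^sup>2 \<le> a * c"
proof (cases "c = 0")
  case True
  have "b = 0"
  proof (rule ccontr)
    assume "b \<noteq> 0"
    then have "2 * (- (a + 1) / (2 * b)) * b = - (a + 1)" by simp
    then show False using assms[of "- (a + 1) / (2 * b)"] True by simp
  qed
  then show ?thesis using True by simp
next
  case False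
  have "c > 0"
  proof (rule ccontr)
    assume "\<not> c > 0"
    then have c: "c < 0" using False by simp
    define t where "t = (\<bar>a\<bar> + 2 * \<bar>b\<bar> + 1) / (- c) + 1"
    have t: "t \<ge> 1" "- c * t \<ge> \<bar>a\<bar> + 2 * \<bar>b\<bar> + 1" using c by (auto simp: t_def field_simps)
    have "t * (\<bar>a\<bar> + 2 * \<bar>b\<bar> + 1) \<le> t * (- c * t)" using t by (intro mult_left_mono) auto
    moreover have "t * (\<bar>a\<bar> + 2 * \<bar>b\<bar> + 1) \<ge> \<bar>a\<bar> + 2 * t * \<bar>b\<bar> + 1"
      using mult_right_mono[OF t(1), of "\<bar>a\<bar> + 1"] by (simp add: algebra_simps)
    moreover have "t * b \<le> t * \<bar>b\<bar>" using t by (intro mult_left_mono) auto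
    ultimately show False using assms[of t] by (simp add: power2_eq_square algebra_simps)
  qed
  then show ?thesis using assms[of "- b / c"] by (simp add: field_simps power2_eq_square)
qed

section \<open>Test functions\<close>

lemma test_functionsI:
  assumes "smooth_on UNIV \<phi>" "compact K" "K \<subseteq> \<Omega>" "\<And>x. x \<notin> K \<Longrightarrow> \<phi> x = 0"
  shows "\<phi> \<in> test_functions \<Omega>"
proof -
  have "closure {x. \<phi> x \<noteq> 0} \<subseteq> K"
    using assms by (intro closure_minimal compact_imp_closed) auto
  then show ?thesis
    using assms unfolding test_functions_def
    by (auto intro: compact_closure[THEN iffD2] bounded_subset[OF compact_imp_bounded] closure_subset[THEN subsetD])
qed

lemma test_smooth: "\<phi> \<in> test_functions \<Omega> \<Longrightarrow> smooth_on UNIV \<phi>"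
  by (simp add: test_functions_def)

lemma test_supportE:
  assumes "\<phi> \<in> test_functions \<Omega>"
  obtains K where "compact K" "K \<subseteq> \<Omega>" "\<And>x. x \<notin> K \<Longrightarrow> \<phi> x = 0" "\<And>x v. x \<notin> K \<Longrightarrow> frechet_derivative \<phi> (at x) v = 0"
proof -
  define K where "K = closure {x. \<phi> x \<noteq> 0}"
  have K: "compact K" "K \<subseteq> \<Omega>" using assms by (auto simp: test_functions_def K_def)
  have 0: "\<phi> x = 0" if "x \<notin> K" for x
    using that closure_subset[of "{x. \<phi> x \<noteq> 0}"] unfolding K_def by auto
  have "frechet_derivative \<phi> (at x) v = 0" if x: "x \<notin> K" for x v
  proof -
    have "(\<phi> has_derivative (\<lambda>v. 0)) (at x)"
    proof (rule has_derivative_transform_within_open[of "\<lambda>x. 0" _ _ _ "- K"])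
      show "open (- K)" using K(1) by (simp add: compact_imp_closed open_Compl)
    qed (use x 0 in auto)
    from frechet_derivative_at[OF this, symmetric] show ?thesis by simp
  qed
  with K 0 that show ?thesis by blast
qed

lemma test_functions_mono: "\<phi> \<in> test_functions \<Omega> \<Longrightarrow> \<Omega> \<subseteq> \<Omega>' \<Longrightarrow> \<phi> \<in> test_functions \<Omega>'"
  by (auto simp: test_functions_def)

lemma test_mult_smooth:
  assumes "\<phi> \<in> test_functions \<Omega>" "smooth_on UNIV \<psi>"
  shows "(\<lambda>x. \<psi> x * \<phi> x) \<in> test_functions \<Omega>"
  using assms(1)
  by (elim test_supportE) (rule test_functionsI, auto intro: smooth_on_mult test_smooth assms)

lemma test_add_scale:
  assumes "\<phi> \<in> test_functions \<Omega>" "\<psi> \<in> test_functions \<Omega>"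
  shows "(\<lambda>x. \<phi> x + c * \<psi> x) \<in> test_functions \<Omega>"
proof -
  obtain K where K: "compact K" "K \<subseteq> \<Omega>" "\<And>x. x \<notin> K \<Longrightarrow> \<phi> x = 0" using test_supportE[OF assms(1)] by metis
  obtain L where L: "compact L" "L \<subseteq> \<Omega>" "\<And>x. x \<notin> L \<Longrightarrow> \<psi> x = 0" using test_supportE[OF assms(2)] by metis
  show ?thesis
    by (rule test_functionsI[where K = "K \<union> L"])
      (use K L in \<open>auto intro!: smooth_on_add smooth_on_mult smooth_on_const test_smooth[OF assms(1)] test_smooth[OF assms(2)]\<close>)
qed

lemma test_frechet:
  assumes "\<phi> \<in> test_functions \<Omega>"
  shows "(\<lambda>x. frechet_derivative \<phi> (at x) v) \<in> test_functions \<Omega>"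
  using assms
  by (elim test_supportE) (rule test_functionsI, auto intro: smooth_on_frechet test_smooth[OF assms])

lemma continuous_on_test: "\<phi> \<in> test_functions \<Omega> \<Longrightarrow> continuous_on UNIV \<phi>"
  by (simp add: smooth_on_imp_continuous_on test_smooth)

section \<open>Integrability of compactly supported functions\<close>

lemma compact_support_integrable:
  fixes f :: "'a::euclidean_space \<Rightarrow> 'b::{banach, second_countable_topology}"
  assumes "continuous_on UNIV f" "compact K" "\<And>x. x \<notin> K \<Longrightarrow> f x = 0"
  shows "integrable lborel f" "integrable lebesgue f"
proof -
  have "integrable lborel (\<lambda>x. indicator K x *\<^sub>R f x)"
    by (rule borel_integrable_compact) (use assms in \<open>auto intro: continuous_on_subset\<close>)
  moreover have "(\<lambda>x. indicator K x *\<^sub>R f x) = f" using assms(3) by (auto simp: indicator_def)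
  ultimately show *: "integrable lborel f" by simp
  show "integrable lebesgue f"
    using * borel_measurable_continuous_onI[OF assms(1)] by (simp add: integrable_completion)
qed

lemma integrable_lebesgue_on_subset:
  fixes f :: "'a::euclidean_space \<Rightarrow> 'b::{banach, second_countable_topology}"
  assumes "integrable lebesgue f" "S \<in> sets lebesgue"
  shows "integrable (lebesgue_on S) f"
  using integrable_mult_indicator[OF assms(2,1)] assms(2)
  by (simp add: integrable_restrict_space)

lemma compact_support_sqint:
  fixes f :: "'a::euclidean_space \<Rightarrow> 'b::euclidean_space"
  assumes "continuous_on UNIV f" "compact K" "\<And>x. x \<notin> K \<Longrightarrow> f x = 0" "S \<in> sets lebesgue"
  shows "sqint (lebesgue_on S) f"
  unfolding sqint_def
proof
  show "f \<in> borel_measurable (lebesgue_on S)"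
    using assms by (intro continuous_imp_measurable_on_sets_lebesgue continuous_on_subset[OF assms(1)]) auto
  show "integrable (lebesgue_on S) (\<lambda>x. (norm (f x))\<^sup>2)"
    by (rule integrable_lebesgue_on_subset[OF compact_support_integrable(2)])
      (use assms in \<open>auto intro!: continuous_intros\<close>)
qed

text \<open>The pair is chosen because its L^2 norm on a set is the Sobolev norm of \<phi>
  there.\<close>

definition jet :: "(real^'n \<Rightarrow> real) \<Rightarrow> real^'n \<Rightarrow> real \<times> (real^'n)" where
  "jet \<phi> x = (\<phi> x, grad \<phi> x)"

lemma fst_jet [simp]: "fst (jet \<phi> x) = \<phi> x" and snd_jet [simp]: "snd (jet \<phi> x) = grad \<phi> x"
  by (simp_all add: jet_def)

lemma test_support_jetE:
  assumes "\<phi> \<in> test_functions \<Omega>"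
  obtains K where "compact K" "K \<subseteq> \<Omega>" "\<And>x. x \<notin> K \<Longrightarrow> \<phi> x = 0" "\<And>x. x \<notin> K \<Longrightarrow> grad \<phi> x = 0" 
  using assms by (elim test_supportE) (auto simp: vec_eq_iff)

lemma continuous_on_jet: "\<phi> \<in> test_functions \<Omega> \<Longrightarrow> continuous_on UNIV (jet \<phi>)"
  unfolding jet_def
  by (intro continuous_on_Pair continuous_on_test continuous_on_grad test_smooth)

lemma test_jet_sqint:
  assumes "\<phi> \<in> test_functions \<Omega>" "S \<in> sets lebesgue"
  shows "sqint (lebesgue_on S) (jet \<phi>)"
  using assms(1)
  by (elim test_support_jetE) (rule compact_support_sqint, auto simp: jet_def[abs_def] zero_prod_def
    intro!: assms(2) continuous_on_jet[OF assms(1), unfolded jet_def[abs_def]])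

section \<open>Integration by parts on the whole space\<close>

lemma lborel_integral_translate:
  fixes f :: "'a::euclidean_space \<Rightarrow> real"
  assumes "f \<in> borel_measurable borel"
  shows "(LINT x|lborel. f (c + x)) = (LINT x|lborel. f x)"
proof -
  have "(LINT x|lborel. f x) = (LINT x|distr lborel borel ((+) c). f x)"
    by (simp add: lborel_distr_plus)
  also have "\<dots> = (LINT x|lborel. f (c + x))" using assms by (simp add: integral_distr)
  finally show ?thesis by simp
qed

text \<open>The integral of a difference quotient vanishes by translation invariance, and difference
  quotients converge boundedly.\<close>

lemma integral_directional_derivative:
  fixes \<phi> :: "real^'n \<Rightarrow> real"
  assumes \<phi>: "\<phi> \<in> test_functions UNIV"
  shows "(LINT x|lebesgue. frechet_derivative \<phi> (at x) v) = 0"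
proof -
  note sm = test_smooth[OF \<phi>]
  obtain K where K: "compact K" "\<And>x. x \<notin> K \<Longrightarrow> \<phi> x = 0" "\<And>x. x \<notin> K \<Longrightarrow> grad \<phi> x = 0"
    using test_support_jetE[OF \<phi>] by metis
  have "bounded (grad \<phi> ` K)"
    by (intro compact_imp_bounded compact_continuous_image continuous_on_subset[OF continuous_on_grad[OF sm]] K) auto
  then obtain B where B: "B > 0" "\<And>x. x \<in> K \<Longrightarrow> norm (grad \<phi> x) \<le> B" by (auto simp: bounded_pos)
  have gB: "norm (grad \<phi> x) \<le> B" for x using B K(3)[of x] by (cases "x \<in> K") auto
  have Lip: "\<bar>\<phi> y - \<phi> x\<bar> \<le> B * norm (y - x)" for x y
  proof -
    have "norm (\<phi> y - \<phi> x) \<le> B * norm (y - x)"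
    proof (rule differentiable_bound[of UNIV \<phi> "\<lambda>x v. grad \<phi> x \<bullet> v"])
      show "onorm (\<lambda>v. grad \<phi> x \<bullet> v) \<le> B" for x
      proof (rule onorm_bound)
        fix w have "norm (grad \<phi> x \<bullet> w) \<le> norm (grad \<phi> x) * norm w" by (simp add: Cauchy_Schwarz_ineq2)
        also have "\<dots> \<le> B * norm w" by (intro mult_right_mono gB) auto
        finally show "norm (grad \<phi> x \<bullet> w) \<le> B * norm w" .
      qed (use B in simp)
    qed (auto intro: has_derivative_grad[OF sm])
    then show ?thesis by simp
  qed
  define t where "t n = 1 / real (Suc n)" for n
  have t: "t n > 0" "t n \<le> 1" for n by (auto simp: t_def)
  \<comment> \<open>The support thickened by the length of \<open>v\<close>: it contains the
    supports of all difference quotients, as the steps \<open>t n\<close> are at most 1. Its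
    indicator times the Lipschitz bound is the dominating function.\<close>
  define K' where "K' = {x + y |x y. x \<in> K \<and> y \<in> cball 0 (norm v)}"
  have K': "compact K'" unfolding K'_def by (rule compact_sums) (use K in auto)
  have KK': "x \<in> K'" if "x + s *\<^sub>R v \<in> K" "0 \<le> s" "s \<le> 1" for x s
  proof -
    have "x = (x + s *\<^sub>R v) + (- s *\<^sub>R v)" by simp
    moreover have "norm (- s *\<^sub>R v) \<le> norm v" using that by (simp add: mult_left_le_one_le)
    ultimately show ?thesis unfolding K'_def using that(1) by (metis (mono_tags, lifting) mem_Collect_eq mem_cball_0)
  qed
  define q where "q n x = (\<phi> (t n *\<^sub>R v + x) - \<phi> x) / t n" for n x
  have cq: "continuous_on UNIV (q n)" for n
    unfolding q_def using t(1)[of n]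
    by (intro continuous_intros continuous_on_compose2[OF continuous_on_test[OF \<phi>]]) auto
  have int\<phi>: "integrable lborel \<phi>"
    by (rule compact_support_integrable(1)[OF continuous_on_test[OF \<phi>] K(1,2)])
  have m\<phi>: "\<phi> \<in> borel_measurable borel" by (rule borel_measurable_continuous_onI[OF continuous_on_test[OF \<phi>]])
  have int\<phi>': "integrable lborel (\<lambda>x. \<phi> (c + x))" for c
    using int\<phi> m\<phi> integrable_distr_eq[of "(+) c" lborel borel \<phi>] by (simp add: lborel_distr_plus)
  have q0: "(LINT x|lborel. q n x) = 0" for n
    unfolding q_def using int\<phi> int\<phi>' lborel_integral_translate[OF m\<phi>] by simp
  have lim: "(\<lambda>n. q n x) \<longlonglongrightarrow> frechet_derivative \<phi> (at x) v" for x
  proof -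
    have "((\<lambda>s. \<phi> (x + s *\<^sub>R v)) has_derivative (\<lambda>s. grad \<phi> x \<bullet> (s *\<^sub>R v))) (at 0)"
    proof (rule has_derivative_compose[where f = "\<lambda>s. x + s *\<^sub>R v" and g = \<phi>])
      show "((\<lambda>s. x + s *\<^sub>R v) has_derivative (\<lambda>s. s *\<^sub>R v)) (at 0)"
        by (auto intro!: derivative_eq_intros)
      show "(\<phi> has_derivative (\<bullet>) (grad \<phi> x)) (at (x + 0 *\<^sub>R v))" using has_derivative_grad[OF sm] by simp
    qed
    then have "((\<lambda>s. \<phi> (x + s *\<^sub>R v)) has_real_derivative (grad \<phi> x \<bullet> v)) (at 0)"
      by (simp add: has_field_derivative_def mult.commute[of _ "grad \<phi> x \<bullet> v"])
    then have "((\<lambda>h. (\<phi> (x + h *\<^sub>R v) - \<phi> x) / h) \<longlongrightarrow> grad \<phi> x \<bullet> v) (at 0)"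
      by (simp add: DERIV_def)
    moreover have "filterlim t (at 0) sequentially"
      unfolding t_def filterlim_at using LIMSEQ_inverse_real_of_nat by (auto simp: inverse_eq_divide)
    ultimately have "(\<lambda>n. (\<phi> (x + t n *\<^sub>R v) - \<phi> x) / t n) \<longlonglongrightarrow> grad \<phi> x \<bullet> v"
      by (rule filterlim_compose)
    moreover have "frechet_derivative \<phi> (at x) v = grad \<phi> x \<bullet> v"
      using sm smooth_on_imp_has_derivative by (intro frechet_eq_grad differentiableI)
    ultimately show ?thesis by (simp add: q_def add.commute)
  qed
  have cD: "continuous_on UNIV (\<lambda>x. frechet_derivative \<phi> (at x) v)"
    by (rule continuous_on_test[OF test_frechet[OF \<phi>]])
  have "(\<lambda>n. LINT x|lborel. q n x) \<longlonglongrightarrow> (LINT x|lborel. frechet_derivative \<phi> (at x) v)"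
  proof (rule integral_dominated_convergence[where w = "\<lambda>x. indicator K' x *\<^sub>R (B * norm v)"])
    show "integrable lborel (\<lambda>x. indicator K' x *\<^sub>R (B * norm v))"
      by (rule borel_integrable_compact[OF K']) auto
    show "AE x in lborel. norm (q n x) \<le> indicator K' x *\<^sub>R (B * norm v)" for n
    proof (rule AE_I2)
      fix x
      show "norm (q n x) \<le> indicator K' x *\<^sub>R (B * norm v)"
      proof (cases "x \<in> K'")
        case True
        have "\<bar>\<phi> (t n *\<^sub>R v + x) - \<phi> x\<bar> \<le> B * (t n * norm v)" using Lip[of "t n *\<^sub>R v + x" x] t[of n] by simp
        then show ?thesis using True t[of n] by (simp add: q_def field_simps)
      next
        case False
        then have "x + t n *\<^sub>R v \<notin> K" "x \<notin> K" using KK'[of x "t n"] KK'[of x 0] t[of n] by auto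
        then show ?thesis using K(2) False by (simp add: q_def add.commute)
      qed
    qed
  qed (use lim borel_measurable_continuous_onI[OF cq] borel_measurable_continuous_onI[OF cD] in auto)
  then have "(LINT x|lborel. frechet_derivative \<phi> (at x) v) = 0"
    using q0 by (simp add: LIMSEQ_const_iff)
  then show ?thesis
    using borel_measurable_continuous_onI[OF cD] by (simp add: integral_completion)
qed

lemma frechet_mult:
  fixes \<phi> \<psi> :: "'a::real_normed_vector \<Rightarrow> real"
  assumes "smooth_on UNIV \<phi>" "smooth_on UNIV \<psi>"
  shows "frechet_derivative (\<lambda>x. \<phi> x * \<psi> x) (at x) v
    = \<phi> x * frechet_derivative \<psi> (at x) v + frechet_derivative \<phi> (at x) v * \<psi> x"
  using frechet_derivative_at[OF has_derivative_mult[OF smooth_on_imp_has_derivative[OF assms(1)]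
      smooth_on_imp_has_derivative[OF assms(2)]], symmetric]
  by simp

lemma integral_on_eq_integral:
  fixes f :: "'a::euclidean_space \<Rightarrow> real"
  assumes "S \<in> sets lebesgue" "\<And>x. x \<notin> S \<Longrightarrow> f x = 0"
  shows "(LINT x|lebesgue_on S. f x) = (LINT x|lebesgue. f x)"
proof -
  have "(\<lambda>x. if x \<in> S then f x else 0) = f" using assms(2) by auto
  then show ?thesis using Lebesgue_Measure.integral_restrict_UNIV[OF assms(1), of f] by simp
qed

text \<open>The product of \<phi> with a test function is again a test function, so the integral of
  its directional derivative vanishes; the product rule splits that integral into the two sides of
  the claim.\<close>

lemma smooth_weak_gradient:
  fixes \<phi> :: "real^'n \<Rightarrow> real"
  assumes sm: "smooth_on UNIV \<phi>" and S: "S \<in> sets lebesgue"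
  shows "is_weak_gradient S \<phi> (grad \<phi>)"
  unfolding is_weak_gradient_def
proof (intro ballI allI)
  fix \<psi> and i :: 'n
  assume \<psi>: "\<psi> \<in> test_functions S"
  then obtain K where K: "compact K" "K \<subseteq> S" "\<And>x. x \<notin> K \<Longrightarrow> \<psi> x = 0"
      "\<And>x v. x \<notin> K \<Longrightarrow> frechet_derivative \<psi> (at x) v = 0" using test_supportE by blast
  let ?v = "axis i (1::real)"
  have t: "(\<lambda>x. \<phi> x * \<psi> x) \<in> test_functions UNIV"
    using test_mult_smooth[OF \<psi> sm] test_functions_mono by blast
  have i1: "integrable lebesgue (\<lambda>x. \<phi> x * frechet_derivative \<psi> (at x) ?v)"
    by (rule compact_support_integrable(2)[OF _ K(1)])
      (auto simp: K(4) intro!: smooth_on_imp_continuous_on smooth_on_mult smooth_on_frechet sm test_smooth[OF \<psi>])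
  have i2: "integrable lebesgue (\<lambda>x. frechet_derivative \<phi> (at x) ?v * \<psi> x)"
    by (rule compact_support_integrable(2)[OF _ K(1)])
      (auto simp: K(3) intro!: smooth_on_imp_continuous_on smooth_on_mult smooth_on_frechet sm test_smooth[OF \<psi>])
  have "0 = (LINT x|lebesgue. \<phi> x * frechet_derivative \<psi> (at x) ?v + frechet_derivative \<phi> (at x) ?v * \<psi> x)"
    using integral_directional_derivative[OF t] by (simp add: frechet_mult[OF sm test_smooth[OF \<psi>]])
  also have "\<dots> = (LINT x|lebesgue. \<phi> x * frechet_derivative \<psi> (at x) ?v)
      + (LINT x|lebesgue. frechet_derivative \<phi> (at x) ?v * \<psi> x)"
    by (rule Bochner_Integration.integral_add[OF i1 i2])
  finally have eq: "(LINT x|lebesgue. \<phi> x * frechet_derivative \<psi> (at x) ?v)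
      = - (LINT x|lebesgue. frechet_derivative \<phi> (at x) ?v * \<psi> x)" by simp
  have "x \<notin> K" if "x \<notin> S" for x using K(2) that by auto
  then show "(LINT x|lebesgue_on S. \<phi> x * frechet_derivative \<psi> (at x) ?v)
      = - (LINT x|lebesgue_on S. grad \<phi> x $ i * \<psi> x)"
    using eq K(3,4) by (simp add: integral_on_eq_integral[OF S])
qed

section \<open>The fundamental lemma of the calculus of variations\<close>

lemma smooth_on_prod:
  fixes f :: "'i \<Rightarrow> 'a::real_normed_vector \<Rightarrow> real"
  assumes "finite I" "\<And>i. i \<in> I \<Longrightarrow> smooth_on UNIV (f i)"
  shows "smooth_on UNIV (\<lambda>x. \<Prod>i\<in>I. f i x)"
  using assms by (induction I rule: finite_induct) (auto intro: smooth_on_const smooth_on_mult)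

text \<open>Boxes are used here instead of balls because the differentiation theorem applied in
  \<open>fundamental_lemma\<close> averages over cubes.\<close>

definition box_bump :: "real^'n \<Rightarrow> real^'n \<Rightarrow> real^'n \<Rightarrow> real" where
  "box_bump a b x = (\<Prod>i\<in>UNIV. flat (flat_poly 0) (x $ i - a $ i) * flat (flat_poly 0) (b $ i - x $ i))"

lemma flat_0_bounds: "0 \<le> flat (flat_poly 0) t" "flat (flat_poly 0) t \<le> 1"
  and flat_0_pos_iff: "flat (flat_poly 0) t > 0 \<longleftrightarrow> t > 0"
  by (auto simp: flat_0)

lemma box_bump_bounds: "0 \<le> box_bump a b x" "box_bump a b x \<le> 1"
  unfolding box_bump_def
  by (intro prod_nonneg prod_le_1 conjI ballI mult_nonneg_nonneg mult_le_one flat_0_bounds)+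

lemma box_bump_pos_iff: "box_bump a b x > 0 \<longleftrightarrow> x \<in> box a b"
proof
  assume "x \<in> box a b"
  then show "box_bump a b x > 0"
    unfolding box_bump_def by (intro prod_pos) (auto simp: mem_box_cart flat_0_pos_iff)
next
  assume pos: "box_bump a b x > 0"
  show "x \<in> box a b"
  proof (rule ccontr)
    assume "x \<notin> box a b"
    then obtain i where "\<not> (a $ i < x $ i \<and> x $ i < b $ i)" by (auto simp: mem_box_cart)
    then have "flat (flat_poly 0) (x $ i - a $ i) * flat (flat_poly 0) (b $ i - x $ i) = 0"
      by (auto simp: flat_def)
    then have "box_bump a b x = 0" unfolding box_bump_def by (intro prod_zero) auto
    with pos show False by simp
  qed
qed

lemma smooth_on_box_bump:
  fixes a b :: "real^'n"
  shows "smooth_on UNIV (box_bump a b)"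
proof -
  have "smooth_on UNIV (\<lambda>x::real^'n. x $ i - a $ i)" "smooth_on UNIV (\<lambda>x::real^'n. b $ i - x $ i)" for i
    using Ck_on_affine[OF bounded_linear_vec_nth, of _ i "- a $ i"]
      Ck_on_affine[OF bounded_linear_minus[OF bounded_linear_vec_nth], of _ i "b $ i"]
    by (simp_all add: smooth_on_def)
  then show ?thesis
    unfolding box_bump_def[abs_def]
    by (intro smooth_on_prod smooth_on_mult smooth_on_compose_chain[where G = "\<lambda>j. flat (flat_poly j)"] flat_chain) auto
qed

lemma integrable_of_square:
  fixes f :: "'a \<Rightarrow> real"
  assumes "f \<in> borel_measurable M" "integrable M (\<lambda>x. (f x)\<^sup>2)" "emeasure M (space M) < \<infinity>"
  shows "integrable M f"
proof (rule Bochner_Integration.integrable_bound[of _ "\<lambda>x. 1 + (f x)\<^sup>2"])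
  interpret finite_measure M by (rule finite_measureI) (use assms in auto)
  show "integrable M (\<lambda>x. 1 + (f x)\<^sup>2)" using assms by auto
  have "\<bar>y\<bar> \<le> 1 + y\<^sup>2" for y :: real
    using zero_le_power2[of "\<bar>y\<bar> - 1"] by (simp add: power2_diff)
  then show "AE x in M. norm (f x) \<le> norm (1 + (f x)\<^sup>2)" by auto
qed fact

text \<open>The functions 1 - (1 - \<open>box_bump\<close>)^(n+1) are test functions that increase
  to the indicator of an open box. Hence \<open>g\<close> has integral zero over every box whose
  closure lies in \<Omega>, and Lebesgue differentiation along shrinking cubes forces
  \<open>g\<close> to vanish almost everywhere.\<close>

lemma fundamental_lemma:
  fixes g :: "real^'n \<Rightarrow> real"
  assumes \<Omega>: "open \<Omega>" and g: "sqint (lebesgue_on \<Omega>) g"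
    and orth: "\<And>\<phi>. \<phi> \<in> test_functions \<Omega> \<Longrightarrow> (LINT x|lebesgue_on \<Omega>. g x * \<phi> x) = 0"
  shows "AE x in lebesgue_on \<Omega>. g x = 0"
proof -
  have \<Omega>s: "\<Omega> \<in> sets lebesgue" using \<Omega> by (simp add: lebesgue_openin)
  \<comment> \<open>The extension by zero is there because the differentiation theorem asks for
    integrability over every box, including those that leave \<Omega>.\<close>
  define f where "f x = (if x \<in> \<Omega> then g x else 0)" for x
  have f_meas: "f \<in> borel_measurable lebesgue"
    using sqint_measurable[OF g] unfolding f_def by (simp add: borel_measurable_if \<Omega>s)
  have "integrable lebesgue (\<lambda>x. if x \<in> \<Omega> then (g x)\<^sup>2 else 0)"
    using sqint_integrable[OF g] by (simp add: Lebesgue_Measure.integrable_restrict_UNIV[OF \<Omega>s])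
  then have f_sq: "integrable lebesgue (\<lambda>x. (f x)\<^sup>2)"
    by (rule Bochner_Integration.integrable_cong[THEN iffD1, rotated 2]) (auto simp: f_def)
  have f_int: "integrable (lebesgue_on S) f" if "S \<in> lmeasurable" for S
  proof (rule integrable_of_square)
    show "f \<in> borel_measurable (lebesgue_on S)" using f_meas by (rule measurable_restrict_space1)
    show "integrable (lebesgue_on S) (\<lambda>x. (f x)\<^sup>2)"
      using f_sq that by (intro integrable_lebesgue_on_subset) auto
    show "emeasure (lebesgue_on S) (space (lebesgue_on S)) < \<infinity>"
      using that fmeasurableD2[OF that]
      by (simp add: emeasure_restrict_space fmeasurableD less_top[symmetric] del: emeasure_completion)
  qed
  have box0: "integral (cbox a b) f = 0" if sub: "cbox a b \<subseteq> \<Omega>" for a b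
  proof -
    define \<phi> where "\<phi> n x = 1 - (1 - box_bump a b x) ^ Suc n" for n x
    have t: "\<phi> n \<in> test_functions \<Omega>" for n
    proof (rule test_functionsI[OF _ compact_cbox sub])
      show "smooth_on UNIV (\<phi> n)"
        unfolding \<phi>_def by (intro smooth_on_diff smooth_on_power smooth_on_const smooth_on_box_bump)
      show "\<phi> n x = 0" if "x \<notin> cbox a b" for x
      proof -
        have "x \<notin> box a b" using that box_subset_cbox by blast
        then have "box_bump a b x = 0" using box_bump_pos_iff[of a b x] box_bump_bounds(1)[of a b x] by simp
        then show ?thesis by (simp add: \<phi>_def)
      qed
    qed
    have bd: "0 \<le> \<phi> n x \<and> \<phi> n x \<le> indicator (box a b) x" for n x
    proof (cases "x \<in> box a b")
      case True
      then show ?thesis using box_bump_bounds[of a b x] by (simp add: \<phi>_def power_le_one del: power_Suc)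
    next
      case False
      then have "box_bump a b x = 0" using box_bump_pos_iff[of a b x] box_bump_bounds(1)[of a b x] by simp
      then show ?thesis using False by (simp add: \<phi>_def)
    qed
    have lim: "(\<lambda>n. \<phi> n x) \<longlonglongrightarrow> indicator (box a b) x" for x
    proof (cases "x \<in> box a b")
      case True
      then have "\<bar>1 - box_bump a b x\<bar> < 1" using box_bump_pos_iff[of a b x] box_bump_bounds[of a b x] by simp
      then have "(\<lambda>n. (1 - box_bump a b x) ^ Suc n) \<longlonglongrightarrow> 0" by (intro LIMSEQ_Suc LIMSEQ_power_zero) auto
      from tendsto_diff[OF tendsto_const[of 1] this] show ?thesis using True by (simp add: \<phi>_def)
    next
      case False
      then have "\<phi> n x = 0" for n using bd[of n x] by simp
      then show ?thesis using False by simp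
    qed
    have boxm: "box a b \<in> sets lebesgue" by simp
    have gi: "integrable lebesgue (\<lambda>x. indicator (box a b) x * f x)"
    proof -
      have "integrable (lebesgue_on (box a b)) f" by (rule f_int) simp
      then show ?thesis using integrable_restrict_space[of "box a b" lebesgue f] by simp
    qed
    have eq: "(LINT x|lebesgue_on \<Omega>. g x * \<phi> n x) = (LINT x|lebesgue. f x * \<phi> n x)" for n
    proof -
      have "(LINT x|lebesgue_on \<Omega>. g x * \<phi> n x) = (LINT x|lebesgue_on \<Omega>. f x * \<phi> n x)"
        by (rule Bochner_Integration.integral_cong) (auto simp: f_def)
      also have "\<dots> = (LINT x|lebesgue. f x * \<phi> n x)" by (rule integral_on_eq_integral[OF \<Omega>s]) (simp add: f_def)
      finally show ?thesis .
    qed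
    have \<phi>m: "\<phi> n \<in> borel_measurable lebesgue" for n
      using borel_measurable_continuous_onI[OF continuous_on_test[OF t[of n]]] by (simp add: measurable_completion)
    have "(\<lambda>n. LINT x|lebesgue. f x * \<phi> n x) \<longlonglongrightarrow> (LINT x|lebesgue. f x * indicator (box a b) x)"
    proof (rule integral_dominated_convergence[where w = "\<lambda>x. \<bar>indicator (box a b) x * f x\<bar>"])
      show "integrable lebesgue (\<lambda>x. \<bar>indicator (box a b) x * f x\<bar>)" using gi by (rule integrable_abs)
      show "AE x in lebesgue. norm (f x * \<phi> n x) \<le> \<bar>indicator (box a b) x * f x\<bar>" for n
      proof (rule AE_I2)
        fix x show "norm (f x * \<phi> n x) \<le> \<bar>indicator (box a b) x * f x\<bar>"
          using bd[of n x] by (simp add: abs_mult mult.commute[of _ "\<bar>f x\<bar>"] mult_left_mono)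
      qed
      show "(\<lambda>x. f x * indicator (box a b) x) \<in> borel_measurable lebesgue"
        using borel_measurable_integrable[OF gi] by (simp add: mult.commute)
    qed (use f_meas \<phi>m lim in \<open>auto intro!: tendsto_intros\<close>)
    then have z: "(LINT x|lebesgue. f x * indicator (box a b) x) = 0"
      using eq orth[OF t] by (simp add: LIMSEQ_const_iff)
    have "integral (cbox a b) f = integral (box a b) f" by (simp add: integral_open_interval)
    also have "\<dots> = (LINT x|lebesgue_on (box a b). f x)"
      by (rule lebesgue_integral_eq_integral[symmetric]) (use f_int in auto)
    also have "\<dots> = (LINT x|lebesgue. f x * indicator (box a b) x)"
      using integral_restrict_space[of "box a b" lebesgue f] by (simp add: mult.commute)
    finally show ?thesis using z by simp
  qed
  have "f integrable_on cbox a b" for a b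
    by (rule integrable_on_lebesgue_on) (use f_int in auto)
  from integrable_ccontinuous_explicit[OF this]
  obtain N where N: "negligible N"
    and avg: "\<And>x e. \<lbrakk>x \<notin> N; 0 < e\<rbrakk> \<Longrightarrow> \<exists>d>0. \<forall>h. 0 < h \<and> h < d \<longrightarrow>
          norm (integral (cbox x (x + h *\<^sub>R One)) f /\<^sub>R h ^ DIM(real^'n) - f x) < e" by metis
  have "g x = 0" if x: "x \<in> \<Omega>" "x \<notin> N" for x
  proof (rule ccontr)
    assume "g x \<noteq> 0"
    then have "\<bar>f x\<bar> > 0" using x by (simp add: f_def)
    from avg[OF x(2) this] obtain d where d: "d > 0"
      and D: "\<And>h. 0 < h \<Longrightarrow> h < d \<Longrightarrow> norm (integral (cbox x (x + h *\<^sub>R One)) f /\<^sub>R h ^ DIM(real^'n) - f x) < \<bar>f x\<bar>" by blast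
    obtain r where r: "r > 0" "ball x r \<subseteq> \<Omega>" using \<Omega> x(1) open_contains_ball by blast
    define C where "C = real DIM(real^'n)"
    have C: "C \<ge> 1" by (simp add: C_def Suc_leI)
    \<comment> \<open>The second bound keeps the cube inside the ball: the sum of the coordinate
      differences of \<open>y\<close> and \<open>x\<close> is at most \<open>h * C\<close>, which is
      less than \<open>r\<close>.\<close>
    define h where "h = min (d/2) (r / (2 * C))"
    have h: "h > 0" "h < d" "h * C < r" using d r C by (auto simp: h_def min_def field_simps)
    have "cbox x (x + h *\<^sub>R One) \<subseteq> ball x r"
    proof
      fix y assume y: "y \<in> cbox x (x + h *\<^sub>R One)"
      have "norm (y - x) \<le> (\<Sum>b\<in>Basis. \<bar>(y - x) \<bullet> b\<bar>)" by (rule norm_le_l1)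
      also have "\<dots> \<le> (\<Sum>b\<in>(Basis::(real^'n) set). h)"
      proof (rule sum_mono)
        fix b :: "real^'n" assume b: "b \<in> Basis"
        then have "x \<bullet> b \<le> y \<bullet> b" "y \<bullet> b \<le> x \<bullet> b + h" using y by (auto simp: mem_box inner_add_left)
        then show "\<bar>(y - x) \<bullet> b\<bar> \<le> h" by (simp add: inner_diff_left)
      qed
      also have "\<dots> = h * C" by (simp add: C_def)
      also have "\<dots> < r" by (rule h)
      finally show "y \<in> ball x r" by (simp add: dist_norm norm_minus_commute)
    qed
    then have "integral (cbox x (x + h *\<^sub>R One)) f = 0" using r(2) by (intro box0) blast
    with D[OF h(1,2)] show False by simp
  qed
  then have "{x \<in> \<Omega>. g x \<noteq> 0} \<subseteq> N" by blast
  then have "negligible {x \<in> \<Omega>. g x \<noteq> 0}" using N negligible_subset by blast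
  then have "{x \<in> \<Omega>. g x \<noteq> 0} \<in> null_sets lebesgue" by (simp add: negligible_iff_null_sets)
  then have "AE x in lebesgue. x \<in> \<Omega> \<longrightarrow> g x = 0" by (rule AE_I') auto
  then show ?thesis by (simp add: AE_restrict_space_iff \<Omega>s)
qed

section \<open>Uniqueness of the weak gradient\<close>

lemma sqint_nth: 
  fixes g :: "'a \<Rightarrow> real^'n"
  assumes "sqint M g" shows "sqint M (\<lambda>x. g x $ i)"
proof (rule sqint_bound[OF assms])
  show "(\<lambda>x. g x $ i) \<in> borel_measurable M"
    using borel_measurable_continuous_on[OF linear_continuous_on[OF bounded_linear_vec_nth] sqint_measurable[OF assms]] .
qed (simp add: component_le_norm_cart)

text \<open>Justifies the choice operator in \<open>wgrad\<close>: every square-integrable weak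
  gradient agrees with the chosen one almost everywhere. The proof applies the fundamental lemma to
  each component of the difference.\<close>

lemma weak_gradient_unique:
  fixes \<Omega> :: "(real^'n) set"
  assumes \<Omega>: "open \<Omega>" and g: "sqint (lebesgue_on \<Omega>) g" "is_weak_gradient \<Omega> u g"
    and h: "sqint (lebesgue_on \<Omega>) h" "is_weak_gradient \<Omega> u h"
  shows "AE x in lebesgue_on \<Omega>. g x = h x"
proof -
  have \<Omega>s: "\<Omega> \<in> sets lebesgue" using \<Omega> by (simp add: lebesgue_openin)
  have "AE x in lebesgue_on \<Omega>. g x $ i - h x $ i = 0" for i
  proof (rule fundamental_lemma[OF \<Omega>])
    show "sqint (lebesgue_on \<Omega>) (\<lambda>x. g x $ i - h x $ i)"
      by (intro sqint_diff sqint_nth g h)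
    fix \<phi> assume \<phi>: "\<phi> \<in> test_functions \<Omega>"
    have \<phi>s: "sqint (lebesgue_on \<Omega>) \<phi>" using sqint_fst[OF test_jet_sqint[OF \<phi> \<Omega>s]] by simp
    have "(LINT x|lebesgue_on \<Omega>. g x $ i * \<phi> x) = (LINT x|lebesgue_on \<Omega>. h x $ i * \<phi> x)"
      using spec[OF bspec[OF g(2)[unfolded is_weak_gradient_def] \<phi>], of i]
        spec[OF bspec[OF h(2)[unfolded is_weak_gradient_def] \<phi>], of i] by simp
    moreover have "integrable (lebesgue_on \<Omega>) (\<lambda>x. g x $ i * \<phi> x)" "integrable (lebesgue_on \<Omega>) (\<lambda>x. h x $ i * \<phi> x)"
      by (intro sqint_mult sqint_nth g h \<phi>s)+
    ultimately show "(LINT x|lebesgue_on \<Omega>. (g x $ i - h x $ i) * \<phi> x) = 0"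
      by (simp add: left_diff_distrib)
  qed
  then have "AE x in lebesgue_on \<Omega>. \<forall>i\<in>UNIV. g x $ i - h x $ i = 0" by (subst AE_finite_all) auto
  then show ?thesis by eventually_elim (simp add: vec_eq_iff)
qed

section \<open>The space of Sobolev functions with zero boundary values\<close>

lemma integral_norm_add_scale:
  assumes "sqint M f" "sqint M g"
  shows "(LINT x|M. (norm (f x + t *\<^sub>R g x))\<^sup>2)
    = (LINT x|M. (norm (f x))\<^sup>2) + 2 * t * (LINT x|M. f x \<bullet> g x) + t\<^sup>2 * (LINT x|M. (norm (g x))\<^sup>2)"
proof -
  have "(norm (f x + t *\<^sub>R g x))\<^sup>2 = (norm (f x))\<^sup>2 + (2 * t) * (f x \<bullet> g x) + t\<^sup>2 * (norm (g x))\<^sup>2" for x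
    unfolding power2_norm_eq_inner
    by (simp add: inner_add inner_commute[of "g x" "f x"] power2_eq_square algebra_simps)
  then show ?thesis
    using assms by (simp add: sqint_integrable sqint_inner)
qed

lemma sqint_Cauchy_Schwarz:
  assumes "sqint M f" "sqint M g"
  shows "(LINT x|M. f x \<bullet> g x)\<^sup>2 \<le> (LINT x|M. (norm (f x))\<^sup>2) * (LINT x|M. (norm (g x))\<^sup>2)"
  by (rule quadratic_nonneg_discrim) (simp add: integral_norm_add_scale[OF assms, symmetric])

lemma tendsto_sqint_inner:
  assumes F: "\<And>n. sqint M (F n)" "sqint M F'" and G: "sqint M G"
    and lim: "(\<lambda>n. LINT x|M. (norm (F n x - F' x))\<^sup>2) \<longlonglongrightarrow> 0"
  shows "(\<lambda>n. LINT x|M. F n x \<bullet> G x) \<longlonglongrightarrow> (LINT x|M. F' x \<bullet> G x)"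
proof -
  have "(\<lambda>n. (LINT x|M. F n x \<bullet> G x) - (LINT x|M. F' x \<bullet> G x)) \<longlonglongrightarrow> 0"
  proof (rule Lim_null_comparison[OF always_eventually])
    let ?b = "\<lambda>n. sqrt ((LINT x|M. (norm (F n x - F' x))\<^sup>2) * (LINT x|M. (norm (G x))\<^sup>2))"
    show "\<forall>n. norm ((LINT x|M. F n x \<bullet> G x) - (LINT x|M. F' x \<bullet> G x)) \<le> ?b n"
    proof
      fix n
      have "(LINT x|M. F n x \<bullet> G x) - (LINT x|M. F' x \<bullet> G x) = (LINT x|M. (F n x - F' x) \<bullet> G x)"
        using F G by (simp add: inner_diff_left sqint_inner)
      also have "\<bar>\<dots>\<bar> \<le> ?b n"
        by (rule real_le_rsqrt) (simp add: sqint_Cauchy_Schwarz sqint_diff F G)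
      finally show "norm ((LINT x|M. F n x \<bullet> G x) - (LINT x|M. F' x \<bullet> G x)) \<le> ?b n" by simp
    qed
    have "?b \<longlonglongrightarrow> sqrt (0 * (LINT x|M. (norm (G x))\<^sup>2))" by (intro tendsto_intros lim)
    then show "?b \<longlonglongrightarrow> 0" by simp
  qed
  then show ?thesis by (simp add: LIM_zero_iff)
qed

lemma tendsto_sqint_norm:
  assumes F: "\<And>n. sqint M (F n)" "sqint M F'"
    and lim: "(\<lambda>n. LINT x|M. (norm (F n x - F' x))\<^sup>2) \<longlonglongrightarrow> 0"
  shows "(\<lambda>n. LINT x|M. (norm (F n x))\<^sup>2) \<longlonglongrightarrow> (LINT x|M. (norm (F' x))\<^sup>2)"
proof -
  have "(LINT x|M. (norm (F n x))\<^sup>2) = (LINT x|M. (norm (F n x - F' x))\<^sup>2)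
      + 2 * (LINT x|M. F n x \<bullet> F' x) - (LINT x|M. (norm (F' x))\<^sup>2)" for n
  proof -
    have "(norm (F n x))\<^sup>2 = (norm (F n x - F' x))\<^sup>2 + 2 * (F n x \<bullet> F' x) - (norm (F' x))\<^sup>2" for x
      by (simp add: power2_norm_eq_inner inner_diff inner_commute)
    then show ?thesis
      using F by (simp add: sqint_integrable sqint_inner sqint_diff)
  qed
  moreover have "(\<lambda>n. (LINT x|M. (norm (F n x - F' x))\<^sup>2) + 2 * (LINT x|M. F n x \<bullet> F' x) - (LINT x|M. (norm (F' x))\<^sup>2))
    \<longlonglongrightarrow> 0 + 2 * (LINT x|M. F' x \<bullet> F' x) - (LINT x|M. (norm (F' x))\<^sup>2)"
    by (intro tendsto_intros lim tendsto_sqint_inner F)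
  ultimately show ?thesis by (simp add: power2_norm_eq_inner)
qed

text \<open>An element is represented as the pair \<open>(u, \<nabla>u)\<close>, so that completeness is inherited from
  \<open>L\<^sup>2\<close>.\<close>

definition W0 :: "(real^'n) set \<Rightarrow> (real^'n \<Rightarrow> real \<times> (real^'n)) set" where
  "W0 \<Omega> = {F. sqint (lebesgue_on \<Omega>) F \<and>
     (\<forall>e>0. \<exists>\<phi>\<in>test_functions \<Omega>. (LINT x|lebesgue_on \<Omega>. (norm (jet \<phi> x - F x))\<^sup>2) < e)}"

lemma W0_sqint: "F \<in> W0 \<Omega> \<Longrightarrow> sqint (lebesgue_on \<Omega>) F"
  by (simp add: W0_def)

lemma W0_approx:
  assumes "F \<in> W0 \<Omega>"
  shows "\<exists>\<phi>. (\<forall>n. \<phi> n \<in> test_functions \<Omega>) \<and>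
    (\<lambda>n. LINT x|lebesgue_on \<Omega>. (norm (jet (\<phi> n) x - F x))\<^sup>2) \<longlonglongrightarrow> 0"
proof -
  have "\<forall>n. \<exists>\<phi>. \<phi> \<in> test_functions \<Omega> \<and> (LINT x|lebesgue_on \<Omega>. (norm (jet \<phi> x - F x))\<^sup>2) < 1 / real (Suc n)"
  proof
    fix n
    have "0 < 1 / real (Suc n)" by simp
    then show "\<exists>\<phi>. \<phi> \<in> test_functions \<Omega> \<and> (LINT x|lebesgue_on \<Omega>. (norm (jet \<phi> x - F x))\<^sup>2) < 1 / real (Suc n)"
      using assms unfolding W0_def by blast
  qed
  from choice[OF this] obtain \<phi> where \<phi>: "\<And>n. \<phi> n \<in> test_functions \<Omega>"
    "\<And>n. (LINT x|lebesgue_on \<Omega>. (norm (jet (\<phi> n) x - F x))\<^sup>2) < 1 / real (Suc n)" by auto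
  have "(\<lambda>n. LINT x|lebesgue_on \<Omega>. (norm (jet (\<phi> n) x - F x))\<^sup>2) \<longlonglongrightarrow> 0"
    by (rule real_tendsto_sandwich[OF _ _ tendsto_const lim_1_over_n[THEN LIMSEQ_Suc]])
      (auto intro!: always_eventually less_imp_le \<phi>(2)[simplified])
  with \<phi>(1) show ?thesis by blast
qed

lemma W0I_seq:
  assumes "sqint (lebesgue_on \<Omega>) F" "\<And>n. \<phi> n \<in> test_functions \<Omega>"
    "(\<lambda>n. LINT x|lebesgue_on \<Omega>. (norm (jet (\<phi> n) x - F x))\<^sup>2) \<longlonglongrightarrow> 0"
  shows "F \<in> W0 \<Omega>"
  unfolding W0_def
proof (intro CollectI conjI allI impI assms(1))
  fix e :: real assume "e > 0"
  from order_tendstoD(2)[OF assms(3) this]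
  obtain n where "(LINT x|lebesgue_on \<Omega>. (norm (jet (\<phi> n) x - F x))\<^sup>2) < e"
    by (auto simp: eventually_sequentially)
  then show "\<exists>\<phi>\<in>test_functions \<Omega>. (LINT x|lebesgue_on \<Omega>. (norm (jet \<phi> x - F x))\<^sup>2) < e"
    using assms(2) by blast
qed

lemma W0_jet: "\<phi> \<in> test_functions \<Omega> \<Longrightarrow> \<Omega> \<in> sets lebesgue \<Longrightarrow> jet \<phi> \<in> W0 \<Omega>"
  by (rule W0I_seq[of _ _ "\<lambda>_. \<phi>"]) (auto intro: test_jet_sqint)

text \<open>Serves to change the representative on a null set, which is how almost-everywhere
  positivity becomes positivity at every point.\<close>

lemma W0_cong_AE:
  assumes \<Omega>: "\<Omega> \<in> sets lebesgue"
    and "F \<in> W0 \<Omega>" "G \<in> borel_measurable (lebesgue_on \<Omega>)" "AE x in lebesgue_on \<Omega>. F x = G x"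
  shows "G \<in> W0 \<Omega>"
proof -
  obtain \<phi> where \<phi>: "\<And>n. \<phi> n \<in> test_functions \<Omega>"
    "(\<lambda>n. LINT x|lebesgue_on \<Omega>. (norm (jet (\<phi> n) x - F x))\<^sup>2) \<longlonglongrightarrow> 0"
    using W0_approx[OF assms(2)] by blast
  have G: "sqint (lebesgue_on \<Omega>) G" by (rule sqint_cong_AE[OF W0_sqint[OF assms(2)] assms(3,4)])
  have "(LINT x|lebesgue_on \<Omega>. (norm (jet (\<phi> n) x - F x))\<^sup>2) = (LINT x|lebesgue_on \<Omega>. (norm (jet (\<phi> n) x - G x))\<^sup>2)" for n
  proof (rule Bochner_Integration.integral_cong_AE)
    show "AE x in lebesgue_on \<Omega>. (norm (jet (\<phi> n) x - F x))\<^sup>2 = (norm (jet (\<phi> n) x - G x))\<^sup>2"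
      using assms(4) by eventually_elim simp
  qed (use sqint_diff[OF test_jet_sqint[OF \<phi>(1) \<Omega>] W0_sqint[OF assms(2)]]
      sqint_diff[OF test_jet_sqint[OF \<phi>(1) \<Omega>] G] in \<open>auto dest: sqint_integrable\<close>)
  then show ?thesis using \<phi> by (intro W0I_seq[OF G \<phi>(1)]) simp
qed

lemma W0_closed:
  assumes \<Omega>: "\<Omega> \<in> sets lebesgue" and F: "\<And>n. F n \<in> W0 \<Omega>" and G: "sqint (lebesgue_on \<Omega>) G"
    and lim: "(\<lambda>n. LINT x|lebesgue_on \<Omega>. (norm (F n x - G x))\<^sup>2) \<longlonglongrightarrow> 0"
  shows "G \<in> W0 \<Omega>"
  unfolding W0_def
proof (intro CollectI conjI allI impI G)
  fix e :: real assume e: "e > 0"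
  then have "eventually (\<lambda>n. (LINT x|lebesgue_on \<Omega>. (norm (F n x - G x))\<^sup>2) < e / 4) sequentially"
    using order_tendstoD(2)[OF lim, of "e/4"] by simp
  then obtain n where n: "(LINT x|lebesgue_on \<Omega>. (norm (F n x - G x))\<^sup>2) < e / 4"
    by (auto simp: eventually_sequentially)
  obtain \<phi> where \<phi>: "\<phi> \<in> test_functions \<Omega>" "(LINT x|lebesgue_on \<Omega>. (norm (jet \<phi> x - F n x))\<^sup>2) < e / 4"
    using F[of n] e unfolding W0_def by (auto dest!: spec[of _ "e/4"])
  have "(LINT x|lebesgue_on \<Omega>. (norm ((jet \<phi> x - F n x) + (F n x - G x)))\<^sup>2) \<le>
     2 * (LINT x|lebesgue_on \<Omega>. (norm (jet \<phi> x - F n x))\<^sup>2) + 2 * (LINT x|lebesgue_on \<Omega>. (norm (F n x - G x))\<^sup>2)"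
    by (intro integral_norm_add_sq_le sqint_diff test_jet_sqint[OF \<phi>(1) \<Omega>] W0_sqint[OF F] G)
  also have "\<dots> < e" using n \<phi>(2) by simp
  finally show "\<exists>\<phi>\<in>test_functions \<Omega>. (LINT x|lebesgue_on \<Omega>. (norm (jet \<phi> x - G x))\<^sup>2) < e"
    using \<phi>(1) by auto
qed

lemma jet_add_scale:
  assumes "smooth_on UNIV \<phi>" "smooth_on UNIV \<psi>"
  shows "jet (\<lambda>x. \<phi> x + c * \<psi> x) x = jet \<phi> x + c *\<^sub>R jet \<psi> x"
proof -
  have "((\<lambda>x. \<phi> x + c * \<psi> x) has_derivative (\<lambda>v. grad \<phi> x \<bullet> v + c * (grad \<psi> x \<bullet> v))) (at x)"
    by (intro has_derivative_add has_derivative_mult_right has_derivative_grad assms)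
  then have "grad (\<lambda>x. \<phi> x + c * \<psi> x) x = grad \<phi> x + c *\<^sub>R grad \<psi> x"
    by (intro grad_eqI) (simp add: inner_add_left)
  then show ?thesis by (simp add: jet_def)
qed

lemma W0_add_scale:
  assumes \<Omega>: "\<Omega> \<in> sets lebesgue" and F: "F \<in> W0 \<Omega>" and G: "G \<in> W0 \<Omega>"
  shows "(\<lambda>x. F x + c *\<^sub>R G x) \<in> W0 \<Omega>"
proof -
  obtain \<phi> where \<phi>: "\<And>n. \<phi> n \<in> test_functions \<Omega>"
    "(\<lambda>n. LINT x|lebesgue_on \<Omega>. (norm (jet (\<phi> n) x - F x))\<^sup>2) \<longlonglongrightarrow> 0"
    using W0_approx[OF F] by blast
  obtain \<psi> where \<psi>: "\<And>n. \<psi> n \<in> test_functions \<Omega>"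
    "(\<lambda>n. LINT x|lebesgue_on \<Omega>. (norm (jet (\<psi> n) x - G x))\<^sup>2) \<longlonglongrightarrow> 0"
    using W0_approx[OF G] by blast
  note sq = test_jet_sqint[OF \<phi>(1) \<Omega>] test_jet_sqint[OF \<psi>(1) \<Omega>] W0_sqint[OF F] W0_sqint[OF G]
  show ?thesis
  proof (rule W0I_seq)
    show "sqint (lebesgue_on \<Omega>) (\<lambda>x. F x + c *\<^sub>R G x)" by (intro sqint_add sqint_scaleR sq)
    show "(\<lambda>x. \<phi> n x + c * \<psi> n x) \<in> test_functions \<Omega>" for n by (rule test_add_scale[OF \<phi>(1) \<psi>(1)])
    have le: "(LINT x|lebesgue_on \<Omega>. (norm (jet (\<lambda>x. \<phi> n x + c * \<psi> n x) x - (F x + c *\<^sub>R G x)))\<^sup>2)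
       \<le> 2 * (LINT x|lebesgue_on \<Omega>. (norm (jet (\<phi> n) x - F x))\<^sup>2)
         + 2 * (c\<^sup>2 * (LINT x|lebesgue_on \<Omega>. (norm (jet (\<psi> n) x - G x))\<^sup>2))" for n
    proof -
      have "(LINT x|lebesgue_on \<Omega>. (norm (jet (\<lambda>x. \<phi> n x + c * \<psi> n x) x - (F x + c *\<^sub>R G x)))\<^sup>2)
        = (LINT x|lebesgue_on \<Omega>. (norm ((jet (\<phi> n) x - F x) + c *\<^sub>R (jet (\<psi> n) x - G x)))\<^sup>2)"
        by (simp add: jet_add_scale[OF test_smooth[OF \<phi>(1)] test_smooth[OF \<psi>(1)]] algebra_simps)
      also have "\<dots> \<le> 2 * (LINT x|lebesgue_on \<Omega>. (norm (jet (\<phi> n) x - F x))\<^sup>2)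
         + 2 * (LINT x|lebesgue_on \<Omega>. (norm (c *\<^sub>R (jet (\<psi> n) x - G x)))\<^sup>2)"
        by (intro integral_norm_add_sq_le sqint_diff sqint_scaleR sq)
      finally show ?thesis by (simp add: power_mult_distrib)
    qed
    have lim: "(\<lambda>n. 2 * (LINT x|lebesgue_on \<Omega>. (norm (jet (\<phi> n) x - F x))\<^sup>2)
         + 2 * (c\<^sup>2 * (LINT x|lebesgue_on \<Omega>. (norm (jet (\<psi> n) x - G x))\<^sup>2))) \<longlonglongrightarrow> 2 * 0 + 2 * (c\<^sup>2 * 0)"
      by (intro tendsto_intros \<phi> \<psi>)
    show "(\<lambda>n. LINT x|lebesgue_on \<Omega>. (norm (jet (\<lambda>x. \<phi> n x + c * \<psi> n x) x - (F x + c *\<^sub>R G x)))\<^sup>2) \<longlonglongrightarrow> 0"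
    proof (rule real_tendsto_sandwich[OF _ _ tendsto_const lim[simplified]])
      show "\<forall>\<^sub>F n in sequentially. 0 \<le> (LINT x|lebesgue_on \<Omega>. (norm (jet (\<lambda>x. \<phi> n x + c * \<psi> n x) x - (F x + c *\<^sub>R G x)))\<^sup>2)"
        by (intro always_eventually allI Bochner_Integration.integral_nonneg) simp
    qed (intro always_eventually allI le)
  qed
qed

lemma W0_diff: "\<Omega> \<in> sets lebesgue \<Longrightarrow> F \<in> W0 \<Omega> \<Longrightarrow> G \<in> W0 \<Omega> \<Longrightarrow> (\<lambda>x. F x - G x) \<in> W0 \<Omega>"
  using W0_add_scale[of \<Omega> F G "-1"] by simp

text \<open>Both sides of the weak formulation combine into one L^2 inner product with a fixed pair
  \<open>\<Psi>\<close>. It vanishes on jets of test functions and is continuous in L^2, hence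
  vanishes on their limits.\<close>

lemma W0_weak_gradient:
  fixes \<Omega> :: "(real^'n) set"
  assumes \<Omega>: "\<Omega> \<in> sets lebesgue" and F: "F \<in> W0 \<Omega>"
  shows "is_weak_gradient \<Omega> (\<lambda>x. fst (F x)) (\<lambda>x. snd (F x))"
  unfolding is_weak_gradient_def
proof (intro ballI allI)
  fix \<psi> and i :: 'n assume \<psi>: "\<psi> \<in> test_functions \<Omega>"
  obtain \<phi> where \<phi>: "\<And>n. \<phi> n \<in> test_functions \<Omega>"
    "(\<lambda>n. LINT x|lebesgue_on \<Omega>. (norm (jet (\<phi> n) x - F x))\<^sup>2) \<longlonglongrightarrow> 0"
    using W0_approx[OF F] by blast
  define \<psi>' where "\<psi>' x = frechet_derivative \<psi> (at x) (axis i 1)" for x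
  define \<Psi> where "\<Psi> x = (\<psi>' x, \<psi> x *\<^sub>R (axis i 1 :: real^'n))" for x
  have sq: "sqint (lebesgue_on \<Omega>) \<psi>" "sqint (lebesgue_on \<Omega>) \<psi>'"
    using sqint_fst[OF test_jet_sqint[OF \<psi> \<Omega>]] sqint_fst[OF test_jet_sqint[OF test_frechet[OF \<psi>] \<Omega>]]
    by (simp_all add: \<psi>'_def[abs_def])
  have \<Psi>: "sqint (lebesgue_on \<Omega>) \<Psi>"
    unfolding \<Psi>_def
  proof (intro sqint_Pair sq sqint_bound[OF sq(1)])
    show "(\<lambda>x. \<psi> x *\<^sub>R (axis i 1 :: real^'n)) \<in> borel_measurable (lebesgue_on \<Omega>)"
      using sqint_measurable[OF sq(1)] by (intro borel_measurable_scaleR) auto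
  qed (simp)
  have split: "(LINT x|lebesgue_on \<Omega>. G x \<bullet> \<Psi> x)
     = (LINT x|lebesgue_on \<Omega>. fst (G x) * \<psi>' x) + (LINT x|lebesgue_on \<Omega>. snd (G x) $ i * \<psi> x)"
    if "sqint (lebesgue_on \<Omega>) G" for G :: "real^'n \<Rightarrow> real \<times> (real^'n)"
  proof -
    have "G x \<bullet> \<Psi> x = fst (G x) * \<psi>' x + snd (G x) $ i * \<psi> x" for x
      by (cases "G x") (simp add: \<Psi>_def inner_axis mult.commute)
    then show ?thesis
      using sqint_mult[OF sqint_fst[OF that] sq(2)] sqint_mult[OF sqint_nth[OF sqint_snd[OF that]] sq(1)] by simp
  qed
  have "(LINT x|lebesgue_on \<Omega>. jet (\<phi> n) x \<bullet> \<Psi> x) = 0" for n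
    unfolding split[OF test_jet_sqint[OF \<phi>(1) \<Omega>]]
    using smooth_weak_gradient[OF test_smooth[OF \<phi>(1)] \<Omega>, of n] \<psi>
    unfolding is_weak_gradient_def \<psi>'_def by simp
  moreover have "(\<lambda>n. LINT x|lebesgue_on \<Omega>. jet (\<phi> n) x \<bullet> \<Psi> x) \<longlonglongrightarrow> (LINT x|lebesgue_on \<Omega>. F x \<bullet> \<Psi> x)"
    by (rule tendsto_sqint_inner[OF test_jet_sqint[OF \<phi>(1) \<Omega>] W0_sqint[OF F] \<Psi> \<phi>(2)])
  ultimately have "(LINT x|lebesgue_on \<Omega>. F x \<bullet> \<Psi> x) = 0" by (simp add: LIMSEQ_const_iff)
  then show "(LINT x|lebesgue_on \<Omega>. fst (F x) * frechet_derivative \<psi> (at x) (axis i 1))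
      = - (LINT x|lebesgue_on \<Omega>. snd (F x) $ i * \<psi> x)"
    unfolding split[OF W0_sqint[OF F]] \<psi>'_def by simp
qed

section \<open>Correspondence between \<open>W0\<close> and \<open>H10\<close>\<close>

lemma L2_on_iff_sqint: "f \<in> L2_on \<Omega> \<longleftrightarrow> sqint (lebesgue_on \<Omega>) f"
  by (simp add: L2_on_def sqint_def)

lemma wgrad_AE:
  assumes \<Omega>: "open \<Omega>" and g: "sqint (lebesgue_on \<Omega>) g" "is_weak_gradient \<Omega> u g"
  shows "sqint (lebesgue_on \<Omega>) (wgrad \<Omega> u)" "is_weak_gradient \<Omega> u (wgrad \<Omega> u)"
    "AE x in lebesgue_on \<Omega>. wgrad \<Omega> u x = g x"
proof -
  have "wgrad \<Omega> u \<in> L2_on \<Omega> \<and> is_weak_gradient \<Omega> u (wgrad \<Omega> u)"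
    unfolding wgrad_def by (rule someI[of _ g]) (use g in \<open>simp add: L2_on_iff_sqint\<close>)
  then show *: "sqint (lebesgue_on \<Omega>) (wgrad \<Omega> u)" "is_weak_gradient \<Omega> u (wgrad \<Omega> u)"
    by (simp_all add: L2_on_iff_sqint)
  show "AE x in lebesgue_on \<Omega>. wgrad \<Omega> u x = g x"
    by (rule weak_gradient_unique[OF \<Omega> * g])
qed

text \<open>Connects \<open>H1_norm\<close>, which goes through the choice in \<open>wgrad\<close>,
  with the L^2 norm of pairs, so that both notions of approximation by test functions
  coincide.\<close>

lemma H1_norm_eq:
  assumes \<Omega>: "open \<Omega>" and F: "sqint (lebesgue_on \<Omega>) F"
    and w: "is_weak_gradient \<Omega> (\<lambda>x. fst (F x)) (\<lambda>x. snd (F x))"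
  shows "H1_norm \<Omega> (\<lambda>x. fst (F x)) = sqrt (LINT x|lebesgue_on \<Omega>. (norm (F x))\<^sup>2)"
proof -
  note g = wgrad_AE[OF \<Omega> sqint_snd[OF F] w]
  have "(LINT x|lebesgue_on \<Omega>. (norm (wgrad \<Omega> (\<lambda>x. fst (F x)) x))\<^sup>2) = (LINT x|lebesgue_on \<Omega>. (norm (snd (F x)))\<^sup>2)"
  proof (rule Bochner_Integration.integral_cong_AE)
    show "AE x in lebesgue_on \<Omega>. (norm (wgrad \<Omega> (\<lambda>x. fst (F x)) x))\<^sup>2 = (norm (snd (F x)))\<^sup>2"
      using g(3) by eventually_elim simp
  qed (use g(1) sqint_snd[OF F] in \<open>auto dest: sqint_integrable\<close>)
  moreover have "(norm (F x))\<^sup>2 = (norm (snd (F x)))\<^sup>2 + (fst (F x))\<^sup>2" for x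
    by (cases "F x") (simp add: norm_Pair)
  ultimately show ?thesis
    unfolding H1_norm_def using sqint_integrable[OF sqint_fst[OF F]] sqint_integrable[OF sqint_snd[OF F]] by simp
qed

lemma weak_gradient_diff:
  fixes \<Omega> :: "(real^'n) set"
  assumes \<Omega>: "\<Omega> \<in> sets lebesgue" and F: "sqint (lebesgue_on \<Omega>) F" "is_weak_gradient \<Omega> (\<lambda>x. fst (F x)) (\<lambda>x. snd (F x))"
    and G: "sqint (lebesgue_on \<Omega>) G" "is_weak_gradient \<Omega> (\<lambda>x. fst (G x)) (\<lambda>x. snd (G x))"
  shows "is_weak_gradient \<Omega> (\<lambda>x. fst (F x - G x)) (\<lambda>x. snd (F x - G x))"
  unfolding is_weak_gradient_def
proof (intro ballI allI)
  fix \<psi> and i :: 'n assume \<psi>: "\<psi> \<in> test_functions \<Omega>"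
  have sq: "sqint (lebesgue_on \<Omega>) \<psi>" "sqint (lebesgue_on \<Omega>) (\<lambda>x. frechet_derivative \<psi> (at x) (axis i 1))"
    using sqint_fst[OF test_jet_sqint[OF \<psi> \<Omega>]] sqint_fst[OF test_jet_sqint[OF test_frechet[OF \<psi>] \<Omega>]]
    by simp_all
  note ints = sqint_mult[OF sqint_fst[OF F(1)] sq(2)] sqint_mult[OF sqint_fst[OF G(1)] sq(2)]
    sqint_mult[OF sqint_nth[OF sqint_snd[OF F(1)]] sq(1), of i] sqint_mult[OF sqint_nth[OF sqint_snd[OF G(1)]] sq(1), of i]
  show "(LINT x|lebesgue_on \<Omega>. fst (F x - G x) * frechet_derivative \<psi> (at x) (axis i 1))
      = - (LINT x|lebesgue_on \<Omega>. snd (F x - G x) $ i * \<psi> x)"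
    using spec[OF bspec[OF F(2)[unfolded is_weak_gradient_def] \<psi>], of i]
      spec[OF bspec[OF G(2)[unfolded is_weak_gradient_def] \<psi>], of i] ints
    by (simp add: left_diff_distrib)
qed

lemma W0_imp_H10:
  fixes \<Omega> :: "(real^'n) set"
  assumes \<Omega>: "open \<Omega>" and F: "F \<in> W0 \<Omega>"
  shows "(\<lambda>x. fst (F x)) \<in> H10 \<Omega>" "AE x in lebesgue_on \<Omega>. wgrad \<Omega> (\<lambda>x. fst (F x)) x = snd (F x)"
proof -
  have \<Omega>s: "\<Omega> \<in> sets lebesgue" using \<Omega> by (simp add: lebesgue_openin)
  note sq = W0_sqint[OF F] and w = W0_weak_gradient[OF \<Omega>s F]
  show "AE x in lebesgue_on \<Omega>. wgrad \<Omega> (\<lambda>x. fst (F x)) x = snd (F x)"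
    by (rule wgrad_AE[OF \<Omega> sqint_snd[OF sq] w])
  obtain \<phi> where \<phi>: "\<And>n. \<phi> n \<in> test_functions \<Omega>"
    "(\<lambda>n. LINT x|lebesgue_on \<Omega>. (norm (jet (\<phi> n) x - F x))\<^sup>2) \<longlonglongrightarrow> 0"
    using W0_approx[OF F] by blast
  have "H1_norm \<Omega> (\<lambda>x. \<phi> n x - fst (F x)) = sqrt (LINT x|lebesgue_on \<Omega>. (norm (jet (\<phi> n) x - F x))\<^sup>2)" for n
    using H1_norm_eq[OF \<Omega> sqint_diff[OF test_jet_sqint[OF \<phi>(1) \<Omega>s] sq]
        weak_gradient_diff[OF \<Omega>s test_jet_sqint[OF \<phi>(1) \<Omega>s] _ sq w], of n]
      smooth_weak_gradient[OF test_smooth[OF \<phi>(1)] \<Omega>s, of n] by simp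
  moreover from tendsto_real_sqrt[OF \<phi>(2)]
  have "(\<lambda>n. sqrt (LINT x|lebesgue_on \<Omega>. (norm (jet (\<phi> n) x - F x))\<^sup>2)) \<longlonglongrightarrow> 0" by simp
  ultimately have "(\<lambda>n. H1_norm \<Omega> (\<lambda>x. \<phi> n x - fst (F x))) \<longlonglongrightarrow> 0" by simp
  moreover have "(\<lambda>x. fst (F x)) \<in> H1 \<Omega>"
    unfolding H1_def using sqint_fst[OF sq] sqint_snd[OF sq] w by (auto simp: L2_on_iff_sqint)
  ultimately show "(\<lambda>x. fst (F x)) \<in> H10 \<Omega>" unfolding H10_def using \<phi>(1) by blast
qed

text \<open>The converse passage: it makes the equation obtained for test elements of
  \<open>W0\<close> available for every \<open>v\<close> in \<open>H10\<close>, as the definition of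
  a weak solution demands.\<close>

lemma H10_imp_W0:
  fixes \<Omega> :: "(real^'n) set"
  assumes \<Omega>: "open \<Omega>" and u: "u \<in> H10 \<Omega>"
  shows "(\<lambda>x. (u x, wgrad \<Omega> u x)) \<in> W0 \<Omega>"
proof -
  have \<Omega>s: "\<Omega> \<in> sets lebesgue" using \<Omega> by (simp add: lebesgue_openin)
  define F where "F = (\<lambda>x. (u x, wgrad \<Omega> u x))"
  obtain g where g: "sqint (lebesgue_on \<Omega>) g" "is_weak_gradient \<Omega> u g" and usq: "sqint (lebesgue_on \<Omega>) u"
    using u by (auto simp: H10_def H1_def L2_on_iff_sqint)
  have sq: "sqint (lebesgue_on \<Omega>) F"
    unfolding F_def by (intro sqint_Pair usq wgrad_AE(1)[OF \<Omega> g])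
  have w: "is_weak_gradient \<Omega> (\<lambda>x. fst (F x)) (\<lambda>x. snd (F x))"
    using wgrad_AE(2)[OF \<Omega> g] by (simp add: F_def)
  obtain \<phi> where \<phi>: "\<And>n. \<phi> n \<in> test_functions \<Omega>" and lim: "(\<lambda>n. H1_norm \<Omega> (\<lambda>x. \<phi> n x - u x)) \<longlonglongrightarrow> 0"
    using u by (auto simp: H10_def)
  have "H1_norm \<Omega> (\<lambda>x. \<phi> n x - u x) = sqrt (LINT x|lebesgue_on \<Omega>. (norm (jet (\<phi> n) x - F x))\<^sup>2)" for n
    using H1_norm_eq[OF \<Omega> sqint_diff[OF test_jet_sqint[OF \<phi>(1) \<Omega>s] sq]
        weak_gradient_diff[OF \<Omega>s test_jet_sqint[OF \<phi>(1) \<Omega>s] _ sq w], of n]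
      smooth_weak_gradient[OF test_smooth[OF \<phi>(1)] \<Omega>s, of n] by (simp add: F_def)
  then have "(\<lambda>n. (sqrt (LINT x|lebesgue_on \<Omega>. (norm (jet (\<phi> n) x - F x))\<^sup>2))\<^sup>2) \<longlonglongrightarrow> 0\<^sup>2"
    using tendsto_power[OF lim, of 2] by simp
  then have "(\<lambda>n. LINT x|lebesgue_on \<Omega>. (norm (jet (\<phi> n) x - F x))\<^sup>2) \<longlonglongrightarrow> 0" by simp
  then show ?thesis using W0I_seq[OF sq \<phi>] by (simp add: F_def)
qed

section \<open>Positive parts\<close>

definition logistic :: "real \<Rightarrow> real" where
  "logistic z = 1 / (1 + exp (- z))"

text \<open>A smooth approximation of the positive part with derivative
  \<open>logistic (a * s - b)\<close>. The subtracted constant makes it vanish at 0, so composition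
  preserves compact support; the shift \<open>b\<close> decides the limit of the derivative at
  0.\<close>

definition softplus :: "real \<Rightarrow> real \<Rightarrow> real \<Rightarrow> real" where
  "softplus a b s = (ln (1 + exp (a * s - b)) - ln (1 + exp (- b))) / a"

lemma logistic_bounds: "0 < logistic z" "logistic z < 1"
  by (auto simp: logistic_def add_pos_pos)

lemma logistic_has_derivative:
  "(logistic has_real_derivative logistic z * (1 - logistic z)) (at z)"
proof -
  have "1 + exp (- z) > 0" by (simp add: add_pos_pos)
  then show ?thesis
    unfolding logistic_def[abs_def]
    by (auto intro!: derivative_eq_intros simp: field_simps)
qed

lemma softplus_has_derivative:
  assumes "a > 0"
  shows "(softplus a b has_real_derivative logistic (a * s - b)) (at s)"
proof -
  have pos: "1 + exp (a * s - b) > 0" by (simp add: add_pos_pos)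
  have "((\<lambda>s. ln (1 + exp (a * s - b))) has_real_derivative (exp (a * s - b) * a) / (1 + exp (a * s - b))) (at s)"
    using pos by (auto intro!: derivative_eq_intros)
  then have "(softplus a b has_real_derivative ((exp (a * s - b) * a) / (1 + exp (a * s - b)) - 0) / a) (at s)"
    unfolding softplus_def[abs_def] by (intro DERIV_cdivide DERIV_diff DERIV_const)
  moreover have "((exp (a * s - b) * a) / (1 + exp (a * s - b)) - 0) / a = logistic (a * s - b)"
  proof -
    define w where "w = exp (a * s - b)"
    have w: "w > 0" "exp (- (a * s - b)) = 1 / w"
      unfolding w_def exp_minus inverse_eq_divide by simp_all
    have "((w * a) / (1 + w) - 0) / a = w / (1 + w)" using assms by simp
    also have "\<dots> = 1 / (1 + 1 / w)" using w(1) by (simp add: divide_simps)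
    finally show ?thesis unfolding logistic_def w(2) w_def[symmetric] .
  qed
  ultimately show ?thesis by simp
qed

text \<open>The logistic function L satisfies L' = L - L^2, so all derivatives of
  \<open>softplus\<close> are polynomials in L. The factor \<open>[:0, 1, -1:]\<close> encodes L -
  L^2, and \<open>smult a\<close> is the inner derivative.\<close>

primrec soft_poly :: "real \<Rightarrow> nat \<Rightarrow> real poly" where
  "soft_poly a 0 = [:0, 1:]"
| "soft_poly a (Suc j) = smult a (pderiv (soft_poly a j) * [:0, 1, -1:])"

definition soft_chain :: "real \<Rightarrow> real \<Rightarrow> nat \<Rightarrow> real \<Rightarrow> real" where
  "soft_chain a b j s = (case j of 0 \<Rightarrow> softplus a b s | Suc i \<Rightarrow> poly (soft_poly a i) (logistic (a * s - b)))"

lemma soft_chain_derivative: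
  assumes "a > 0"
  shows "(soft_chain a b j has_real_derivative soft_chain a b (Suc j) s) (at s)"
proof (cases j)
  case 0
  then show ?thesis using softplus_has_derivative[OF assms] by (simp add: soft_chain_def[abs_def])
next
  case (Suc i)
  have "((\<lambda>s. logistic (a * s - b)) has_real_derivative
      logistic (a * s - b) * (1 - logistic (a * s - b)) * a) (at s)"
    by (rule DERIV_chain2[OF logistic_has_derivative]) (auto intro!: derivative_eq_intros)
  from DERIV_chain2[OF poly_DERIV this]
  show ?thesis unfolding Suc soft_chain_def[abs_def] by (simp add: algebra_simps)
qed

lemma softplus_0 [simp]: "softplus a b 0 = 0"
  by (simp add: softplus_def)

lemma softplus_Lipschitz:
  assumes "a > 0" shows "\<bar>softplus a b x - softplus a b y\<bar> \<le> \<bar>x - y\<bar>"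
proof -
  have "norm (softplus a b x - softplus a b y) \<le> 1 * norm (x - y)"
    by (rule field_differentiable_bound[of UNIV _ "\<lambda>s. logistic (a * s - b)"])
      (use softplus_has_derivative[OF assms] logistic_bounds in \<open>auto intro: less_imp_le simp: abs_of_pos\<close>)
  then show ?thesis by simp
qed

text \<open>At s = 0 the argument of \<open>logistic\<close> is minus \<open>Suc n\<close>, hence
  the limit 0 there; without the shift it would be 1/2. The shift divided by the squared slope
  factor tends to 0, so it does not affect positive \<open>s\<close> in the limit.\<close>

lemma softplus_limit:
  "(\<lambda>n. softplus ((real (Suc n))\<^sup>2) (real (Suc n)) s) \<longlonglongrightarrow> (if s > 0 then s else 0)" (is ?A)
  "(\<lambda>n. logistic ((real (Suc n))\<^sup>2 * s - real (Suc n))) \<longlonglongrightarrow> (if s > 0 then 1 else 0)" (is ?B)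
proof -
  consider "s > 0" | "s = 0" | "s < 0" by linarith
  then have "?A \<and> ?B"
  proof cases
    case 1
    have "(\<lambda>n. softplus ((real (Suc n))\<^sup>2) (real (Suc n)) s) \<longlonglongrightarrow> s"
      "(\<lambda>n. logistic ((real (Suc n))\<^sup>2 * s - real (Suc n))) \<longlonglongrightarrow> 1"
      unfolding softplus_def logistic_def using 1 by real_asymp+
    then show ?thesis using 1 by simp
  next
    case 2
    have "(\<lambda>n. logistic (- real (Suc n))) \<longlonglongrightarrow> 0"
      unfolding logistic_def by real_asymp
    then show ?thesis using 2 by simp
  next
    case 3
    have "(\<lambda>n. softplus ((real (Suc n))\<^sup>2) (real (Suc n)) s) \<longlonglongrightarrow> 0"
      "(\<lambda>n. logistic ((real (Suc n))\<^sup>2 * s - real (Suc n))) \<longlonglongrightarrow> 0"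
      unfolding softplus_def logistic_def using 3 by real_asymp+
    then show ?thesis using 3 by simp
  qed
  then show ?A ?B by auto
qed

lemma smooth_softplus: "a > 0 \<Longrightarrow> smooth_on UNIV \<phi> \<Longrightarrow> smooth_on UNIV (\<lambda>x. softplus a b (\<phi> x))"
  using smooth_on_compose_chain[of \<phi> "soft_chain a b" 0, OF _ soft_chain_derivative]
  by (simp add: soft_chain_def)

lemma test_softplus:
  assumes "a > 0" "\<phi> \<in> test_functions \<Omega>"
  shows "(\<lambda>x. softplus a b (\<phi> x)) \<in> test_functions \<Omega>"
  using assms(2)
  by (elim test_supportE) (rule test_functionsI, auto intro: smooth_softplus assms test_smooth)

definition soft_jet :: "real \<Rightarrow> real \<Rightarrow> real \<times> (real^'n) \<Rightarrow> real \<times> (real^'n)" where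
  "soft_jet a b p = (softplus a b (fst p), logistic (a * fst p - b) *\<^sub>R snd p)"

lemma jet_softplus:
  "a > 0 \<Longrightarrow> smooth_on UNIV \<phi> \<Longrightarrow> jet (\<lambda>x. softplus a b (\<phi> x)) x = soft_jet a b (jet \<phi> x)"
  by (simp add: jet_def soft_jet_def grad_compose_chain[OF _ softplus_has_derivative])

lemma norm_soft_jet_le:
  assumes "a > 0" shows "norm (soft_jet a b p) \<le> norm p"
proof -
  have "\<bar>softplus a b (fst p)\<bar> \<le> \<bar>fst p\<bar>" using softplus_Lipschitz[OF assms, of b "fst p" 0] by simp
  moreover have "norm (logistic (a * fst p - b) *\<^sub>R snd p) \<le> norm (snd p)"
    using logistic_bounds[of "a * fst p - b"] by (simp add: mult_left_le_one_le)
  ultimately have "(softplus a b (fst p))\<^sup>2 + (norm (logistic (a * fst p - b) *\<^sub>R snd p))\<^sup>2 \<le> (fst p)\<^sup>2 + (norm (snd p))\<^sup>2"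
    by (intro add_mono power_mono[of "norm _"]) (auto simp only: abs_le_square_iff norm_ge_zero)
  then show ?thesis unfolding soft_jet_def norm_Pair norm_prod_def by (simp add: real_sqrt_le_mono)
qed

lemma continuous_on_softplus: "a > 0 \<Longrightarrow> continuous_on UNIV (softplus a b)"
  using softplus_has_derivative by (meson DERIV_isCont continuous_at_imp_continuous_on)

lemma continuous_on_logistic: "continuous_on UNIV logistic"
  using logistic_has_derivative by (meson DERIV_isCont continuous_at_imp_continuous_on)

lemma continuous_on_soft_jet: "a > 0 \<Longrightarrow> continuous_on UNIV (soft_jet a b)"
  unfolding soft_jet_def
  by (intro continuous_intros continuous_on_compose2[OF continuous_on_softplus] continuous_on_compose2[OF continuous_on_logistic]) auto

text \<open>The difference of gradients is written as L(p) (snd p - snd q) + (L(p) - L(q)) snd q.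
  The first part is controlled by \<open>p - q\<close>; the second multiplies the fixed function
  \<open>snd q\<close> by a factor of modulus at most 1 and so suits dominated convergence.\<close>

lemma soft_jet_diff:
  assumes "a > 0"
  shows "(norm (soft_jet a b p - soft_jet a b q))\<^sup>2 \<le> 2 * (norm (p - q))\<^sup>2
    + 2 * (logistic (a * fst p - b) - logistic (a * fst q - b))\<^sup>2 * (norm (snd q))\<^sup>2"
proof -
  define L L' where "L = logistic (a * fst p - b)" and "L' = logistic (a * fst q - b)"
  have L: "0 < L" "L < 1" by (simp_all add: L_def logistic_bounds)
  have 1: "(softplus a b (fst p) - softplus a b (fst q))\<^sup>2 \<le> (fst p - fst q)\<^sup>2"
    using softplus_Lipschitz[OF assms] by (simp add: abs_le_square_iff)
  have "L *\<^sub>R snd p - L' *\<^sub>R snd q = L *\<^sub>R (snd p - snd q) + (L - L') *\<^sub>R snd q" by (simp add: algebra_simps)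
  then have "(norm (L *\<^sub>R snd p - L' *\<^sub>R snd q))\<^sup>2 \<le> 2 * (norm (L *\<^sub>R (snd p - snd q)))\<^sup>2 + 2 * (norm ((L - L') *\<^sub>R snd q))\<^sup>2"
    by (metis norm_add_sq_le)
  moreover have "(norm (L *\<^sub>R (snd p - snd q)))\<^sup>2 \<le> (norm (snd p - snd q))\<^sup>2"
    using L by (intro power_mono) (simp_all add: mult_left_le_one_le)
  moreover have "(norm ((L - L') *\<^sub>R snd q))\<^sup>2 = (L - L')\<^sup>2 * (norm (snd q))\<^sup>2" by (simp add: power_mult_distrib)
  moreover have "(norm (p - q))\<^sup>2 = (fst p - fst q)\<^sup>2 + (norm (snd p - snd q))\<^sup>2"
    by (simp add: norm_prod_def)
  moreover have "(norm (soft_jet a b p - soft_jet a b q))\<^sup>2 =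
     (softplus a b (fst p) - softplus a b (fst q))\<^sup>2 + (norm (L *\<^sub>R snd p - L' *\<^sub>R snd q))\<^sup>2"
    by (simp add: soft_jet_def norm_prod_def L_def L'_def)
  ultimately show ?thesis using 1 zero_le_power2[of "fst p - fst q"] unfolding L_def[symmetric] L'_def[symmetric]
    by (simp only: mult.assoc) argo
qed

lemma soft_jet_measurable:
  "a > 0 \<Longrightarrow> F \<in> borel_measurable M \<Longrightarrow> (\<lambda>x. soft_jet a b (F x)) \<in> borel_measurable M"
  by (rule borel_measurable_continuous_on[OF continuous_on_soft_jet])

lemma W0_soft_jet:
  fixes \<Omega> :: "(real^'n) set"
  assumes \<Omega>: "\<Omega> \<in> sets lebesgue" and a: "a > 0" and F: "F \<in> W0 \<Omega>"
  shows "(\<lambda>x. soft_jet a b (F x)) \<in> W0 \<Omega>"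
proof -
  obtain \<phi> where \<phi>: "\<And>n. \<phi> n \<in> test_functions \<Omega>"
    and lim: "(\<lambda>n. LINT x|lebesgue_on \<Omega>. (norm (jet (\<phi> n) x - F x))\<^sup>2) \<longlonglongrightarrow> 0"
    using W0_approx[OF F] by blast
  note sq = W0_sqint[OF F]
  \<comment> \<open>Pointwise convergence is required for the logistic factors; the squared norm of
    \<open>snd (F x)\<close> is the majorant.\<close>
  obtain r :: "nat \<Rightarrow> nat" where r: "strict_mono r" and ae: "AE x in lebesgue_on \<Omega>. (\<lambda>n. jet (\<phi> (r n)) x) \<longlonglongrightarrow> F x"
    by (rule sqint_AE_subseq[OF test_jet_sqint[OF \<phi> \<Omega>] sq lim])
  define L where "L x = logistic (a * fst (F x) - b)" for x
  define Ln where "Ln n x = logistic (a * \<phi> (r n) x - b)" for n x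
  have [measurable]: "F \<in> borel_measurable (lebesgue_on \<Omega>)" using sq by (rule sqint_measurable)
  have [measurable]: "\<phi> n \<in> borel_measurable (lebesgue_on \<Omega>)" for n
    using sqint_measurable[OF sqint_fst[OF test_jet_sqint[OF \<phi> \<Omega>]], of n] by simp
  have vm [measurable]: "(\<lambda>x. fst (F x)) \<in> borel_measurable (lebesgue_on \<Omega>)" using sqint_measurable[OF sqint_fst[OF sq]] .
  have Gm [measurable]: "(\<lambda>x. snd (F x)) \<in> borel_measurable (lebesgue_on \<Omega>)" using sqint_measurable[OF sqint_snd[OF sq]] .
  have Lm [measurable]: "L \<in> borel_measurable (lebesgue_on \<Omega>)" "Ln n \<in> borel_measurable (lebesgue_on \<Omega>)" for n
    unfolding L_def Ln_def by (intro borel_measurable_continuous_on[OF continuous_on_logistic]; measurable)+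
  have Gint: "integrable (lebesgue_on \<Omega>) (\<lambda>x. (norm (snd (F x)))\<^sup>2)" using sqint_integrable[OF sqint_snd[OF sq]] .
  have L01: "(Ln n x - L x)\<^sup>2 \<le> 1" for n x
    unfolding Ln_def L_def using logistic_bounds[of "a * \<phi> (r n) x - b"] logistic_bounds[of "a * fst (F x) - b"]
    by (simp add: abs_square_le_1)
  have bd: "(Ln n x - L x)\<^sup>2 * (norm (snd (F x)))\<^sup>2 \<le> (norm (snd (F x)))\<^sup>2" for n x
    using L01[of n x] by (simp add: mult_left_le_one_le)
  have "(\<lambda>n. LINT x|lebesgue_on \<Omega>. (Ln n x - L x)\<^sup>2 * (norm (snd (F x)))\<^sup>2) \<longlonglongrightarrow> (LINT x|lebesgue_on \<Omega>. 0)"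
  proof (rule integral_dominated_convergence[where w = "\<lambda>x. (norm (snd (F x)))\<^sup>2"])
    show "AE x in lebesgue_on \<Omega>. (\<lambda>n. (Ln n x - L x)\<^sup>2 * (norm (snd (F x)))\<^sup>2) \<longlonglongrightarrow> 0"
      using ae
    proof eventually_elim
      case (elim x)
      from tendsto_fst[OF this] have "(\<lambda>n. \<phi> (r n) x) \<longlonglongrightarrow> fst (F x)" by simp
      then have "(\<lambda>n. Ln n x) \<longlonglongrightarrow> L x"
        unfolding Ln_def L_def
        by (intro continuous_on_tendsto_compose[OF continuous_on_logistic] tendsto_intros) auto
      then have "(\<lambda>n. (Ln n x - L x)\<^sup>2 * (norm (snd (F x)))\<^sup>2) \<longlonglongrightarrow> (L x - L x)\<^sup>2 * (norm (snd (F x)))\<^sup>2"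
        by (intro tendsto_intros)
      then show ?case by simp
    qed
  qed (use Gint bd in auto)
  then have lim2: "(\<lambda>n. LINT x|lebesgue_on \<Omega>. (Ln n x - L x)\<^sup>2 * (norm (snd (F x)))\<^sup>2) \<longlonglongrightarrow> 0" by simp
  have int2: "integrable (lebesgue_on \<Omega>) (\<lambda>x. (Ln n x - L x)\<^sup>2 * (norm (snd (F x)))\<^sup>2)" for n
    by (rule Bochner_Integration.integrable_bound[OF Gint]) (use bd in auto)
  have sj: "sqint (lebesgue_on \<Omega>) (\<lambda>x. soft_jet a b (F x))"
    by (rule sqint_bound[OF sq soft_jet_measurable[OF a]]) (auto simp: norm_soft_jet_le[OF a])
  show ?thesis
  proof (rule W0I_seq[OF sj])
    show t: "(\<lambda>x. softplus a b (\<phi> (r n) x)) \<in> test_functions \<Omega>" for n by (rule test_softplus[OF a \<phi>])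
    have le: "(LINT x|lebesgue_on \<Omega>. (norm (jet (\<lambda>x. softplus a b (\<phi> (r n) x)) x - soft_jet a b (F x)))\<^sup>2)
      \<le> 2 * (LINT x|lebesgue_on \<Omega>. (norm (jet (\<phi> (r n)) x - F x))\<^sup>2)
        + 2 * (LINT x|lebesgue_on \<Omega>. (Ln n x - L x)\<^sup>2 * (norm (snd (F x)))\<^sup>2)" for n
    proof -
      note i1 = sqint_integrable[OF sqint_diff[OF test_jet_sqint[OF \<phi> \<Omega>] sq], of "r n"]
      have "(LINT x|lebesgue_on \<Omega>. (norm (jet (\<lambda>x. softplus a b (\<phi> (r n) x)) x - soft_jet a b (F x)))\<^sup>2)
        \<le> (LINT x|lebesgue_on \<Omega>. 2 * (norm (jet (\<phi> (r n)) x - F x))\<^sup>2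
           + 2 * ((Ln n x - L x)\<^sup>2 * (norm (snd (F x)))\<^sup>2))"
      proof (rule integral_mono)
        show "integrable (lebesgue_on \<Omega>) (\<lambda>x. (norm (jet (\<lambda>x. softplus a b (\<phi> (r n) x)) x - soft_jet a b (F x)))\<^sup>2)"
          by (rule sqint_integrable[OF sqint_diff[OF test_jet_sqint[OF t \<Omega>] sj]])
        show "(norm (jet (\<lambda>x. softplus a b (\<phi> (r n) x)) x - soft_jet a b (F x)))\<^sup>2
          \<le> 2 * (norm (jet (\<phi> (r n)) x - F x))\<^sup>2 + 2 * ((Ln n x - L x)\<^sup>2 * (norm (snd (F x)))\<^sup>2)" for x
          using soft_jet_diff[OF a, of b "jet (\<phi> (r n)) x" "F x"]
          unfolding jet_softplus[OF a test_smooth[OF \<phi>]] Ln_def L_def by (simp add: mult.assoc)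
      qed (use i1 int2 in simp)
      also have "\<dots> = 2 * (LINT x|lebesgue_on \<Omega>. (norm (jet (\<phi> (r n)) x - F x))\<^sup>2)
        + 2 * (LINT x|lebesgue_on \<Omega>. (Ln n x - L x)\<^sup>2 * (norm (snd (F x)))\<^sup>2)"
        using i1 int2 by simp
      finally show ?thesis .
    qed
    have "(\<lambda>n. 2 * (LINT x|lebesgue_on \<Omega>. (norm (jet (\<phi> (r n)) x - F x))\<^sup>2)
        + 2 * (LINT x|lebesgue_on \<Omega>. (Ln n x - L x)\<^sup>2 * (norm (snd (F x)))\<^sup>2)) \<longlonglongrightarrow> 2 * 0 + 2 * 0"
      by (intro tendsto_intros lim2 LIMSEQ_subseq_LIMSEQ[OF lim r, unfolded o_def])
    then have lim3: "(\<lambda>n. 2 * (LINT x|lebesgue_on \<Omega>. (norm (jet (\<phi> (r n)) x - F x))\<^sup>2)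
        + 2 * (LINT x|lebesgue_on \<Omega>. (Ln n x - L x)\<^sup>2 * (norm (snd (F x)))\<^sup>2)) \<longlonglongrightarrow> 0" by simp
    show "(\<lambda>n. LINT x|lebesgue_on \<Omega>. (norm (jet (\<lambda>x. softplus a b (\<phi> (r n) x)) x - soft_jet a b (F x)))\<^sup>2) \<longlonglongrightarrow> 0"
    proof (rule real_tendsto_sandwich[OF _ _ tendsto_const lim3])
      show "\<forall>\<^sub>F n in sequentially. 0 \<le> (LINT x|lebesgue_on \<Omega>. (norm (jet (\<lambda>x. softplus a b (\<phi> (r n) x)) x - soft_jet a b (F x)))\<^sup>2)"
        by (intro always_eventually allI Bochner_Integration.integral_nonneg) simp
    qed (intro always_eventually allI le)
  qed
qed

definition pos_jet :: "('a \<Rightarrow> real \<times> 'b) \<Rightarrow> 'a \<Rightarrow> real \<times> 'b::zero" where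
  "pos_jet F x = (if fst (F x) > 0 then F x else (0, 0))"

text \<open>The smoothings \<open>softplus (n\<^sup>2) n\<close> have derivatives converging to the indicator of
  \<open>{s > 0}\<close>, including at \<open>s = 0\<close>, so the gradient need not vanish on the zero set.\<close>

lemma W0_pos_jet:
  fixes \<Omega> :: "(real^'n) set"
  assumes \<Omega>: "\<Omega> \<in> sets lebesgue" and F: "F \<in> W0 \<Omega>"
  shows "pos_jet F \<in> W0 \<Omega>"
proof -
  note sq = W0_sqint[OF F]
  have [measurable]: "F \<in> borel_measurable (lebesgue_on \<Omega>)" using sq by (rule sqint_measurable)
  have vm [measurable]: "(\<lambda>x. fst (F x)) \<in> borel_measurable (lebesgue_on \<Omega>)" using sqint_measurable[OF sqint_fst[OF sq]] .
  have pm: "pos_jet F \<in> borel_measurable (lebesgue_on \<Omega>)" unfolding pos_jet_def[abs_def] by measurable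
  have ple: "norm (pos_jet F x) \<le> norm (F x)" for x by (simp add: pos_jet_def zero_prod_def[symmetric])
  have psq: "sqint (lebesgue_on \<Omega>) (pos_jet F)" by (rule sqint_bound[OF sq pm]) (simp add: ple)
  define H where "H n x = soft_jet ((real (Suc n))\<^sup>2) (real (Suc n)) (F x)" for n x
  have apos: "(real (Suc n))\<^sup>2 > 0" for n by simp
  have H: "H n \<in> W0 \<Omega>" for n
    unfolding H_def by (rule W0_soft_jet[OF \<Omega> apos F])
  have "(\<lambda>n. LINT x|lebesgue_on \<Omega>. (norm (H n x - pos_jet F x))\<^sup>2) \<longlonglongrightarrow> (LINT x|lebesgue_on \<Omega>. 0)"
  proof (rule integral_dominated_convergence[where w = "\<lambda>x. 4 * (norm (F x))\<^sup>2"])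
    show "AE x in lebesgue_on \<Omega>. norm ((norm (H n x - pos_jet F x))\<^sup>2) \<le> 4 * (norm (F x))\<^sup>2" for n
    proof (rule AE_I2)
      fix x
      have "norm (H n x - pos_jet F x) \<le> norm (H n x) + norm (pos_jet F x)" by (rule norm_triangle_ineq4)
      also have "\<dots> \<le> 2 * norm (F x)" using norm_soft_jet_le[OF apos, of n "real (Suc n)" "F x"] ple[of x] unfolding H_def by linarith
      finally have "(norm (H n x - pos_jet F x))\<^sup>2 \<le> (2 * norm (F x))\<^sup>2" by (intro power_mono) auto
      then show "norm ((norm (H n x - pos_jet F x))\<^sup>2) \<le> 4 * (norm (F x))\<^sup>2" by (simp add: power_mult_distrib)
    qed
    show "AE x in lebesgue_on \<Omega>. (\<lambda>n. (norm (H n x - pos_jet F x))\<^sup>2) \<longlonglongrightarrow> 0"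
    proof (rule AE_I2)
      fix x
      have "(\<lambda>n. H n x) \<longlonglongrightarrow> (if fst (F x) > 0 then fst (F x) else 0, (if fst (F x) > 0 then 1 else 0) *\<^sub>R snd (F x))"
        unfolding H_def soft_jet_def by (intro tendsto_Pair tendsto_scaleR softplus_limit tendsto_const)
      moreover have "(if fst (F x) > 0 then fst (F x) else 0, (if fst (F x) > 0 then 1 else 0) *\<^sub>R snd (F x)) = pos_jet F x"
        by (simp add: pos_jet_def)
      ultimately have "(\<lambda>n. H n x) \<longlonglongrightarrow> pos_jet F x" by simp
      then have "(\<lambda>n. (norm (H n x - pos_jet F x))\<^sup>2) \<longlonglongrightarrow> (norm (pos_jet F x - pos_jet F x))\<^sup>2" by (intro tendsto_intros)
      then show "(\<lambda>n. (norm (H n x - pos_jet F x))\<^sup>2) \<longlonglongrightarrow> 0" by simp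
    qed
    show "(\<lambda>x. (norm (H n x - pos_jet F x))\<^sup>2) \<in> borel_measurable (lebesgue_on \<Omega>)" for n
      using sqint_integrable[OF sqint_diff[OF W0_sqint[OF H] psq]] by (rule borel_measurable_integrable)
  qed (use sqint_integrable[OF sq] in auto)
  then have "(\<lambda>n. LINT x|lebesgue_on \<Omega>. (norm (H n x - pos_jet F x))\<^sup>2) \<longlonglongrightarrow> 0" by simp
  then show ?thesis by (rule W0_closed[OF \<Omega> H psq])
qed

section \<open>The Riesz representation\<close>

text \<open>The only vector space operation used is \<open>comb t F G = F + t G\<close>; this makes the lemma applicable to
  functions, which do not form an instance of a real vector space class.\<close>

lemma Riesz_representation:
  fixes V :: "'v set" and comb :: "real \<Rightarrow> 'v \<Rightarrow> 'v \<Rightarrow> 'v" and E :: "'v \<Rightarrow> 'v \<Rightarrow> real" and l :: "'v \<Rightarrow> real"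
  assumes V: "V \<noteq> {}" "\<And>t F G. F \<in> V \<Longrightarrow> G \<in> V \<Longrightarrow> comb t F G \<in> V"
    and E_comb: "\<And>t F G H. F \<in> V \<Longrightarrow> G \<in> V \<Longrightarrow> H \<in> V \<Longrightarrow> E (comb t F G) H = E F H + t * E G H"
    and E_sym: "\<And>F G. E F G = E G F" and E_nonneg: "\<And>F. E F F \<ge> 0"
    and l_comb: "\<And>t F G. F \<in> V \<Longrightarrow> G \<in> V \<Longrightarrow> l (comb t F G) = l F + t * l G"
    and C: "C \<ge> 0" "\<And>F. F \<in> V \<Longrightarrow> (l F)\<^sup>2 \<le> C * E F F"
    and complete: "\<And>F. (\<And>n::nat. F n \<in> V) \<Longrightarrow>
        (\<And>e. e > 0 \<Longrightarrow> \<exists>N. \<forall>m\<ge>N. \<forall>n\<ge>N. E (comb (-1) (F m) (F n)) (comb (-1) (F m) (F n)) < e) \<Longrightarrow>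
        \<exists>G\<in>V. (\<lambda>n. E (comb (-1) (F n) G) (comb (-1) (F n) G)) \<longlonglongrightarrow> 0"
  obtains F where "F \<in> V" "\<And>G. G \<in> V \<Longrightarrow> E F G = l G"
proof -
  have E_comb2: "E H (comb t F G) = E H F + t * E H G" if "F \<in> V" "G \<in> V" "H \<in> V" for t F G H
    using E_comb[OF that, of t] by (simp add: E_sym)
  \<comment> \<open>Dirichlet's principle: the representing element is the minimizer of this
    quadratic functional.\<close>
  define Q where "Q F = E F F / 2 - l F" for F
  have Q_comb: "Q (comb t F G) = Q F + 2 * t * ((E F G - l G) / 2) + t\<^sup>2 * (E G G / 2)"
    if "F \<in> V" "G \<in> V" for t F G
    unfolding Q_def using that
    by (simp add: E_comb E_comb2 V(2) l_comb E_sym[of G F] power2_eq_square field_simps)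
  have CS: "(E F G)\<^sup>2 \<le> E F F * E G G" if "F \<in> V" "G \<in> V" for F G
  proof (rule quadratic_nonneg_discrim)
    fix t show "0 \<le> E F F + 2 * t * E F G + t\<^sup>2 * E G G"
      using E_nonneg[of "comb t F G"] that
      by (simp add: E_comb E_comb2 V(2) E_sym[of G F] power2_eq_square algebra_simps)
  qed
  have Q_bdd: "- C / 2 \<le> Q F" if "F \<in> V" for F
  proof -
    have "(l F)\<^sup>2 \<le> ((C + E F F) / 2)\<^sup>2"
      using C(2)[OF that] zero_le_power2[of "(C - E F F) / 2"]
      by (simp add: power2_eq_square field_simps)
    then have "\<bar>l F\<bar> \<le> (C + E F F) / 2"
      by (rule power2_le_imp_le[of "\<bar>l F\<bar>", simplified]) (use C(1) E_nonneg[of F] in simp)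
    then show ?thesis unfolding Q_def by (simp add: field_simps)
  qed
  define m where "m = Inf (Q ` V)"
  have bdd: "bdd_below (Q ` V)" using Q_bdd by (auto intro!: bdd_belowI[of _ "- C / 2"])
  have m: "m \<le> Q F" if "F \<in> V" for F unfolding m_def using that bdd by (auto intro: cInf_lower)
  have "\<exists>F. F \<in> V \<and> Q F < m + 1 / real (Suc n)" for n
  proof -
    have "m < m + 1 / real (Suc n)" by simp
    then have "\<exists>y\<in>Q ` V. y < m + 1 / real (Suc n)"
      using cInf_less_iff[OF _ bdd, of "m + 1 / real (Suc n)"] V(1) unfolding m_def by blast
    then show ?thesis by auto
  qed
  then obtain F where F: "\<And>n. F n \<in> V" "\<And>n. Q (F n) < m + 1 / real (Suc n)" by metis
  \<comment> \<open>Parallelogram identity: with \<open>D\<close> the difference of \<open>f\<close>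
    and \<open>g\<close>, the element \<open>comb (1/2) g D\<close> is their midpoint, where
    \<open>Q\<close> equals the mean of \<open>Q f\<close> and \<open>Q g\<close> minus
    \<open>E D D / 8\<close>, and is still at least \<open>m\<close>.\<close>
  have para: "E (comb (-1) f g) (comb (-1) f g) \<le> 4 * (Q f - m) + 4 * (Q g - m)" if "f \<in> V" "g \<in> V" for f g
  proof -
    define D where "D = comb (-1) f g"
    have D: "D \<in> V" unfolding D_def by (rule V(2)[OF that])
    have ED: "E D D = E f f - 2 * E f g + E g g" "E g D = E f g - E g g" "l D = l f - l g"
      unfolding D_def using that by (simp_all add: E_comb E_comb2 V(2) l_comb E_sym[of g f])
    have "m \<le> Q (comb (1/2) g D)" by (intro m V(2) that D)
    also have "\<dots> = Q g / 2 + Q f / 2 - E D D / 8"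
      unfolding Q_comb[OF that(2) D] unfolding Q_def ED by (simp add: power2_eq_square field_simps)
    finally show ?thesis unfolding D_def[symmetric] by simp
  qed
  have aux: "x < e" if "a < m + e / 8" "b < m + e / 8" "x \<le> 4 * (a - m) + 4 * (b - m)" for x a b e :: real
    using that by (simp add: field_simps)
  have lim0: "(\<lambda>n. 1 / real (Suc n)) \<longlonglongrightarrow> 0" by (rule lim_1_over_n[THEN LIMSEQ_Suc])
  have "\<exists>N. \<forall>m\<ge>N. \<forall>n\<ge>N. E (comb (-1) (F m) (F n)) (comb (-1) (F m) (F n)) < e" if "e > 0" for e
  proof -
    have "eventually (\<lambda>n. 1 / real (Suc n) < e / 8) sequentially"
      using order_tendstoD(2)[OF lim0, of "e/8"] that by simp
    then obtain N where N: "\<And>n. n \<ge> N \<Longrightarrow> 1 / real (Suc n) < e / 8" by (auto simp: eventually_sequentially)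
    show ?thesis
    proof (intro exI[of _ N] allI impI)
      fix i j assume "i \<ge> N" "j \<ge> N"
      have "Q (F i) < m + e / 8" by (rule less_trans[OF F(2) add_strict_left_mono[OF N]]) fact
      moreover have "Q (F j) < m + e / 8" by (rule less_trans[OF F(2) add_strict_left_mono[OF N]]) fact
      ultimately show "E (comb (-1) (F i) (F j)) (comb (-1) (F i) (F j)) < e"
        using para[OF F(1) F(1), of i j] by (rule aux)
    qed
  qed
  from complete[OF F(1) this] obtain G where G: "G \<in> V"
    and lim: "(\<lambda>n. E (comb (-1) (F n) G) (comb (-1) (F n) G)) \<longlonglongrightarrow> 0" by blast
  have "E G H = l H" if H: "H \<in> V" for H
  proof -
    \<comment> \<open>Perturbing \<open>F n\<close> by multiples of \<open>H\<close> never brings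
      \<open>Q\<close> below \<open>m\<close>; the discriminant therefore bounds the defect in the
      Euler equation by the excess \<open>Q (F n) - m\<close>. The equation passes to the limit
      without continuity of \<open>Q\<close>.\<close>
    have "((E (F n) H - l H) / 2)\<^sup>2 \<le> (Q (F n) - m) * (E H H / 2)" for n
    proof (rule quadratic_nonneg_discrim)
      fix t show "0 \<le> Q (F n) - m + 2 * t * ((E (F n) H - l H) / 2) + t\<^sup>2 * (E H H / 2)"
        using m[OF V(2)[OF F(1) H], of t n] Q_comb[OF F(1) H, of t n] by linarith
    qed
    also have "(Q (F n) - m) * (E H H / 2) \<le> 1 / real (Suc n) * (E H H / 2)" for n
      using F(2)[of n] E_nonneg[of H] by (intro mult_right_mono) auto
    finally have le1: "((E (F n) H - l H) / 2)\<^sup>2 \<le> 1 / real (Suc n) * (E H H / 2)" for n .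
    have lim1: "(\<lambda>n. ((E (F n) H - l H) / 2)\<^sup>2) \<longlonglongrightarrow> 0"
    proof (rule real_tendsto_sandwich[OF _ _ tendsto_const])
      show "(\<lambda>n. 1 / real (Suc n) * (E H H / 2)) \<longlonglongrightarrow> 0"
        using tendsto_mult[OF lim0 tendsto_const[of "E H H / 2"]] by simp
    qed (use le1 in \<open>auto intro!: always_eventually simp del: of_nat_Suc\<close>)
    have le2: "(E (F n) H - E G H)\<^sup>2 \<le> E (comb (-1) (F n) G) (comb (-1) (F n) G) * E H H" for n
      using CS[OF V(2)[OF F(1) G] H, of "-1" n] E_comb[OF F(1) G H, of "-1" n] by simp
    have lim2: "(\<lambda>n. (E (F n) H - E G H)\<^sup>2) \<longlonglongrightarrow> 0"
    proof (rule real_tendsto_sandwich[OF _ _ tendsto_const])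
      show "(\<lambda>n. E (comb (-1) (F n) G) (comb (-1) (F n) G) * E H H) \<longlonglongrightarrow> 0"
        using tendsto_mult[OF lim tendsto_const[of "E H H"]] by simp
    qed (use le2 in \<open>auto intro!: always_eventually\<close>)
    have "(\<lambda>n. \<bar>(E (F n) H - l H) / 2\<bar>) \<longlonglongrightarrow> 0" "(\<lambda>n. \<bar>E (F n) H - E G H\<bar>) \<longlonglongrightarrow> 0"
      using tendsto_real_sqrt[OF lim1] tendsto_real_sqrt[OF lim2] by simp_all
    then have "(\<lambda>n. (E (F n) H - l H) / 2) \<longlonglongrightarrow> 0" "(\<lambda>n. E (F n) H - E G H) \<longlonglongrightarrow> 0"
      by (simp_all only: tendsto_rabs_zero_iff)
    then have "(\<lambda>n. 2 * ((E (F n) H - l H) / 2) - (E (F n) H - E G H)) \<longlonglongrightarrow> 2 * 0 - 0"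
      by (intro tendsto_intros)
    moreover have "2 * ((E (F n) H - l H) / 2) - (E (F n) H - E G H) = E G H - l H" for n
      by (simp add: field_simps)
    ultimately have "(\<lambda>n::nat. E G H - l H) \<longlonglongrightarrow> 2 * 0 - 0" by (simp only:)
    then have "(\<lambda>n::nat. E G H - l H) \<longlonglongrightarrow> 0" by simp
    then show ?thesis by (simp add: LIMSEQ_const_iff)
  qed
  with G show ?thesis using that by blast
qed

section \<open>The energy form and completeness\<close>

text \<open>The bilinear form of the operator - \<Delta> + K, acting on pairs of a function and its
  gradient.\<close>

definition energy_form ::
  "(real^'n) set \<Rightarrow> real \<Rightarrow> (real^'n \<Rightarrow> real \<times> (real^'n)) \<Rightarrow> (real^'n \<Rightarrow> real \<times> (real^'n)) \<Rightarrow> real" where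
  "energy_form \<Omega> K F G = (LINT x|lebesgue_on \<Omega>. snd (F x) \<bullet> snd (G x)) + K * (LINT x|lebesgue_on \<Omega>. fst (F x) * fst (G x))"

lemma energy_form_sym: "energy_form \<Omega> K F G = energy_form \<Omega> K G F"
  by (simp add: energy_form_def inner_commute mult.commute)

lemma energy_form_add_scale:
  assumes "sqint (lebesgue_on \<Omega>) F" "sqint (lebesgue_on \<Omega>) G" "sqint (lebesgue_on \<Omega>) H"
  shows "energy_form \<Omega> K (\<lambda>x. F x + t *\<^sub>R G x) H = energy_form \<Omega> K F H + t * energy_form \<Omega> K G H"
proof -
  note i = sqint_inner[OF sqint_snd[OF assms(1)] sqint_snd[OF assms(3)]]
    sqint_inner[OF sqint_snd[OF assms(2)] sqint_snd[OF assms(3)]]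
    sqint_mult[OF sqint_fst[OF assms(1)] sqint_fst[OF assms(3)]]
    sqint_mult[OF sqint_fst[OF assms(2)] sqint_fst[OF assms(3)]]
  have "(LINT x|lebesgue_on \<Omega>. snd (F x + t *\<^sub>R G x) \<bullet> snd (H x)) =
     (LINT x|lebesgue_on \<Omega>. snd (F x) \<bullet> snd (H x)) + t * (LINT x|lebesgue_on \<Omega>. snd (G x) \<bullet> snd (H x))"
    using i(1,2) by (simp add: inner_add_left)
  moreover have "(LINT x|lebesgue_on \<Omega>. fst (F x + t *\<^sub>R G x) * fst (H x)) =
     (LINT x|lebesgue_on \<Omega>. fst (F x) * fst (H x)) + t * (LINT x|lebesgue_on \<Omega>. fst (G x) * fst (H x))"
    using i(3,4) by (simp add: distrib_right mult.assoc)
  ultimately show ?thesis by (simp add: energy_form_def algebra_simps)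
qed

lemma energy_form_self:
  "energy_form \<Omega> K F F = (LINT x|lebesgue_on \<Omega>. (norm (snd (F x)))\<^sup>2) + K * (LINT x|lebesgue_on \<Omega>. (fst (F x))\<^sup>2)"
  unfolding energy_form_def power2_norm_eq_inner by (simp add: power2_eq_square)

lemma energy_form_nonneg: "K \<ge> 0 \<Longrightarrow> energy_form \<Omega> K F F \<ge> 0"
  unfolding energy_form_self by (intro add_nonneg_nonneg mult_nonneg_nonneg Bochner_Integration.integral_nonneg) auto

lemma integral_norm_jet:
  fixes F :: "real^'n \<Rightarrow> real \<times> (real^'n)"
  assumes "sqint (lebesgue_on \<Omega>) F"
  shows "(LINT x|lebesgue_on \<Omega>. (norm (F x))\<^sup>2)
    = (LINT x|lebesgue_on \<Omega>. (norm (snd (F x)))\<^sup>2) + (LINT x|lebesgue_on \<Omega>. (fst (F x))\<^sup>2)"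
proof -
  have "(norm (F x))\<^sup>2 = (norm (snd (F x)))\<^sup>2 + (fst (F x))\<^sup>2" for x by (simp add: norm_prod_def)
  then show ?thesis using sqint_integrable[OF sqint_fst[OF assms]] sqint_integrable[OF sqint_snd[OF assms]] by simp
qed

lemma energy_form_bounds:
  fixes F :: "real^'n \<Rightarrow> real \<times> (real^'n)"
  assumes "sqint (lebesgue_on \<Omega>) F" "K \<ge> 1"
  shows "(LINT x|lebesgue_on \<Omega>. (norm (F x))\<^sup>2) \<le> energy_form \<Omega> K F F"
    "energy_form \<Omega> K F F \<le> K * (LINT x|lebesgue_on \<Omega>. (norm (F x))\<^sup>2)"
proof -
  have 0: "(LINT x|lebesgue_on \<Omega>. (norm (snd (F x)))\<^sup>2) \<ge> 0" "(LINT x|lebesgue_on \<Omega>. (fst (F x))\<^sup>2) \<ge> 0"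
    by (intro Bochner_Integration.integral_nonneg; simp)+
  show "(LINT x|lebesgue_on \<Omega>. (norm (F x))\<^sup>2) \<le> energy_form \<Omega> K F F"
    using mult_right_mono[OF assms(2) 0(2)] unfolding integral_norm_jet[OF assms(1)] energy_form_self by simp
  show "energy_form \<Omega> K F F \<le> K * (LINT x|lebesgue_on \<Omega>. (norm (F x))\<^sup>2)"
    using mult_right_mono[OF assms(2) 0(1)] unfolding integral_norm_jet[OF assms(1)] energy_form_self
    by (simp add: distrib_left)
qed

text \<open>For \<open>K \<ge> 1\<close> the energy form is equivalent to the squared L^2 norm of
  the pair, so completeness follows from that of L^2 and closedness of \<open>W0\<close>.\<close>

lemma W0_complete:
  fixes \<Omega> :: "(real^'n) set"
  assumes \<Omega>: "\<Omega> \<in> sets lebesgue" and K: "K \<ge> 1" and F: "\<And>n::nat. F n \<in> W0 \<Omega>"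
    and cau: "\<And>e. e > 0 \<Longrightarrow> \<exists>N. \<forall>m\<ge>N. \<forall>n\<ge>N. energy_form \<Omega> K (\<lambda>x. F m x - F n x) (\<lambda>x. F m x - F n x) < e"
  shows "\<exists>G\<in>W0 \<Omega>. (\<lambda>n. energy_form \<Omega> K (\<lambda>x. F n x - G x) (\<lambda>x. F n x - G x)) \<longlonglongrightarrow> 0"
proof -
  note sq = W0_sqint[OF F]
  have "\<exists>N. \<forall>m\<ge>N. \<forall>n\<ge>N. (LINT x|lebesgue_on \<Omega>. (norm (F m x - F n x))\<^sup>2) < e" if e: "e > 0" for e
  proof -
    obtain N where N: "\<forall>m\<ge>N. \<forall>n\<ge>N. energy_form \<Omega> K (\<lambda>x. F m x - F n x) (\<lambda>x. F m x - F n x) < e"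
      using cau[OF e] by blast
    show ?thesis
    proof (intro exI[of _ N] allI impI)
      fix m n assume "m \<ge> N" "n \<ge> N"
      with N have "energy_form \<Omega> K (\<lambda>x. F m x - F n x) (\<lambda>x. F m x - F n x) < e" by blast
      with energy_form_bounds(1)[OF sqint_diff[OF sq sq] K, of m n]
      show "(LINT x|lebesgue_on \<Omega>. (norm (F m x - F n x))\<^sup>2) < e" by linarith
    qed
  qed
  from sqint_complete[OF sq this] obtain G where G: "sqint (lebesgue_on \<Omega>) G"
    and lim: "(\<lambda>n. LINT x|lebesgue_on \<Omega>. (norm (F n x - G x))\<^sup>2) \<longlonglongrightarrow> 0" by blast
  have GW: "G \<in> W0 \<Omega>" by (rule W0_closed[OF \<Omega> F G lim])
  have "(\<lambda>n. energy_form \<Omega> K (\<lambda>x. F n x - G x) (\<lambda>x. F n x - G x)) \<longlonglongrightarrow> 0"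
  proof (rule real_tendsto_sandwich[OF _ _ tendsto_const])
    show "(\<lambda>n. K * (LINT x|lebesgue_on \<Omega>. (norm (F n x - G x))\<^sup>2)) \<longlonglongrightarrow> 0"
      using tendsto_mult[OF tendsto_const[of K] lim] by simp
    show "\<forall>\<^sub>F n in sequentially. 0 \<le> energy_form \<Omega> K (\<lambda>x. F n x - G x) (\<lambda>x. F n x - G x)"
      using K by (intro always_eventually allI energy_form_nonneg) simp
    show "\<forall>\<^sub>F n in sequentially. energy_form \<Omega> K (\<lambda>x. F n x - G x) (\<lambda>x. F n x - G x) \<le> K * (LINT x|lebesgue_on \<Omega>. (norm (F n x - G x))\<^sup>2)"
      by (intro always_eventually allI energy_form_bounds(2) sqint_diff sq G K)
  qed
  with GW show ?thesis by blast
qed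

lemma W0_zero: "(\<lambda>x. 0) \<in> W0 (\<Omega>::(real^'n) set)"
proof -
  have t: "(\<lambda>x. 0) \<in> test_functions \<Omega>"
    by (rule test_functionsI[where K = "{}"]) (auto intro: smooth_on_const)
  have "grad (\<lambda>x. 0) x = 0" for x :: "real^'n" by (rule grad_eqI) simp
  then have "jet (\<lambda>x. 0) = (\<lambda>x::real^'n. 0)" by (simp add: jet_def fun_eq_iff zero_prod_def)
  then show ?thesis by (intro W0I_seq[OF _ t]) (auto simp: sqint_def)
qed

lemma W0_Riesz:
  fixes \<Omega> :: "(real^'n) set" and f :: "real^'n \<Rightarrow> real"
  assumes \<Omega>: "\<Omega> \<in> sets lebesgue" and K: "K \<ge> 1"
    and int: "\<And>F. F \<in> W0 \<Omega> \<Longrightarrow> integrable (lebesgue_on \<Omega>) (\<lambda>x. f x * fst (F x))"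
    and C: "C \<ge> 0" "\<And>F. F \<in> W0 \<Omega> \<Longrightarrow> (LINT x|lebesgue_on \<Omega>. f x * fst (F x))\<^sup>2 \<le> C * energy_form \<Omega> K F F"
  obtains U where "U \<in> W0 \<Omega>" "\<And>G. G \<in> W0 \<Omega> \<Longrightarrow> energy_form \<Omega> K U G = (LINT x|lebesgue_on \<Omega>. f x * fst (G x))"
proof (rule Riesz_representation[of "W0 \<Omega>" "\<lambda>t F G x. F x + t *\<^sub>R G x" "energy_form \<Omega> K" "\<lambda>F. LINT x|lebesgue_on \<Omega>. f x * fst (F x)" C])
  show "W0 \<Omega> \<noteq> {}" using W0_zero by blast
  show "(\<lambda>x. F x + t *\<^sub>R G x) \<in> W0 \<Omega>" if "F \<in> W0 \<Omega>" "G \<in> W0 \<Omega>" for t F G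
    by (rule W0_add_scale[OF \<Omega> that])
  show "energy_form \<Omega> K (\<lambda>x. F x + t *\<^sub>R G x) H = energy_form \<Omega> K F H + t * energy_form \<Omega> K G H"
    if "F \<in> W0 \<Omega>" "G \<in> W0 \<Omega>" "H \<in> W0 \<Omega>" for t F G H
    by (rule energy_form_add_scale) (use that in \<open>auto intro: W0_sqint\<close>)
  show "energy_form \<Omega> K F F \<ge> 0" for F using K by (intro energy_form_nonneg) simp
  show "(LINT x|lebesgue_on \<Omega>. f x * fst (F x + t *\<^sub>R G x)) =
      (LINT x|lebesgue_on \<Omega>. f x * fst (F x)) + t * (LINT x|lebesgue_on \<Omega>. f x * fst (G x))"
    if "F \<in> W0 \<Omega>" "G \<in> W0 \<Omega>" for t F G
    using int[OF that(1)] int[OF that(2)] by (simp add: distrib_left mult.left_commute[of "f _" t])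
  fix F assume "\<And>n::nat. F n \<in> W0 \<Omega>"
    and "\<And>e. e > 0 \<Longrightarrow> \<exists>N. \<forall>m\<ge>N. \<forall>n\<ge>N. energy_form \<Omega> K (\<lambda>x. F m x + (-1) *\<^sub>R F n x) (\<lambda>x. F m x + (-1) *\<^sub>R F n x) < e"
  then show "\<exists>G\<in>W0 \<Omega>. (\<lambda>n. energy_form \<Omega> K (\<lambda>x. F n x + (-1) *\<^sub>R G x) (\<lambda>x. F n x + (-1) *\<^sub>R G x)) \<longlonglongrightarrow> 0"
    using W0_complete[OF \<Omega> K, of F] by simp
qed (use C energy_form_sym that in auto)

section \<open>Sobolev and Poincare inequalities from the definitions of the constants\<close>

lemma abs_powr_even:
  fixes x :: real assumes "q > 0" shows "\<bar>x\<bar> powr (2 * real q) = x ^ (2 * q)"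
proof (cases "x = 0")
  case False
  then have "\<bar>x\<bar> powr real (2 * q) = \<bar>x\<bar> ^ (2 * q)" by (intro powr_realpow) simp
  also have "\<dots> = x ^ (2 * q)" by (simp add: power_even_abs)
  finally show ?thesis by simp
qed (use assms in simp)

lemma sobolev_test_function:
  fixes \<phi> :: "real^'n \<Rightarrow> real"
  assumes \<phi>: "\<phi> \<in> test_functions UNIV" and q: "q > 0" "two_star CARD('n) = 2 * real q"
    and S: "sobolev_S TYPE('n) > 0"
  shows "(LINT x|lebesgue. \<phi> x ^ (2 * q)) \<le> ((LINT x|lebesgue. (norm (grad \<phi> x))\<^sup>2) / sobolev_S TYPE('n)) ^ q"
proof -
  define I where "I = (LINT x|lebesgue. \<phi> x ^ (2 * q))"
  define D where "D = (LINT x|lebesgue. (norm (grad \<phi> x))\<^sup>2)"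
  let ?S = "sobolev_S TYPE('n)"
  have D0: "D \<ge> 0" unfolding D_def by (intro Bochner_Integration.integral_nonneg) simp
  have I0: "I \<ge> 0" unfolding I_def by (intro Bochner_Integration.integral_nonneg) (simp add: power_mult)
  have L: "lebesgue_on UNIV = (lebesgue :: (real^'n) measure)" by (rule lebesgue_on_UNIV_eq)
  note sq = test_jet_sqint[OF \<phi>, of UNIV, simplified]
  note w = smooth_weak_gradient[OF test_smooth[OF \<phi>], of UNIV, simplified]
  note g = wgrad_AE[OF open_UNIV _ w, simplified L, OF sqint_snd[OF sq, unfolded snd_jet, simplified L]]
  have "I \<le> (D / ?S) ^ q"
  proof (cases "I = 0")
    case True
    then show ?thesis using D0 S by simp
  next
    case False
    then have Ipos: "I > 0" using I0 by simp
    have nz: "\<not> ae_zero UNIV \<phi>"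
    proof
      assume "ae_zero UNIV \<phi>"
      then have "AE x in lebesgue. \<phi> x ^ (2 * q) = 0"
        unfolding ae_zero_def L by eventually_elim (use q in simp)
      then have "I = 0" unfolding I_def by (rule integral_eq_zero_AE)
      with False show False by simp
    qed
    have H1: "\<phi> \<in> H1 UNIV"
      unfolding H1_def using sqint_fst[OF sq] sqint_snd[OF sq] w by (auto simp: L2_on_iff_sqint)
    let ?R = "\<lambda>u. (LINT x|lebesgue. (norm (wgrad UNIV u x))\<^sup>2) /
        (LINT x|lebesgue. \<bar>u x\<bar> powr two_star CARD('n)) powr (2 / two_star CARD('n))"
    have "?S \<le> ?R \<phi>"
      unfolding sobolev_S_def
    proof (rule cINF_lower)
      show "bdd_below (?R ` {u \<in> H1 (UNIV :: (real^'n) set). \<not> ae_zero UNIV u})"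
        by (intro bdd_belowI[of _ 0]) (auto intro!: divide_nonneg_nonneg Bochner_Integration.integral_nonneg)
    qed (use H1 nz in simp)
    moreover have "(LINT x|lebesgue. (norm (wgrad UNIV \<phi> x))\<^sup>2) = D"
      unfolding D_def
    proof (rule Bochner_Integration.integral_cong_AE)
      show "AE x in lebesgue. (norm (wgrad UNIV \<phi> x))\<^sup>2 = (norm (grad \<phi> x))\<^sup>2"
        using g(3) by eventually_elim simp
    qed (use g(1) sqint_snd[OF sq] in \<open>auto simp: L dest: sqint_integrable\<close>)
    moreover have "(LINT x|lebesgue. \<bar>\<phi> x\<bar> powr two_star CARD('n)) = I"
      unfolding I_def q(2) by (simp add: abs_powr_even[OF q(1)])
    ultimately have "?S \<le> D / I powr (1 / real q)" by (simp add: q(2))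
    then have "I powr (1 / real q) \<le> D / ?S" using Ipos S by (simp add: field_simps)
    then have "(I powr (1 / real q)) ^ q \<le> (D / ?S) ^ q" by (intro power_mono) auto
    moreover have "(I powr (1 / real q)) ^ q = I"
      using Ipos q(1) by (simp add: powr_realpow[symmetric] powr_powr)
    ultimately show ?thesis by simp
  qed
  then show ?thesis by (simp add: I_def D_def)
qed

text \<open>Fatou's lemma along approximating test functions that converge almost everywhere.
  Integrability of the critical power is a conclusion, since membership in \<open>W0\<close> only
  provides squares.\<close>

lemma sobolev_W0:
  fixes \<Omega> :: "(real^'n) set"
  assumes \<Omega>: "\<Omega> \<in> sets lebesgue" and F: "F \<in> W0 \<Omega>"
    and q: "q > 0" "two_star CARD('n) = 2 * real q" and S: "sobolev_S TYPE('n) > 0"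
  shows "integrable (lebesgue_on \<Omega>) (\<lambda>x. fst (F x) ^ (2 * q))"
    "(LINT x|lebesgue_on \<Omega>. fst (F x) ^ (2 * q)) \<le> ((LINT x|lebesgue_on \<Omega>. (norm (snd (F x)))\<^sup>2) / sobolev_S TYPE('n)) ^ q"
proof -
  let ?S = "sobolev_S TYPE('n)"
  obtain \<phi> where \<phi>: "\<And>n. \<phi> n \<in> test_functions \<Omega>"
    and lim: "(\<lambda>n. LINT x|lebesgue_on \<Omega>. (norm (jet (\<phi> n) x - F x))\<^sup>2) \<longlonglongrightarrow> 0"
    using W0_approx[OF F] by blast
  note sq = W0_sqint[OF F]
  obtain r :: "nat \<Rightarrow> nat" where r: "strict_mono r" and ae: "AE x in lebesgue_on \<Omega>. (\<lambda>n. jet (\<phi> (r n)) x) \<longlonglongrightarrow> F x"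
    by (rule sqint_AE_subseq[OF test_jet_sqint[OF \<phi> \<Omega>] sq lim])
  define D where "D = (LINT x|lebesgue_on \<Omega>. (norm (snd (F x)))\<^sup>2)"
  define Dn where "Dn n = (LINT x|lebesgue_on \<Omega>. (norm (grad (\<phi> (r n)) x))\<^sup>2)" for n
  have lim_r: "(\<lambda>n. LINT x|lebesgue_on \<Omega>. (norm (jet (\<phi> (r n)) x - F x))\<^sup>2) \<longlonglongrightarrow> 0"
    using LIMSEQ_subseq_LIMSEQ[OF lim r] by (simp add: o_def)
  have "(\<lambda>n. LINT x|lebesgue_on \<Omega>. (norm (grad (\<phi> (r n)) x - snd (F x)))\<^sup>2) \<longlonglongrightarrow> 0"
  proof (rule real_tendsto_sandwich[OF _ _ tendsto_const lim_r])
    show "\<forall>\<^sub>F n in sequentially. 0 \<le> (LINT x|lebesgue_on \<Omega>. (norm (grad (\<phi> (r n)) x - snd (F x)))\<^sup>2)"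
      by (intro always_eventually allI Bochner_Integration.integral_nonneg) simp
    show "\<forall>\<^sub>F n in sequentially. (LINT x|lebesgue_on \<Omega>. (norm (grad (\<phi> (r n)) x - snd (F x)))\<^sup>2)
        \<le> (LINT x|lebesgue_on \<Omega>. (norm (jet (\<phi> (r n)) x - F x))\<^sup>2)"
    proof (intro always_eventually allI integral_mono)
      fix n x
      note d = sqint_diff[OF test_jet_sqint[OF \<phi>[of "r n"] \<Omega>] sq]
      show "integrable (lebesgue_on \<Omega>) (\<lambda>x. (norm (jet (\<phi> (r n)) x - F x))\<^sup>2)"
        using d by (rule sqint_integrable)
      show "integrable (lebesgue_on \<Omega>) (\<lambda>x. (norm (grad (\<phi> (r n)) x - snd (F x)))\<^sup>2)"
        using sqint_integrable[OF sqint_snd[OF d]] by simp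
      show "(norm (grad (\<phi> (r n)) x - snd (F x)))\<^sup>2 \<le> (norm (jet (\<phi> (r n)) x - F x))\<^sup>2"
        by (simp add: norm_prod_def)
    qed
  qed
  then have Dlim: "Dn \<longlonglongrightarrow> D"
    unfolding Dn_def D_def
    using tendsto_sqint_norm[of "lebesgue_on \<Omega>" "\<lambda>n. grad (\<phi> (r n))" "\<lambda>x. snd (F x)"]
      sqint_snd[OF test_jet_sqint[OF \<phi> \<Omega>]] sqint_snd[OF sq] by simp
  have zero: "\<phi> n x = 0" "grad (\<phi> n) x = 0" if "x \<notin> \<Omega>" for n x
    by (rule test_support_jetE[OF \<phi>[of n]]; use that in blast)+
  have le: "(LINT x|lebesgue_on \<Omega>. \<phi> (r n) x ^ (2 * q)) \<le> (Dn n / ?S) ^ q" for n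
  proof -
    have t: "\<phi> (r n) \<in> test_functions UNIV" using \<phi> test_functions_mono by blast
    have "(LINT x|lebesgue_on \<Omega>. \<phi> (r n) x ^ (2 * q)) = (LINT x|lebesgue. \<phi> (r n) x ^ (2 * q))"
      by (rule integral_on_eq_integral[OF \<Omega>]) (use zero q in simp)
    moreover have "Dn n = (LINT x|lebesgue. (norm (grad (\<phi> (r n)) x))\<^sup>2)"
      unfolding Dn_def by (rule integral_on_eq_integral[OF \<Omega>]) (use zero in simp)
    ultimately show ?thesis using sobolev_test_function[OF t q S] by simp
  qed
  have int\<phi>: "integrable (lebesgue_on \<Omega>) (\<lambda>x. \<phi> n x ^ (2 * q))" for n
  proof -
    obtain K where K: "compact K" "\<And>x. x \<notin> K \<Longrightarrow> \<phi> n x = 0" using test_supportE[OF \<phi>[of n]] by metis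
    have "integrable lebesgue (\<lambda>x. \<phi> n x ^ (2 * q))"
      by (rule compact_support_integrable(2)[OF _ K(1)])
        (use K q in \<open>auto intro!: continuous_intros continuous_on_test[OF \<phi>]\<close>)
    then show ?thesis by (rule integrable_lebesgue_on_subset[OF _ \<Omega>])
  qed
  have Flim: "AE x in lebesgue_on \<Omega>. (\<lambda>n. \<phi> (r (n + k)) x ^ (2 * q)) \<longlonglongrightarrow> fst (F x) ^ (2 * q)" for k
    using ae
  proof eventually_elim
    case (elim x)
    from tendsto_fst[OF this] have "(\<lambda>n. \<phi> (r n) x) \<longlonglongrightarrow> fst (F x)" by simp
    then show ?case by (intro tendsto_intros LIMSEQ_ignore_initial_segment[where f = "\<lambda>n. \<phi> (r n) x"])
  qed
  have Fm: "(\<lambda>x. fst (F x) ^ (2 * q)) \<in> borel_measurable (lebesgue_on \<Omega>)"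
    using sqint_measurable[OF sqint_fst[OF sq]] by simp
  \<comment> \<open>A tail of the approximating sequence satisfies a uniform bound up to
    \<open>e\<close>, as Fatou's lemma requires; \<open>e\<close> is removed at the end.\<close>
  have main: "integrable (lebesgue_on \<Omega>) (\<lambda>x. fst (F x) ^ (2 * q))
      \<and> (LINT x|lebesgue_on \<Omega>. fst (F x) ^ (2 * q)) \<le> (D / ?S) ^ q + e" if "e > 0" for e
  proof -
    have "(\<lambda>n. (Dn n / ?S) ^ q) \<longlonglongrightarrow> (D / ?S) ^ q" using S by (intro tendsto_intros Dlim) simp
    from order_tendstoD(2)[OF this, of "(D / ?S) ^ q + e"] that
    obtain k where k: "\<And>n. n \<ge> k \<Longrightarrow> (Dn n / ?S) ^ q < (D / ?S) ^ q + e" by (auto simp: eventually_sequentially)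
    have b: "(LINT x|lebesgue_on \<Omega>. \<phi> (r (n + k)) x ^ (2 * q)) \<le> (D / ?S) ^ q + e" for n
      using le[of "n + k"] k[of "n + k"] by simp
    have nn: "AE x in lebesgue_on \<Omega>. 0 \<le> \<phi> (r (n + k)) x ^ (2 * q)" for n by (simp add: power_mult)
    show ?thesis
      using fatou_real[OF int\<phi> nn Flim[of k] Fm b] by blast
  qed
  from main[of 1] show "integrable (lebesgue_on \<Omega>) (\<lambda>x. fst (F x) ^ (2 * q))" by simp
  show "(LINT x|lebesgue_on \<Omega>. fst (F x) ^ (2 * q)) \<le> ((LINT x|lebesgue_on \<Omega>. (norm (snd (F x)))\<^sup>2) / ?S) ^ q"
    unfolding D_def[symmetric]
  proof (rule field_le_epsilon)
    fix e :: real assume "e > 0"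
    from main[OF this] show "(LINT x|lebesgue_on \<Omega>. fst (F x) ^ (2 * q)) \<le> (D / ?S) ^ q + e" by (rule conjunct2)
  qed
qed

lemma poincare_W0:
  fixes \<Omega> :: "(real^'n) set"
  assumes \<Omega>: "open \<Omega>" and F: "F \<in> W0 \<Omega>"
  shows "lambda1 \<Omega> * (LINT x|lebesgue_on \<Omega>. (fst (F x))\<^sup>2) \<le> (LINT x|lebesgue_on \<Omega>. (norm (snd (F x)))\<^sup>2)"
proof -
  define I where "I = (LINT x|lebesgue_on \<Omega>. (fst (F x))\<^sup>2)"
  define D where "D = (LINT x|lebesgue_on \<Omega>. (norm (snd (F x)))\<^sup>2)"
  let ?u = "\<lambda>x. fst (F x)"
  have D0: "D \<ge> 0" unfolding D_def by (intro Bochner_Integration.integral_nonneg) simp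
  have I0: "I \<ge> 0" unfolding I_def by (intro Bochner_Integration.integral_nonneg) simp
  note sq = W0_sqint[OF F]
  have "lambda1 \<Omega> * I \<le> D"
  proof (cases "I = 0")
    case False
    have nz: "\<not> ae_zero \<Omega> ?u"
    proof
      assume "ae_zero \<Omega> ?u"
      then have "AE x in lebesgue_on \<Omega>. (fst (F x))\<^sup>2 = 0" unfolding ae_zero_def by eventually_elim simp
      then have "I = 0" unfolding I_def by (rule integral_eq_zero_AE)
      with False show False by simp
    qed
    note H = W0_imp_H10[OF \<Omega> F]
    let ?R = "\<lambda>u. (LINT x|lebesgue_on \<Omega>. (norm (wgrad \<Omega> u x))\<^sup>2) / (LINT x|lebesgue_on \<Omega>. \<bar>u x\<bar>\<^sup>2)"
    have "lambda1 \<Omega> \<le> ?R ?u"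
      unfolding lambda1_def
    proof (rule cINF_lower)
      show "bdd_below (?R ` {u \<in> H10 \<Omega>. \<not> ae_zero \<Omega> u})"
        by (intro bdd_belowI[of _ 0]) (auto intro!: divide_nonneg_nonneg Bochner_Integration.integral_nonneg)
    qed (use H nz in simp)
    moreover have "(LINT x|lebesgue_on \<Omega>. (norm (wgrad \<Omega> ?u x))\<^sup>2) = D"
      unfolding D_def
    proof (rule Bochner_Integration.integral_cong_AE)
      show "AE x in lebesgue_on \<Omega>. (norm (wgrad \<Omega> ?u x))\<^sup>2 = (norm (snd (F x)))\<^sup>2"
        using H(2) by eventually_elim simp
      have "\<Omega> \<in> sets lebesgue" using \<Omega> by (simp add: lebesgue_openin)
      from wgrad_AE(1)[OF \<Omega> sqint_snd[OF sq] W0_weak_gradient[OF this F]]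
      show "(\<lambda>x. (norm (wgrad \<Omega> ?u x))\<^sup>2) \<in> borel_measurable (lebesgue_on \<Omega>)" by (auto dest: sqint_integrable)
    qed (use sqint_snd[OF sq] in \<open>auto dest: sqint_integrable\<close>)
    ultimately have "lambda1 \<Omega> \<le> D / I" by (simp add: I_def)
    then show ?thesis using False I0 by (simp add: field_simps)
  qed (use D0 in simp)
  then show ?thesis by (simp add: I_def D_def)
qed

section \<open>Monotone iteration inside an energy well\<close>

text \<open>Isolates what the iteration needs from the concrete equation. \<open>H\<close> is tied
  to \<open>h\<close> by the tangent inequality, which makes it a convex primitive;
  \<open>ridge\<close> is the energy barrier on the sphere; the Sobolev inequality enters with the
  exponent 2q.\<close>

locale monotone_iteration =
  fixes \<Omega> :: "(real^'n) set" and q :: nat and S K C rho b :: real and h H :: "real \<Rightarrow> real"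
  assumes open_\<Omega>: "open \<Omega>" and bounded_\<Omega>: "bounded \<Omega>"
    and q: "q \<ge> 1" and S: "S > 0" and K: "K \<ge> 1" and C: "C \<ge> 0"
    and sobolev_int: "\<And>F. F \<in> W0 \<Omega> \<Longrightarrow> integrable (lebesgue_on \<Omega>) (\<lambda>x. fst (F x) ^ (2 * q))"
    and sobolev: "\<And>F. F \<in> W0 \<Omega> \<Longrightarrow>
      (LINT x|lebesgue_on \<Omega>. fst (F x) ^ (2 * q)) \<le> ((LINT x|lebesgue_on \<Omega>. (norm (snd (F x)))\<^sup>2) / S) ^ q"
    and h_mono: "mono h" and h_nonneg: "\<And>s. 0 \<le> h s" and h_cont: "continuous_on UNIV h"
    and h_growth: "\<And>s. h s \<le> C * (1 + \<bar>s\<bar> ^ (2 * q - 1))"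
    and H_convex: "\<And>s t. H s + h s * (t - s) \<le> H t" and H_0: "H 0 = 0" and H_nonneg: "\<And>s. 0 \<le> H s"
    and H_measurable: "H \<in> borel_measurable borel"
    and ridge: "\<And>F. F \<in> W0 \<Omega> \<Longrightarrow> (LINT x|lebesgue_on \<Omega>. (norm (snd (F x)))\<^sup>2) = rho \<Longrightarrow>
      b \<le> energy_form \<Omega> K F F / 2 - (LINT x|lebesgue_on \<Omega>. H (fst (F x)))"
begin

section \<open>Admissible functions and the linear problem\<close>

abbreviation M where "M \<equiv> lebesgue_on \<Omega>"

definition energy where
  "energy F = energy_form \<Omega> K F F / 2 - (LINT x|M. H (fst (F x)))"

text \<open>The domain of \<open>T\<close> is L^(2q), with no gradient asked for, so that a
  countable supremum of bumps and the pointwise limit of the iterates both qualify.\<close>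

definition admissible :: "(real^'n \<Rightarrow> real) \<Rightarrow> bool" where
  "admissible v \<longleftrightarrow> v \<in> borel_measurable M \<and> integrable M (\<lambda>x. v x ^ (2 * q))"

lemma sets_\<Omega>: "\<Omega> \<in> sets lebesgue"
  using open_\<Omega> by (simp add: lebesgue_openin)

sublocale finite_measure M
proof (rule finite_measureI)
  have "\<Omega> \<in> lmeasurable" using open_\<Omega> bounded_\<Omega> by (rule lmeasurable_open[rotated])
  from fmeasurableD2[OF this] show "emeasure M (space M) \<noteq> \<infinity>"
    by (simp add: emeasure_restrict_space sets_\<Omega> del: emeasure_completion)
qed

abbreviation vol where "vol \<equiv> measure M (space M)"

lemma integral_const_M: "(LINT x|M. c) = vol * c"
  by (simp add: lebesgue_integral_const)

lemma admissible_W0: "F \<in> W0 \<Omega> \<Longrightarrow> admissible (\<lambda>x. fst (F x))"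
  unfolding admissible_def using sobolev_int sqint_measurable[OF sqint_fst[OF W0_sqint]] by blast

lemma even_power_nonneg: "0 \<le> (x::real) ^ (2 * q)"
  by (simp add: power_mult)

lemma abs_le_one_plus_power: "\<bar>w\<bar> \<le> 1 + (w::real) ^ (2 * q)"
proof (cases "\<bar>w\<bar> \<le> 1")
  case True
  then show ?thesis using even_power_nonneg[of w] by linarith
next
  case False
  then have "\<bar>w\<bar> ^ 1 \<le> \<bar>w\<bar> ^ (2 * q)" using q by (intro power_increasing) auto
  then show ?thesis by (simp add: power_even_abs)
qed

text \<open>The larger of |a| and |w| may replace the other one, which gives a Young inequality
  without conjugate exponents.\<close>

lemma young: "\<bar>a\<bar> ^ (2 * q - 1) * \<bar>w\<bar> \<le> (a::real) ^ (2 * q) + w ^ (2 * q)"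
proof -
  have eq: "\<bar>z\<bar> ^ (2 * q - 1) * \<bar>z\<bar> = z ^ (2 * q)" for z :: real
  proof -
    have "\<bar>z\<bar> ^ (2 * q - 1) * \<bar>z\<bar> = \<bar>z\<bar> ^ (2 * q)" using q by (simp add: power_eq_if)
    then show ?thesis by (simp add: power_even_abs)
  qed
  show ?thesis
  proof (cases "\<bar>w\<bar> \<le> \<bar>a\<bar>")
    case True
    then have "\<bar>a\<bar> ^ (2 * q - 1) * \<bar>w\<bar> \<le> \<bar>a\<bar> ^ (2 * q - 1) * \<bar>a\<bar>" by (intro mult_left_mono) auto
    then show ?thesis using eq[of a] even_power_nonneg[of w] by linarith
  next
    case False
    then have "\<bar>a\<bar> ^ (2 * q - 1) * \<bar>w\<bar> \<le> \<bar>w\<bar> ^ (2 * q - 1) * \<bar>w\<bar>" by (intro mult_right_mono power_mono) auto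
    then show ?thesis using eq[of w] even_power_nonneg[of a] by linarith
  qed
qed

lemma h_times_le: "h a * \<bar>w\<bar> \<le> C * (1 + a ^ (2 * q) + 2 * w ^ (2 * q))"
proof -
  have "h a * \<bar>w\<bar> \<le> C * (1 + \<bar>a\<bar> ^ (2 * q - 1)) * \<bar>w\<bar>" by (intro mult_right_mono h_growth) auto
  also have "\<dots> = C * (\<bar>w\<bar> + \<bar>a\<bar> ^ (2 * q - 1) * \<bar>w\<bar>)" by (simp add: algebra_simps)
  also have "\<dots> \<le> C * ((1 + w ^ (2 * q)) + (a ^ (2 * q) + w ^ (2 * q)))"
    by (intro mult_left_mono add_mono abs_le_one_plus_power young C)
  finally show ?thesis by (simp add: algebra_simps)
qed

lemma h_measurable: "admissible v \<Longrightarrow> (\<lambda>x. h (v x)) \<in> borel_measurable M"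
  unfolding admissible_def using borel_measurable_continuous_on[OF h_cont] by blast

lemma h_times:
  assumes v: "admissible v" and w: "admissible w"
  shows "integrable M (\<lambda>x. h (v x) * w x)"
    "\<bar>LINT x|M. h (v x) * w x\<bar> \<le> C * (vol + (LINT x|M. v x ^ (2 * q)) + 2 * (LINT x|M. w x ^ (2 * q)))"
proof -
  let ?B = "\<lambda>x. C * (1 + v x ^ (2 * q) + 2 * w x ^ (2 * q))"
  have B: "integrable M ?B" using v w by (simp add: admissible_def)
  have m: "(\<lambda>x. h (v x) * w x) \<in> borel_measurable M"
    using h_measurable[OF v] w by (intro borel_measurable_times) (auto simp: admissible_def)
  have le: "\<bar>h (v x) * w x\<bar> \<le> ?B x" for x
    using h_times_le[of "v x" "w x"] by (simp add: abs_mult h_nonneg)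
  show int: "integrable M (\<lambda>x. h (v x) * w x)"
    by (rule Bochner_Integration.integrable_bound[OF B m]) (use le in \<open>auto intro: order_trans[OF _ abs_ge_self]\<close>)
  have "\<bar>LINT x|M. h (v x) * w x\<bar> \<le> (LINT x|M. \<bar>h (v x) * w x\<bar>)" by (rule integral_abs_bound)
  also have "\<dots> \<le> (LINT x|M. ?B x)" by (rule integral_mono[OF integrable_abs[OF int] B le])
  also have "\<dots> = C * (vol + (LINT x|M. v x ^ (2 * q)) + 2 * (LINT x|M. w x ^ (2 * q)))"
    using v w by (simp add: admissible_def integral_const_M)
  finally show "\<bar>LINT x|M. h (v x) * w x\<bar> \<le> C * (vol + (LINT x|M. v x ^ (2 * q)) + 2 * (LINT x|M. w x ^ (2 * q)))" .
qed

text \<open>The tangent inequality taken at \<open>t = 0\<close> gives H(s) \<le> h(s) s, so the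
  growth bound for \<open>h\<close> suffices.\<close>

lemma H_integrable:
  assumes v: "admissible v" shows "integrable M (\<lambda>x. H (v x))"
proof (rule Bochner_Integration.integrable_bound[OF h_times(1)[OF v v]])
  show "(\<lambda>x. H (v x)) \<in> borel_measurable M"
    using measurable_compose[OF _ H_measurable, of v M] v by (simp add: admissible_def)
  have "norm (H (v x)) \<le> norm (h (v x) * v x)" for x
    using H_convex[of "v x" 0] H_nonneg[of "v x"] H_0 by simp
  then show "AE x in M. norm (H (v x)) \<le> norm (h (v x) * v x)" by simp
qed

definition solves :: "(real^'n \<Rightarrow> real) \<Rightarrow> (real^'n \<Rightarrow> real \<times> (real^'n)) \<Rightarrow> bool" where
  "solves v U \<longleftrightarrow> U \<in> W0 \<Omega> \<and> (\<forall>G\<in>W0 \<Omega>. energy_form \<Omega> K U G = (LINT x|M. h (v x) * fst (G x)))"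

lemma W0_scale: "F \<in> W0 \<Omega> \<Longrightarrow> (\<lambda>x. t *\<^sub>R F x) \<in> W0 \<Omega>"
  using W0_add_scale[OF sets_\<Omega> W0_zero, of F t] by simp

text \<open>Rescaling \<open>F\<close> to unit energy turns the inhomogeneous bound from Young's inequality into
  boundedness of the functional.\<close>

lemma solvable:
  assumes v: "admissible v" shows "\<exists>U. solves v U"
proof -
  define l where "l F = (LINT x|M. h (v x) * fst (F x))" for F :: "real^'n \<Rightarrow> real \<times> (real^'n)"
  define B where "B = C * (vol + (LINT x|M. v x ^ (2 * q)) + 2 * (1 / S) ^ q)"
  have B0: "B \<ge> 0"
    unfolding B_def using C S
    by (intro mult_nonneg_nonneg add_nonneg_nonneg Bochner_Integration.integral_nonneg even_power_nonneg) auto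
  have bound: "(l F)\<^sup>2 \<le> B\<^sup>2 * energy_form \<Omega> K F F" if F: "F \<in> W0 \<Omega>" for F
  proof (rule field_le_epsilon)
    fix e :: real assume e: "e > 0"
    let ?E = "energy_form \<Omega> K F F"
    have E0: "?E \<ge> 0" using K by (intro energy_form_nonneg) simp
    \<comment> \<open>Added to the energy so that the rescaling factor exists even when the energy
      is 0; the size is chosen to make \<open>B\<^sup>2 * e'\<close> at most
      \<open>e\<close>.\<close>
    define e' where "e' = e / (B\<^sup>2 + 1)"
    have e': "e' > 0" "B\<^sup>2 * e' \<le> e" using e by (auto simp: e'_def field_simps add_pos_nonneg)
    define t where "t = 1 / sqrt (?E + e')"
    have t: "t > 0" "t\<^sup>2 = 1 / (?E + e')" using E0 e' by (auto simp: t_def power_divide)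
    let ?G = "\<lambda>x. t *\<^sub>R F x"
    have G: "?G \<in> W0 \<Omega>" by (rule W0_scale[OF F])
    have "(LINT x|M. (norm (snd (?G x)))\<^sup>2) = t\<^sup>2 * (LINT x|M. (norm (snd (F x)))\<^sup>2)"
      by (simp add: power_mult_distrib)
    also have "\<dots> \<le> t\<^sup>2 * ?E"
    proof (rule mult_left_mono)
      have "0 \<le> K * (LINT x|M. (fst (F x))\<^sup>2)" using K by (intro mult_nonneg_nonneg Bochner_Integration.integral_nonneg) auto
      then show "(LINT x|M. (norm (snd (F x)))\<^sup>2) \<le> ?E" unfolding energy_form_self by simp
    qed simp
    also have "\<dots> \<le> 1"
    proof -
      have "t\<^sup>2 * ?E + t\<^sup>2 * e' = 1" using E0 e' unfolding t(2) distrib_left[symmetric] by simp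
      moreover have "0 \<le> t\<^sup>2 * e'" using e' by simp
      ultimately show ?thesis by linarith
    qed
    finally have "(LINT x|M. (norm (snd (?G x)))\<^sup>2) / S \<le> 1 / S" using S by (intro divide_right_mono) auto
    then have "((LINT x|M. (norm (snd (?G x)))\<^sup>2) / S) ^ q \<le> (1 / S) ^ q"
      using S by (intro power_mono divide_nonneg_nonneg Bochner_Integration.integral_nonneg) auto
    with sobolev[OF G] have sG: "(LINT x|M. fst (?G x) ^ (2 * q)) \<le> (1 / S) ^ q" by linarith
    have "\<bar>l ?G\<bar> \<le> C * (vol + (LINT x|M. v x ^ (2 * q)) + 2 * (LINT x|M. fst (?G x) ^ (2 * q)))"
      unfolding l_def by (rule h_times(2)[OF v admissible_W0[OF G]])
    also have "\<dots> \<le> B" unfolding B_def using sG C by (intro mult_left_mono add_mono) auto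
    finally have "\<bar>l ?G\<bar> \<le> B" .
    moreover have "l ?G = t * l F"
      unfolding l_def using h_times(1)[OF v admissible_W0[OF F]] by (simp add: mult.left_commute[of "h _" t])
    ultimately have "(t * l F)\<^sup>2 \<le> B\<^sup>2" using B0 by (simp add: abs_le_square_iff[symmetric])
    then have "(l F)\<^sup>2 \<le> B\<^sup>2 * (?E + e')"
      using E0 e' unfolding power_mult_distrib t(2) by (simp add: field_simps)
    then show "(l F)\<^sup>2 \<le> B\<^sup>2 * ?E + e" using e'(2) by (simp add: distrib_left)
  qed
  show ?thesis
    by (rule W0_Riesz[OF sets_\<Omega> K h_times(1)[OF v admissible_W0] _ bound[unfolded l_def]])
      (auto simp: solves_def)
qed

definition T :: "(real^'n \<Rightarrow> real) \<Rightarrow> real^'n \<Rightarrow> real \<times> (real^'n)" where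
  "T v = (SOME U. solves v U)"

lemma T:
  assumes "admissible v"
  shows "T v \<in> W0 \<Omega>" "\<And>G. G \<in> W0 \<Omega> \<Longrightarrow> energy_form \<Omega> K (T v) G = (LINT x|M. h (v x) * fst (G x))"
  using someI_ex[OF solvable[OF assms]] unfolding T_def[symmetric] by (auto simp: solves_def)

section \<open>Order preservation and invariance of the well\<close>

text \<open>The difference \<open>D\<close> of \<open>U\<close> and \<open>V\<close> is tested with
  its positive part \<open>P\<close>. Since \<open>P\<close> agrees with \<open>D\<close> where it
  is nonzero, the energy form of \<open>D\<close> and \<open>P\<close> equals that of
  \<open>P\<close> with itself; being nonpositive it forces \<open>P\<close> to vanish.\<close>

lemma comparison:
  assumes U: "U \<in> W0 \<Omega>" and V: "V \<in> W0 \<Omega>"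
    and le: "\<And>G. G \<in> W0 \<Omega> \<Longrightarrow> (\<And>x. 0 \<le> fst (G x)) \<Longrightarrow> energy_form \<Omega> K U G \<le> energy_form \<Omega> K V G"
  shows "AE x in M. fst (U x) \<le> fst (V x)"
proof -
  define D where "D x = U x - V x" for x
  have D: "D \<in> W0 \<Omega>" unfolding D_def by (rule W0_diff[OF sets_\<Omega> U V])
  define P where "P = pos_jet D"
  have P: "P \<in> W0 \<Omega>" unfolding P_def by (rule W0_pos_jet[OF sets_\<Omega> D])
  have "energy_form \<Omega> K D P = energy_form \<Omega> K U P - energy_form \<Omega> K V P"
    using energy_form_add_scale[OF W0_sqint[OF U] W0_sqint[OF V] W0_sqint[OF P], of K "-1"] by (simp add: D_def[abs_def])
  moreover have "energy_form \<Omega> K U P \<le> energy_form \<Omega> K V P"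
    by (rule le[OF P]) (auto simp: P_def pos_jet_def)
  moreover have "energy_form \<Omega> K D P = energy_form \<Omega> K P P"
  proof -
    have "snd (D x) \<bullet> snd (P x) = snd (P x) \<bullet> snd (P x)" "fst (D x) * fst (P x) = fst (P x) * fst (P x)" for x
      by (simp_all add: P_def pos_jet_def)
    then show ?thesis unfolding energy_form_def by (simp only:)
  qed
  ultimately have "energy_form \<Omega> K P P \<le> 0" by linarith
  with energy_form_bounds(1)[OF W0_sqint[OF P] K] have "(LINT x|M. (norm (P x))\<^sup>2) \<le> 0" by linarith
  moreover have "(LINT x|M. (norm (P x))\<^sup>2) \<ge> 0" by (intro Bochner_Integration.integral_nonneg) simp
  ultimately have "(LINT x|M. (norm (P x))\<^sup>2) = 0" by linarith
  then have "AE x in M. (norm (P x))\<^sup>2 = 0"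
    using integral_nonneg_eq_0_iff_AE[OF sqint_integrable[OF W0_sqint[OF P]]] by simp
  then show ?thesis
  proof eventually_elim
    case (elim x)
    then have "P x = 0" by simp
    then have "\<not> fst (D x) > 0" by (auto simp: P_def pos_jet_def split: if_splits)
    then show ?case by (simp add: D_def)
  qed
qed

lemma T_mono:
  assumes v: "admissible v" and w: "admissible w" and le: "AE x in M. v x \<le> w x"
  shows "AE x in M. fst (T v x) \<le> fst (T w x)"
proof (rule comparison[OF T(1)[OF v] T(1)[OF w]])
  fix G assume G: "G \<in> W0 \<Omega>" "\<And>x. 0 \<le> fst (G x)"
  show "energy_form \<Omega> K (T v) G \<le> energy_form \<Omega> K (T w) G"
    unfolding T(2)[OF v G(1)] T(2)[OF w G(1)]
  proof (rule integral_mono_AE)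
    show "AE x in M. h (v x) * fst (G x) \<le> h (w x) * fst (G x)"
      using le by eventually_elim (intro mult_right_mono monoD[OF h_mono] G(2))
  qed (intro h_times(1) v w admissible_W0 G(1))+
qed

lemma energy_form_expand:
  assumes "F \<in> W0 \<Omega>" "D \<in> W0 \<Omega>"
  shows "energy_form \<Omega> K (\<lambda>x. F x + t *\<^sub>R D x) (\<lambda>x. F x + t *\<^sub>R D x)
    = energy_form \<Omega> K F F + 2 * t * energy_form \<Omega> K F D + t\<^sup>2 * energy_form \<Omega> K D D"
proof -
  let ?G = "\<lambda>x. F x + t *\<^sub>R D x"
  note sq = W0_sqint[OF assms(1)] W0_sqint[OF assms(2)]
  note G = W0_sqint[OF W0_add_scale[OF sets_\<Omega> assms, of t]]
  have "energy_form \<Omega> K ?G ?G = energy_form \<Omega> K ?G F + t * energy_form \<Omega> K ?G D"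
    using energy_form_add_scale[OF sq G] by (simp add: energy_form_sym[of \<Omega> K ?G])
  also have "\<dots> = (energy_form \<Omega> K F F + t * energy_form \<Omega> K D F) + t * (energy_form \<Omega> K F D + t * energy_form \<Omega> K D D)"
    using energy_form_add_scale[OF sq sq(1)] energy_form_add_scale[OF sq sq(2)] by simp
  finally show ?thesis by (simp add: energy_form_sym[of \<Omega> K D F] power2_eq_square algebra_simps)
qed

text \<open>Since \<open>H\<close> is convex, replacing it by its tangent at \<open>U\<close> gives a convex majorant of the
  energy that is minimal at \<open>T U\<close>.\<close>

lemma energy_segment:
  assumes U: "U \<in> W0 \<Omega>" and t: "0 \<le> t" "t \<le> 1"
  shows "energy (\<lambda>x. U x + t *\<^sub>R (T (\<lambda>x. fst (U x)) x - U x)) \<le> energy U"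
proof -
  note aU = admissible_W0[OF U]
  define D where "D x = T (\<lambda>x. fst (U x)) x - U x" for x
  have D: "D \<in> W0 \<Omega>" unfolding D_def by (rule W0_diff[OF sets_\<Omega> T(1)[OF aU] U])
  define G where "G x = U x + t *\<^sub>R D x" for x
  have G: "G \<in> W0 \<Omega>" unfolding G_def by (rule W0_add_scale[OF sets_\<Omega> U D])
  note ints = H_integrable[OF aU] h_times(1)[OF aU admissible_W0[OF D]]
  have "(LINT x|M. H (fst (U x)) + t * (h (fst (U x)) * fst (D x))) \<le> (LINT x|M. H (fst (G x)))"
  proof (rule integral_mono)
    show "H (fst (U x)) + t * (h (fst (U x)) * fst (D x)) \<le> H (fst (G x))" for x
      using H_convex[of "fst (U x)" "fst (G x)"] by (simp add: G_def mult.left_commute)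
  qed (use ints H_integrable[OF admissible_W0[OF G]] in auto)
  moreover have "(LINT x|M. h (fst (U x)) * fst (D x)) = energy_form \<Omega> K U D + energy_form \<Omega> K D D"
    using T(2)[OF aU D] energy_form_add_scale[OF W0_sqint[OF U] W0_sqint[OF D] W0_sqint[OF D], of K 1]
    by (simp add: D_def)
  ultimately have le: "(LINT x|M. H (fst (U x))) + t * (energy_form \<Omega> K U D + energy_form \<Omega> K D D) \<le> (LINT x|M. H (fst (G x)))"
    using ints by simp
  \<comment> \<open>After the linear terms cancel, the change of energy is at most t^2/2 - t times
    the form at \<open>D\<close>, which is nonpositive for t between 0 and 1.\<close>
  have "0 \<le> energy_form \<Omega> K D D" using K by (intro energy_form_nonneg) simp
  then have "t\<^sup>2 * energy_form \<Omega> K D D \<le> 2 * t * energy_form \<Omega> K D D"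
    using t mult_right_mono[of t 1 t] by (intro mult_right_mono) (auto simp: power2_eq_square)
  then have "t\<^sup>2 * energy_form \<Omega> K D D \<le> 2 * (t * energy_form \<Omega> K D D)" by (simp only: mult.assoc)
  moreover have "energy_form \<Omega> K G G = energy_form \<Omega> K U U + 2 * (t * energy_form \<Omega> K U D) + t\<^sup>2 * energy_form \<Omega> K D D"
    using energy_form_expand[OF U D, of t] by (simp only: G_def[abs_def] mult.assoc)
  ultimately have "energy G \<le> energy U"
    using le[unfolded distrib_left] unfolding energy_def by linarith
  then show ?thesis by (simp add: G_def[abs_def] D_def)
qed

text \<open>A discrete step could jump across the sphere, so the whole segment is inspected: leaving
  the ball would give, by the intermediate value theorem, a point with gradient integral
  \<open>rho\<close>, where the energy would be at least \<open>b\<close> and at most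
  \<open>energy U\<close>.\<close>

lemma energy_well_invariant:
  assumes U: "U \<in> W0 \<Omega>" and eU: "energy U < b" and gU: "(LINT x|M. (norm (snd (U x)))\<^sup>2) < rho"
  shows "energy (T (\<lambda>x. fst (U x))) < b" "(LINT x|M. (norm (snd (T (\<lambda>x. fst (U x)) x)))\<^sup>2) < rho"
proof -
  note aU = admissible_W0[OF U]
  let ?W = "T (\<lambda>x. fst (U x))"
  define D where "D x = ?W x - U x" for x
  have D: "D \<in> W0 \<Omega>" unfolding D_def by (rule W0_diff[OF sets_\<Omega> T(1)[OF aU] U])
  have W: "?W = (\<lambda>x. U x + 1 *\<^sub>R D x)" by (simp add: D_def)
  show "energy ?W < b"
    using energy_segment[OF U, of 1] eU by simp
  define f where "f t = (LINT x|M. (norm (snd (U x) + t *\<^sub>R snd (D x)))\<^sup>2)" for t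
  have f: "f t = (LINT x|M. (norm (snd (U x)))\<^sup>2) + 2 * t * (LINT x|M. snd (U x) \<bullet> snd (D x))
      + t\<^sup>2 * (LINT x|M. (norm (snd (D x)))\<^sup>2)" for t
    unfolding f_def by (rule integral_norm_add_scale) (intro sqint_snd W0_sqint U D)+
  have "f 1 < rho"
  proof (rule ccontr)
    assume "\<not> f 1 < rho"
    moreover have "f 0 \<le> rho" using gU by (simp add: f)
    moreover have "continuous_on {0..1} f" unfolding f[abs_def] by (intro continuous_intros)
    ultimately obtain t where t: "0 \<le> t" "t \<le> 1" "f t = rho" using IVT'[of f 0 rho 1] by auto
    have "b \<le> energy (\<lambda>x. U x + t *\<^sub>R D x)"
      unfolding energy_def
      by (rule ridge[OF W0_add_scale[OF sets_\<Omega> U D]]) (use t(3) in \<open>simp add: f_def\<close>)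
    also have "\<dots> \<le> energy U" using energy_segment[OF U t(1,2)] by (simp add: D_def)
    finally show False using eU by simp
  qed
  then show "(LINT x|M. (norm (snd (?W x)))\<^sup>2) < rho" by (simp add: f_def D_def)
qed

text \<open>Places the first iterate in the well although the starting function has no gradient of
  its own. The equation is tested with \<open>T v\<close>, and for \<open>d \<le> 1/2\<close> the
  quadratic term is absorbed on the left.\<close>

lemma small_start:
  assumes v: "admissible v" and le: "\<And>x. h (v x) \<le> d" and d: "0 \<le> d" "d \<le> 1/2"
  shows "energy_form \<Omega> K (T v) (T v) \<le> 2 * d * vol"
proof -
  note TW = T(1)[OF v]
  let ?E = "energy_form \<Omega> K (T v) (T v)"
  have int: "integrable M (\<lambda>x. (fst (T v x))\<^sup>2)" using sqint_integrable[OF sqint_fst[OF W0_sqint[OF TW]]] by simp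
  have "?E = (LINT x|M. h (v x) * fst (T v x))" by (rule T(2)[OF v TW])
  also have "\<dots> \<le> (LINT x|M. d * (1 + (fst (T v x))\<^sup>2))"
  proof (rule integral_mono)
    show "h (v x) * fst (T v x) \<le> d * (1 + (fst (T v x))\<^sup>2)" for x
    proof -
      have "h (v x) * fst (T v x) \<le> h (v x) * \<bar>fst (T v x)\<bar>" by (intro mult_left_mono h_nonneg) auto
      also have "\<dots> \<le> d * \<bar>fst (T v x)\<bar>" by (intro mult_right_mono le) auto
      also have "\<dots> \<le> d * (1 + (fst (T v x))\<^sup>2)"
      proof (rule mult_left_mono[OF _ d(1)])
        have "\<bar>y\<bar> \<le> 1 + y\<^sup>2" for y :: real
          using zero_le_power2[of "\<bar>y\<bar> - 1"] by (simp add: power2_diff)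
        then show "\<bar>fst (T v x)\<bar> \<le> 1 + (fst (T v x))\<^sup>2" .
      qed
      finally show ?thesis .
    qed
  qed (use h_times(1)[OF v admissible_W0[OF TW]] int in auto)
  also have "\<dots> = d * vol + d * (LINT x|M. (fst (T v x))\<^sup>2)"
    using int by (simp add: integral_const_M distrib_left)
  finally have fin: "?E \<le> d * vol + d * (LINT x|M. (fst (T v x))\<^sup>2)" .
  have "(LINT x|M. (fst (T v x))\<^sup>2) \<le> ?E"
  proof -
    have "0 \<le> (LINT x|M. (norm (snd (T v x)))\<^sup>2)" by (intro Bochner_Integration.integral_nonneg) simp
    then show ?thesis
      using energy_form_bounds(1)[OF W0_sqint[OF TW] K] unfolding integral_norm_jet[OF W0_sqint[OF TW]] by linarith
  qed
  from mult_left_mono[OF this d(1)] fin have "?E \<le> d * vol + d * ?E" by linarith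
  moreover have "d * ?E \<le> 1/2 * ?E" using K by (intro mult_right_mono d energy_form_nonneg) simp
  ultimately show ?thesis by linarith
qed

end

section \<open>Passage to the limit along increasing iterates\<close>

context monotone_iteration
begin

text \<open>Monotone convergence applied to the powers with exponent 2q shows that the supremum of
  the iterates is finite almost everywhere; Fatou's lemma puts the limit in L^(2q).\<close>

lemma monotone_bounded_limit:
  fixes u :: "nat \<Rightarrow> real^'n \<Rightarrow> real"
  assumes u: "\<And>k. admissible (u k)" and nn: "AE x in M. \<forall>k. 0 \<le> u k x"
    and mono: "AE x in M. \<forall>k. u k x \<le> u (Suc k) x"
    and bd: "\<And>k. (LINT x|M. u k x ^ (2 * q)) \<le> B"
  obtains v where "admissible v" "AE x in M. (\<lambda>k. u k x) \<longlonglongrightarrow> v x" "AE x in M. \<forall>k. u k x \<le> v x"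
proof -
  have um [measurable]: "u k \<in> borel_measurable M" for k using u by (simp add: admissible_def)
  let ?f = "\<lambda>k x. ennreal (u k x ^ (2 * q))"
  have "AE x in M. \<forall>k. ?f k x \<le> ?f (Suc k) x"
    using nn mono by eventually_elim (auto intro!: ennreal_leI power_mono)
  then have "(\<integral>\<^sup>+x. (SUP k. ?f k x) \<partial>M) = (SUP k. \<integral>\<^sup>+x. ?f k x \<partial>M)"
    by (intro nn_integral_monotone_convergence_SUP_AE) (auto simp: AE_all_countable)
  also have "\<dots> \<le> ennreal B"
  proof (rule SUP_least)
    fix k
    have "(\<integral>\<^sup>+x. ?f k x \<partial>M) = ennreal (LINT x|M. u k x ^ (2 * q))"
      using u by (intro nn_integral_eq_integral) (auto simp: admissible_def even_power_nonneg)
    then show "(\<integral>\<^sup>+x. ?f k x \<partial>M) \<le> ennreal B" by (simp add: bd ennreal_leI)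
  qed
  finally have "(\<integral>\<^sup>+x. (SUP k. ?f k x) \<partial>M) < \<infinity>" by (simp add: le_less_trans)
  then have fin: "AE x in M. (SUP k. ?f k x) \<noteq> \<infinity>" by (intro nn_integral_PInf_AE) auto
  define v where "v x = lim (\<lambda>k. u k x)" for x
  have vm: "v \<in> borel_measurable M" unfolding v_def by (rule borel_measurable_lim_metric) measurable
  have conv: "AE x in M. (\<lambda>k. u k x) \<longlonglongrightarrow> v x"
    using fin nn mono
  proof eventually_elim
    case (elim x)
    have inc: "incseq (\<lambda>k. u k x)" using elim by (intro incseq_SucI) auto
    obtain c where c: "0 \<le> c" "(SUP k. ?f k x) = ennreal c"
      using elim(1) by (cases "SUP k. ?f k x") auto
    have "u k x \<le> 1 + c" for k
    proof -
      have "?f k x \<le> ennreal c" using SUP_upper[of k UNIV "\<lambda>k. ?f k x"] c(2) by simp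
      then have "u k x ^ (2 * q) \<le> c" using c(1) by simp
      then show ?thesis using abs_le_one_plus_power[of "u k x"] by linarith
    qed
    with inc have "convergent (\<lambda>k. u k x)"
      using incseq_convergent[of "\<lambda>k. u k x" "1 + c"] by (metis convergentI)
    then show ?case by (simp add: v_def convergent_LIMSEQ_iff)
  qed
  have pow: "AE x in M. (\<lambda>k. u k x ^ (2 * q)) \<longlonglongrightarrow> v x ^ (2 * q)"
    using conv by eventually_elim (intro tendsto_intros)
  have int: "integrable M (\<lambda>x. u k x ^ (2 * q))" for k using u by (simp add: admissible_def)
  have "integrable M (\<lambda>x. v x ^ (2 * q))"
  proof (rule fatou_real(1)[OF int _ pow _ bd])
    show "(\<lambda>x. v x ^ (2 * q)) \<in> borel_measurable M" using vm by measurable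
  qed (simp add: even_power_nonneg)
  with vm have "admissible v" by (simp add: admissible_def)
  moreover have "AE x in M. \<forall>k. u k x \<le> v x"
    using conv mono
  proof eventually_elim
    case (elim x)
    have "incseq (\<lambda>k. u k x)" using elim(2) by (intro incseq_SucI) auto
    then show ?case using elim(1) incseq_le by blast
  qed
  ultimately show ?thesis using that conv by blast
qed

text \<open>Strong convergence comes from order. Subtracting the equations of two iterates and
  testing with their difference leaves an integral of (h(u m) - h(u n)) times that difference; since
  all iterates lie between 0 and \<open>v\<close>, it is at most the sum of two integrals of
  \<open>h(v)\<close> against \<open>v\<close> minus an iterate, and these tend to 0.\<close>

theorem solution_in_well:
  assumes u0: "admissible u0" and nn0: "\<And>x. 0 \<le> u0 x" and sub: "AE x in M. u0 x \<le> fst (T u0 x)"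
    and e0: "energy (T u0) < b" and g0: "(LINT x|M. (norm (snd (T u0 x)))\<^sup>2) < rho"
  shows "\<exists>U\<in>W0 \<Omega>. (AE x in M. u0 x \<le> fst (U x)) \<and>
    (\<forall>V\<in>W0 \<Omega>. energy_form \<Omega> K U V = (LINT x|M. h (fst (U x)) * fst (V x)))"
proof -
  \<comment> \<open>The sequence begins at \<open>T u0\<close>, not at \<open>u0\<close>, because
    membership in \<open>W0\<close> is part of the invariant.\<close>
  define U where "U k = ((\<lambda>V. T (\<lambda>x. fst (V x))) ^^ k) (T u0)" for k :: nat
  have U0: "U 0 = T u0" and USuc: "U (Suc k) = T (\<lambda>x. fst (U k x))" for k by (simp_all add: U_def)
  have inv: "U k \<in> W0 \<Omega> \<and> energy (U k) < b \<and> (LINT x|M. (norm (snd (U k x)))\<^sup>2) < rho" for k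
  proof (induction k)
    case 0 show ?case using T(1)[OF u0] e0 g0 by (simp add: U0)
  next
    case (Suc k)
    then show ?case
      using T(1)[OF admissible_W0] energy_well_invariant[of "U k"] by (simp add: USuc)
  qed
  then have UW: "U k \<in> W0 \<Omega>" and gU: "(LINT x|M. (norm (snd (U k x)))\<^sup>2) < rho" for k by auto
  define u where "u k x = fst (U k x)" for k x
  have u: "admissible (u k)" for k unfolding u_def by (rule admissible_W0[OF UW])
  have USu: "energy_form \<Omega> K (U (Suc k)) V = (LINT x|M. h (u k x) * fst (V x))" if "V \<in> W0 \<Omega>" for k V
    unfolding USuc u_def by (rule T(2)[OF admissible_W0[OF UW] that])
  have "AE x in M. u k x \<le> u (Suc k) x" for k
  proof (induction k)
    case 0
    then show ?case unfolding u_def USuc U0 by (rule T_mono[OF u0 admissible_W0[OF T(1)[OF u0]] sub])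
  next
    case (Suc k)
    then show ?case
      using T_mono[OF u u, of k "Suc k"] unfolding u_def by (simp add: USuc)
  qed
  then have mono: "AE x in M. \<forall>k. u k x \<le> u (Suc k) x" by (simp add: AE_all_countable)
  have ge0: "AE x in M. \<forall>k. u0 x \<le> u k x"
    using sub mono
  proof eventually_elim
    case (elim x)
    show ?case
    proof
      fix k show "u0 x \<le> u k x"
      proof (induction k)
        case 0 show ?case using elim(1) by (simp add: u_def U0)
      next
        case (Suc k)
        then show ?case using spec[OF elim(2), of k] by linarith
      qed
    qed
  qed
  have nn: "AE x in M. \<forall>k. 0 \<le> u k x"
    using ge0 by eventually_elim (blast intro: order_trans[OF nn0])
  have rho: "rho \<ge> 0"
  proof -
    have "0 \<le> (LINT x|M. (norm (snd (U 0 x)))\<^sup>2)" by (intro Bochner_Integration.integral_nonneg) simp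
    with gU[of 0] show ?thesis by linarith
  qed
  have bd: "(LINT x|M. u k x ^ (2 * q)) \<le> (rho / S) ^ q" for k
  proof -
    have "((LINT x|M. (norm (snd (U k x)))\<^sup>2) / S) ^ q \<le> (rho / S) ^ q"
      using gU[of k] S by (intro power_mono divide_right_mono divide_nonneg_nonneg Bochner_Integration.integral_nonneg) auto
    with sobolev[OF UW[of k]] show ?thesis unfolding u_def by linarith
  qed
  obtain v where v: "admissible v" and lim: "AE x in M. (\<lambda>k. u k x) \<longlonglongrightarrow> v x" and le_v: "AE x in M. \<forall>k. u k x \<le> v x"
    by (rule monotone_bounded_limit[OF u nn mono bd])
  have vm: "v \<in> borel_measurable M" using v by (simp add: admissible_def)
  have um: "u k \<in> borel_measurable M" for k using u by (simp add: admissible_def)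
  have adm_diff: "admissible (\<lambda>x. v x - u k x)" for k
    unfolding admissible_def
  proof
    show "integrable M (\<lambda>x. (v x - u k x) ^ (2 * q))"
    proof (rule Bochner_Integration.integrable_bound)
      show "integrable M (\<lambda>x. v x ^ (2 * q))" using v by (simp add: admissible_def)
      show "AE x in M. norm ((v x - u k x) ^ (2 * q)) \<le> norm (v x ^ (2 * q))"
        using nn le_v
      proof eventually_elim
        case (elim x)
        then have "(v x - u k x) ^ (2 * q) \<le> v x ^ (2 * q)" by (intro power_mono) auto
        then show ?case using even_power_nonneg[of "v x - u k x"] even_power_nonneg[of "v x"] by simp
      qed
    qed (use vm um in measurable)
  qed (use vm um in measurable)
  \<comment> \<open>The error term in the Cauchy estimate; it tends to 0 by domination with
    \<open>h (v x) * v x\<close>, integrable because \<open>v\<close> is admissible.\<close>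
  define c where "c k = (LINT x|M. h (v x) * (v x - u k x))" for k
  have "c \<longlonglongrightarrow> (LINT x|M. 0)"
    unfolding c_def
  proof (rule integral_dominated_convergence[where w = "\<lambda>x. h (v x) * v x"])
    show "AE x in M. (\<lambda>k. h (v x) * (v x - u k x)) \<longlonglongrightarrow> 0"
      using lim
    proof eventually_elim
      case (elim x)
      then have "(\<lambda>k. h (v x) * (v x - u k x)) \<longlonglongrightarrow> h (v x) * (v x - v x)" by (intro tendsto_intros)
      then show ?case by simp
    qed
    show "AE x in M. norm (h (v x) * (v x - u k x)) \<le> h (v x) * v x" for k
      using nn le_v
    proof eventually_elim
      case (elim x)
      then show ?case by (auto simp: abs_mult h_nonneg intro!: mult_left_mono)
    qed
    show "integrable M (\<lambda>x. h (v x) * v x)" by (rule h_times(1)[OF v v])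
    show "(\<lambda>x. h (v x) * (v x - u k x)) \<in> borel_measurable M" for k
      using h_times(1)[OF v adm_diff] by (rule borel_measurable_integrable)
  qed simp
  then have c0: "c \<longlonglongrightarrow> 0" by simp
  have cauchy_est: "energy_form \<Omega> K (\<lambda>x. U (Suc m) x - U (Suc n) x) (\<lambda>x. U (Suc m) x - U (Suc n) x) \<le> c (Suc m) + c (Suc n)" for m n
  proof -
    let ?D = "\<lambda>x. U (Suc m) x - U (Suc n) x"
    have D: "?D \<in> W0 \<Omega>" by (rule W0_diff[OF sets_\<Omega> UW UW])
    have "energy_form \<Omega> K ?D ?D = energy_form \<Omega> K (U (Suc m)) ?D - energy_form \<Omega> K (U (Suc n)) ?D"
      using energy_form_add_scale[OF W0_sqint[OF UW] W0_sqint[OF UW] W0_sqint[OF D], of K "Suc m" "-1" "Suc n"] by simp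
    also have "\<dots> = (LINT x|M. h (u m x) * fst (?D x)) - (LINT x|M. h (u n x) * fst (?D x))"
      by (simp only: USu[OF D])
    also have "\<dots> = (LINT x|M. h (u m x) * fst (?D x) - h (u n x) * fst (?D x))"
      by (rule Bochner_Integration.integral_diff[symmetric]) (intro h_times(1) u admissible_W0[OF D])+
    also have "\<dots> \<le> (LINT x|M. h (v x) * (v x - u (Suc m) x) + h (v x) * (v x - u (Suc n) x))"
    proof (rule integral_mono_AE)
      show "AE x in M. h (u m x) * fst (?D x) - h (u n x) * fst (?D x) \<le> h (v x) * (v x - u (Suc m) x) + h (v x) * (v x - u (Suc n) x)"
        using le_v
      proof eventually_elim
        case (elim x)
        have hm: "h (u m x) \<le> h (v x)" "h (u n x) \<le> h (v x)" using elim by (auto intro: monoD[OF h_mono])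
        have "h (u m x) * fst (?D x) - h (u n x) * fst (?D x) = (h (u m x) - h (u n x)) * (u (Suc m) x - u (Suc n) x)"
          by (simp add: u_def left_diff_distrib)
        also have "\<dots> \<le> \<bar>h (u m x) - h (u n x)\<bar> * \<bar>u (Suc m) x - u (Suc n) x\<bar>"
          by (simp only: abs_mult[symmetric] abs_ge_self)
        also have "\<dots> \<le> h (v x) * ((v x - u (Suc m) x) + (v x - u (Suc n) x))"
        proof (rule mult_mono)
          show "\<bar>h (u m x) - h (u n x)\<bar> \<le> h (v x)" using hm h_nonneg[of "u m x"] h_nonneg[of "u n x"] by linarith
          have "u (Suc m) x \<le> v x" "u (Suc n) x \<le> v x" using elim by auto
          then show "\<bar>u (Suc m) x - u (Suc n) x\<bar> \<le> (v x - u (Suc m) x) + (v x - u (Suc n) x)" by linarith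
        qed (use h_nonneg in auto)
        finally show ?case by (simp only: distrib_left)
      qed
    qed (intro Bochner_Integration.integrable_add Bochner_Integration.integrable_diff h_times(1) u v adm_diff admissible_W0[OF D])+
    also have "\<dots> = c (Suc m) + c (Suc n)"
      unfolding c_def by (intro Bochner_Integration.integral_add h_times(1) v adm_diff)
    finally show ?thesis .
  qed
  have "\<exists>N. \<forall>m\<ge>N. \<forall>n\<ge>N. energy_form \<Omega> K (\<lambda>x. U (Suc m) x - U (Suc n) x) (\<lambda>x. U (Suc m) x - U (Suc n) x) < e"
    if e: "e > 0" for e
  proof -
    from order_tendstoD(2)[OF c0, of "e/2"] e obtain N where N: "\<And>n. n \<ge> N \<Longrightarrow> c n < e / 2"
      by (auto simp: eventually_sequentially)
    show ?thesis
    proof (intro exI[of _ N] allI impI)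
      fix m n assume mn: "N \<le> m" "N \<le> n"
      have "c (Suc m) < e / 2" "c (Suc n) < e / 2" by (rule N, use mn in simp)+
      with cauchy_est[of m n]
      show "energy_form \<Omega> K (\<lambda>x. U (Suc m) x - U (Suc n) x) (\<lambda>x. U (Suc m) x - U (Suc n) x) < e" by linarith
    qed
  qed
  from W0_complete[OF sets_\<Omega> K, of "\<lambda>k. U (Suc k)", OF UW this] obtain G where G: "G \<in> W0 \<Omega>"
    and Elim: "(\<lambda>n. energy_form \<Omega> K (\<lambda>x. U (Suc n) x - G x) (\<lambda>x. U (Suc n) x - G x)) \<longlonglongrightarrow> 0" by blast
  have Llim: "(\<lambda>n. LINT x|M. (norm (U (Suc n) x - G x))\<^sup>2) \<longlonglongrightarrow> 0"
  proof (rule real_tendsto_sandwich[OF _ _ tendsto_const Elim])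
    show "\<forall>\<^sub>F n in sequentially. 0 \<le> (LINT x|M. (norm (U (Suc n) x - G x))\<^sup>2)"
      by (intro always_eventually allI Bochner_Integration.integral_nonneg) simp
    show "\<forall>\<^sub>F n in sequentially. (LINT x|M. (norm (U (Suc n) x - G x))\<^sup>2) \<le> energy_form \<Omega> K (\<lambda>x. U (Suc n) x - G x) (\<lambda>x. U (Suc n) x - G x)"
      by (intro always_eventually allI energy_form_bounds(1) sqint_diff W0_sqint UW G K)
  qed
  have Gv: "AE x in M. fst (G x) = v x"
  proof -
    obtain r :: "nat \<Rightarrow> nat" where r: "strict_mono r" and ae: "AE x in M. (\<lambda>n. U (Suc (r n)) x) \<longlonglongrightarrow> G x"
      by (rule sqint_AE_subseq[of M "\<lambda>n. U (Suc n)", OF W0_sqint[OF UW] W0_sqint[OF G] Llim])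
    show ?thesis
      using ae lim
    proof eventually_elim
      case (elim x)
      from tendsto_fst[OF elim(1)] have 1: "(\<lambda>n. u (Suc (r n)) x) \<longlonglongrightarrow> fst (G x)" by (simp add: u_def)
      have "(\<lambda>n. u (Suc n) x) \<longlonglongrightarrow> v x" using elim(2) by (rule LIMSEQ_Suc)
      from LIMSEQ_subseq_LIMSEQ[OF this r] have "(\<lambda>n. u (Suc (r n)) x) \<longlonglongrightarrow> v x" by (simp add: o_def)
      with 1 show ?case by (rule LIMSEQ_unique)
    qed
  qed
  have "energy_form \<Omega> K G V = (LINT x|M. h (fst (G x)) * fst (V x))" if V: "V \<in> W0 \<Omega>" for V
  proof -
    have "(\<lambda>n. energy_form \<Omega> K (U (Suc n)) V) \<longlonglongrightarrow> energy_form \<Omega> K G V"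
    proof -
      \<comment> \<open>The weight \<open>K\<close> is moved into the test pair, which turns the
        energy form into an L^2 inner product that is continuous in its first argument.\<close>
      define V' where "V' x = (K * fst (V x), snd (V x))" for x
      have V': "sqint M V'"
        unfolding V'_def using sqint_scaleR[OF sqint_fst[OF W0_sqint[OF V]], of K] sqint_snd[OF W0_sqint[OF V]]
        by (intro sqint_Pair) auto
      have eq: "energy_form \<Omega> K F V = (LINT x|M. F x \<bullet> V' x)" if "F \<in> W0 \<Omega>" for F
      proof -
        have "F x \<bullet> V' x = snd (F x) \<bullet> snd (V x) + K * (fst (F x) * fst (V x))" for x
          by (simp add: V'_def inner_prod_def algebra_simps)
        then show ?thesis
          unfolding energy_form_def
          using sqint_inner[OF sqint_snd[OF W0_sqint[OF that]] sqint_snd[OF W0_sqint[OF V]]]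
            sqint_mult[OF sqint_fst[OF W0_sqint[OF that]] sqint_fst[OF W0_sqint[OF V]]] by simp
      qed
      show ?thesis
        unfolding eq[OF UW] eq[OF G]
        by (rule tendsto_sqint_inner[OF W0_sqint[OF UW] W0_sqint[OF G] V' Llim])
    qed
    moreover have "(\<lambda>n. energy_form \<Omega> K (U (Suc n)) V) \<longlonglongrightarrow> (LINT x|M. h (v x) * fst (V x))"
      unfolding USu[OF V]
    proof (rule integral_dominated_convergence[where w = "\<lambda>x. \<bar>h (v x) * fst (V x)\<bar>"])
      show "AE x in M. (\<lambda>n. h (u n x) * fst (V x)) \<longlonglongrightarrow> h (v x) * fst (V x)"
        using lim
      proof eventually_elim
        case (elim x)
        then have "(\<lambda>n. h (u n x)) \<longlonglongrightarrow> h (v x)" by (rule continuous_on_tendsto_compose[OF h_cont]) auto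
        then show ?case by (intro tendsto_intros)
      qed
      show "AE x in M. norm (h (u n x) * fst (V x)) \<le> \<bar>h (v x) * fst (V x)\<bar>" for n
        using le_v
      proof eventually_elim
        case (elim x)
        then have "h (u n x) \<le> h (v x)" by (auto intro: monoD[OF h_mono])
        then show ?case by (simp add: abs_mult h_nonneg mult_right_mono)
      qed
      show "integrable M (\<lambda>x. \<bar>h (v x) * fst (V x)\<bar>)" by (intro integrable_abs h_times(1) v admissible_W0[OF V])
      show "(\<lambda>x. h (u n x) * fst (V x)) \<in> borel_measurable M" for n
        using h_times(1)[OF u admissible_W0[OF V]] by (rule borel_measurable_integrable)
      show "(\<lambda>x. h (v x) * fst (V x)) \<in> borel_measurable M"
        using h_times(1)[OF v admissible_W0[OF V]] by (rule borel_measurable_integrable)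
    qed
    ultimately have "energy_form \<Omega> K G V = (LINT x|M. h (v x) * fst (V x))" by (rule LIMSEQ_unique)
    also have "\<dots> = (LINT x|M. h (fst (G x)) * fst (V x))"
    proof (rule Bochner_Integration.integral_cong_AE)
      show "AE x in M. h (v x) * fst (V x) = h (fst (G x)) * fst (V x)"
        using Gv by eventually_elim simp
    qed (intro borel_measurable_integrable[OF h_times(1)] v admissible_W0 G V)+
    finally show ?thesis .
  qed
  moreover have "AE x in M. u0 x \<le> fst (G x)"
    using ge0 le_v Gv
  proof eventually_elim
    case (elim x)
    then have "u0 x \<le> u 0 x" "u 0 x \<le> v x" by blast+
    then show ?case using elim(3) by simp
  qed
  ultimately show ?thesis using G by blast
qed

end

section \<open>A positive start for the iteration\<close>

text \<open>Each partial derivative of \<phi> is itself a test function and may be inserted into the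
  weak gradient identity of \<open>G\<close>; summing over the coordinates gives the
  Laplacian.\<close>

lemma laplacian_by_parts:
  fixes \<Omega> :: "(real^'n) set"
  assumes \<Omega>: "\<Omega> \<in> sets lebesgue" and \<phi>: "\<phi> \<in> test_functions \<Omega>" and G: "G \<in> W0 \<Omega>"
  shows "integrable (lebesgue_on \<Omega>) (\<lambda>x. - laplacian \<phi> x * fst (G x))"
    "(LINT x|lebesgue_on \<Omega>. grad \<phi> x \<bullet> snd (G x)) = (LINT x|lebesgue_on \<Omega>. - laplacian \<phi> x * fst (G x))"
proof -
  define \<psi> where "\<psi> i x = frechet_derivative \<phi> (at x) (axis i 1)" for i x
  define \<psi>' where "\<psi>' i x = frechet_derivative (\<psi> i) (at x) (axis i 1)" for i x
  have t: "\<psi> i \<in> test_functions \<Omega>" "\<psi>' i \<in> test_functions \<Omega>" for i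
    using test_frechet[OF \<phi>] test_frechet[OF test_frechet[OF \<phi>]] by (simp_all add: \<psi>_def[abs_def] \<psi>'_def[abs_def])
  have sq: "sqint (lebesgue_on \<Omega>) (\<psi> i)" "sqint (lebesgue_on \<Omega>) (\<psi>' i)" for i
    using sqint_fst[OF test_jet_sqint[OF t(1) \<Omega>]] sqint_fst[OF test_jet_sqint[OF t(2) \<Omega>]] by simp_all
  have lap: "laplacian \<phi> x = (\<Sum>i\<in>UNIV. \<psi>' i x)" for x
    by (simp add: laplacian_def \<psi>_def[abs_def] \<psi>'_def)
  note G1 = sqint_fst[OF W0_sqint[OF G]] and G2 = sqint_nth[OF sqint_snd[OF W0_sqint[OF G]]]
  have i1: "integrable (lebesgue_on \<Omega>) (\<lambda>x. fst (G x) * \<psi>' i x)" for i by (rule sqint_mult[OF G1 sq(2)])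
  have i2: "integrable (lebesgue_on \<Omega>) (\<lambda>x. snd (G x) $ i * \<psi> i x)" for i by (rule sqint_mult[OF G2 sq(1)])
  have eq1: "- laplacian \<phi> x * fst (G x) = - (\<Sum>i\<in>UNIV. fst (G x) * \<psi>' i x)" for x
    by (simp add: lap sum_distrib_left[symmetric] mult.commute)
  show "integrable (lebesgue_on \<Omega>) (\<lambda>x. - laplacian \<phi> x * fst (G x))"
    unfolding eq1 by (intro Bochner_Integration.integrable_minus Bochner_Integration.integrable_sum i1)
  have weak: "(LINT x|lebesgue_on \<Omega>. fst (G x) * \<psi>' i x) = - (LINT x|lebesgue_on \<Omega>. snd (G x) $ i * \<psi> i x)" for i
    using spec[OF bspec[OF W0_weak_gradient[OF \<Omega> G, unfolded is_weak_gradient_def] t(1)[of i]], of i]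
    by (simp add: \<psi>'_def)
  have "(LINT x|lebesgue_on \<Omega>. grad \<phi> x \<bullet> snd (G x)) = (LINT x|lebesgue_on \<Omega>. (\<Sum>i\<in>UNIV. snd (G x) $ i * \<psi> i x))"
    by (simp add: inner_vec_def \<psi>_def mult.commute)
  also have "\<dots> = (\<Sum>i\<in>UNIV. LINT x|lebesgue_on \<Omega>. snd (G x) $ i * \<psi> i x)"
    by (rule Bochner_Integration.integral_sum) (rule i2)
  also have "\<dots> = - (\<Sum>i\<in>UNIV. LINT x|lebesgue_on \<Omega>. fst (G x) * \<psi>' i x)"
    by (simp add: weak sum_negf)
  also have "(\<Sum>i\<in>UNIV. LINT x|lebesgue_on \<Omega>. fst (G x) * \<psi>' i x) = (LINT x|lebesgue_on \<Omega>. (\<Sum>i\<in>UNIV. fst (G x) * \<psi>' i x))"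
    by (rule Bochner_Integration.integral_sum[symmetric]) (rule i1)
  also have "- \<dots> = (LINT x|lebesgue_on \<Omega>. - laplacian \<phi> x * fst (G x))"
    unfolding eq1 by simp
  finally show "(LINT x|lebesgue_on \<Omega>. grad \<phi> x \<bullet> snd (G x)) = (LINT x|lebesgue_on \<Omega>. - laplacian \<phi> x * fst (G x))" .
qed

lemma test_bump:
  assumes "r > 0" "cball a r \<subseteq> \<Omega>"
  shows "bump a r \<in> test_functions \<Omega>"
proof (rule test_functionsI[OF smooth_on_bump compact_cball assms(2)])
  fix x assume "x \<notin> cball a r"
  then have "x \<notin> ball a r" by auto
  then show "bump a r x = 0" using bump_nz_iff[OF assms(1)] by blast
qed

text \<open>Countability keeps the later supremum of bumps measurable and allows the
  almost-everywhere inequalities for the single bumps to be combined. Closed balls inside \<Omega>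
  make the bumps test functions.\<close>

lemma open_countable_balls:
  fixes \<Omega> :: "'a::euclidean_space set"
  assumes "open \<Omega>" "\<Omega> \<noteq> {}"
  shows "\<exists>(a::nat \<Rightarrow> 'a) r. (\<forall>i. 0 < r i \<and> cball (a i) (r i) \<subseteq> \<Omega>) \<and> \<Omega> \<subseteq> (\<Union>i. ball (a i) (r i))"
proof -
  define \<F> where "\<F> = {ball x e |x e. e > 0 \<and> cball x e \<subseteq> \<Omega>}"
  have cover: "\<Union>\<F> = \<Omega>"
  proof
    show "\<Union>\<F> \<subseteq> \<Omega>" unfolding \<F>_def using ball_subset_cball by blast
    show "\<Omega> \<subseteq> \<Union>\<F>"
    proof
      fix x assume "x \<in> \<Omega>"
      then obtain e where "e > 0" "cball x e \<subseteq> \<Omega>" using assms(1) open_contains_cball by blast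
      then show "x \<in> \<Union>\<F>" unfolding \<F>_def by (intro UnionI[of "ball x e"]) auto
    qed
  qed
  obtain \<F>' where \<F>': "\<F>' \<subseteq> \<F>" "countable \<F>'" "\<Union>\<F>' = \<Union>\<F>"
    using Lindelof[of \<F>] unfolding \<F>_def by blast
  have ne: "\<F>' \<noteq> {}" using \<F>'(3) cover assms(2) by auto
  have "\<forall>i. \<exists>p. snd p > 0 \<and> cball (fst p) (snd p) \<subseteq> \<Omega> \<and> from_nat_into \<F>' i = ball (fst p) (snd p)"
  proof
    fix i
    have "from_nat_into \<F>' i \<in> \<F>" using from_nat_into[OF ne] \<F>'(1) by blast
    then obtain x e where "e > 0" "cball x e \<subseteq> \<Omega>" "from_nat_into \<F>' i = ball x e" unfolding \<F>_def by blast
    then show "\<exists>p. snd p > 0 \<and> cball (fst p) (snd p) \<subseteq> \<Omega> \<and> from_nat_into \<F>' i = ball (fst p) (snd p)"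
      by (intro exI[of _ "(x, e)"]) simp
  qed
  from choice[OF this] obtain p where p: "\<And>i. snd (p i) > 0 \<and> cball (fst (p i)) (snd (p i)) \<subseteq> \<Omega> \<and> from_nat_into \<F>' i = ball (fst (p i)) (snd (p i))"
    by blast
  have "\<Omega> = (\<Union>i. from_nat_into \<F>' i)"
    using range_from_nat_into[OF ne \<F>'(2)] \<F>'(3) cover by simp
  then have "\<Omega> \<subseteq> (\<Union>i. ball (fst (p i)) (snd (p i)))" using p by simp
  then show ?thesis using p by (intro exI[of _ "\<lambda>i. fst (p i)"] exI[of _ "\<lambda>i. snd (p i)"]) simp
qed

section \<open>Subsolutions and their supremum\<close>

context monotone_iteration
begin

text \<open>The pointwise hypothesis says that \<open>e * \<phi>\<close> is a classical subsolution
  of (- \<Delta> + K) u = h(u). Multiplied by a nonnegative element of \<open>W0\<close> and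
  integrated by parts, it becomes the hypothesis of \<open>comparison\<close>.\<close>

lemma subsolution_le_T:
  assumes \<phi>: "\<phi> \<in> test_functions \<Omega>" and sub: "\<And>x. e * (- laplacian \<phi> x + K * \<phi> x) \<le> h (e * \<phi> x)"
  shows "admissible (\<lambda>x. e * \<phi> x)" "AE x in M. e * \<phi> x \<le> fst (T (\<lambda>x. e * \<phi> x) x)"
proof -
  define U where "U x = e *\<^sub>R jet \<phi> x" for x
  have jW: "jet \<phi> \<in> W0 \<Omega>" by (rule W0_jet[OF \<phi> sets_\<Omega>])
  have U: "U \<in> W0 \<Omega>" unfolding U_def by (rule W0_scale[OF jW])
  have fU: "fst (U x) = e * \<phi> x" for x by (simp add: U_def)
  show adm: "admissible (\<lambda>x. e * \<phi> x)" using admissible_W0[OF U] by (simp add: fU)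
  have "AE x in M. fst (U x) \<le> fst (T (\<lambda>x. e * \<phi> x) x)"
  proof (rule comparison[OF U T(1)[OF adm]])
    fix G assume G: "G \<in> W0 \<Omega>" "\<And>x. 0 \<le> fst (G x)"
    note lap = laplacian_by_parts[OF sets_\<Omega> \<phi> G(1)]
    have i2: "integrable M (\<lambda>x. \<phi> x * fst (G x))"
      using sqint_mult[OF sqint_fst[OF W0_sqint[OF jW]] sqint_fst[OF W0_sqint[OF G(1)]]] by simp
    have "energy_form \<Omega> K U G = e * ((LINT x|M. - laplacian \<phi> x * fst (G x)) + K * (LINT x|M. \<phi> x * fst (G x)))"
      unfolding energy_form_def lap(2)[symmetric] by (simp add: U_def mult.assoc distrib_left mult.left_commute)
    also have "\<dots> = (LINT x|M. e * (- laplacian \<phi> x * fst (G x) + K * (\<phi> x * fst (G x))))"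
      using lap(1) i2 by simp
    also have "\<dots> \<le> (LINT x|M. h (e * \<phi> x) * fst (G x))"
    proof (rule integral_mono)
      show "e * (- laplacian \<phi> x * fst (G x) + K * (\<phi> x * fst (G x))) \<le> h (e * \<phi> x) * fst (G x)" for x
        using mult_right_mono[OF sub[of x] G(2)[of x]] by (simp add: algebra_simps)
      show "integrable M (\<lambda>x. h (e * \<phi> x) * fst (G x))" by (rule h_times(1)[OF adm admissible_W0[OF G(1)]])
    qed (use lap(1) i2 in auto)
    finally show "energy_form \<Omega> K U G \<le> energy_form \<Omega> K (T (\<lambda>x. e * \<phi> x)) G"
      by (simp only: T(2)[OF adm G(1)])
  qed
  then show "AE x in M. e * \<phi> x \<le> fst (T (\<lambda>x. e * \<phi> x) x)" by (simp only: fU)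
qed

text \<open>The infinite slope of \<open>h\<close> at the origin makes small multiples of bump functions on
  arbitrary balls subsolutions; the iteration starts from their pointwise supremum.\<close>

theorem positive_solution_in_well:
  assumes ne: "\<Omega> \<noteq> {}" and b: "b > 0" and rho: "rho > 0" and h0: "h 0 = 0"
    and slope: "\<And>A. \<exists>d>0. \<forall>s. 0 \<le> s \<and> s \<le> d \<longrightarrow> A * s \<le> h s"
  shows "\<exists>U\<in>W0 \<Omega>. (AE x in M. 0 < fst (U x)) \<and>
    (\<forall>V\<in>W0 \<Omega>. energy_form \<Omega> K U V = (LINT x|M. h (fst (U x)) * fst (V x)))"
proof -
  \<comment> \<open>Adding 1 makes the divisor positive and strictly larger than \<open>vol\<close>;
    with the \<open>d\<close> below, the bound \<open>2 * d * vol\<close> for the energy form of the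
    first iterate falls below both \<open>rho\<close> and \<open>b\<close>.\<close>
  define c where "c = vol + 1"
  have c: "c > 0" "vol < c" "vol \<ge> 0" using measure_nonneg[of M "space M"] by (simp_all add: c_def del: measure_nonneg)
  define d where "d = min (1/2) (min rho b / (2 * c))"
  have "0 < min rho b / (2 * c)" using b rho c(1) by (intro divide_pos_pos) auto
  then have d: "0 < d" "d \<le> 1/2" unfolding d_def by auto
  have "2 * d * vol \<le> (min rho b / c) * vol"
    using c by (intro mult_right_mono) (auto simp: d_def min_def field_simps)
  also have "\<dots> < min rho b"
  proof -
    have "min rho b * vol < min rho b * c" using b rho c by (intro mult_strict_left_mono) auto
    then show ?thesis using pos_divide_less_eq[OF c(1)] by (simp only: times_divide_eq_left)
  qed
  finally have dv: "2 * d * vol < rho" "2 * d * vol < b" by simp_all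
  \<comment> \<open>A common height for all bumps. It keeps \<open>h\<close> of their supremum at
    most \<open>d\<close>, as \<open>small_start\<close> requires.\<close>
  obtain e where e: "0 < e" "e \<le> 1" "h e \<le> d"
  proof -
    have "isCont h 0" using h_cont by (simp add: continuous_on_eq_continuous_at)
    then have "(h \<longlongrightarrow> 0) (at_right 0)" using h0 by (simp add: isCont_def filterlim_at_split)
    from order_tendstoD(2)[OF this d(1)] obtain y where y: "y > 0" "\<And>z. 0 < z \<Longrightarrow> z < y \<Longrightarrow> h z < d"
      by (auto simp: eventually_at_right_field)
    show ?thesis by (rule that[of "min 1 (y/2)"]) (use y(1) in \<open>auto intro!: less_imp_le y(2)\<close>)
  qed
  from open_countable_balls[OF open_\<Omega> ne] obtain a :: "nat \<Rightarrow> real^'n" and r :: "nat \<Rightarrow> real"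
    where ar: "\<forall>i. 0 < r i \<and> cball (a i) (r i) \<subseteq> \<Omega>" and cover: "\<Omega> \<subseteq> (\<Union>i. ball (a i) (r i))"
    by (elim exE conjE) (rule that)
  from ar have r: "r i > 0" and cb: "cball (a i) (r i) \<subseteq> \<Omega>" for i by blast+
  have "\<forall>i. \<exists>s. 0 < s \<and> s \<le> e \<and> (\<forall>x. s * (- laplacian (bump (a i) (r i)) x + K * bump (a i) (r i) x) \<le> h (s * bump (a i) (r i) x))"
  proof
    fix i
    obtain A where A: "\<And>x. - laplacian (bump (a i) (r i)) x \<le> A * bump (a i) (r i) x"
      using laplacian_bump_ge[OF r[of i], of "a i"] by metis
    \<comment> \<open>The slope of \<open>h\<close> near 0 exceeds \<open>A + K\<close>, where
      \<open>A\<close> bounds the negative Laplacian of the bump relative to the bump.\<close>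
    obtain s0 where s0: "s0 > 0" "\<And>s. 0 \<le> s \<Longrightarrow> s \<le> s0 \<Longrightarrow> (A + K) * s \<le> h s" using slope[of "A + K"] by blast
    define s where "s = min s0 e"
    have s: "0 < s" "s \<le> e" "s \<le> s0" using s0 e by (auto simp: s_def)
    have "s * (- laplacian (bump (a i) (r i)) x + K * bump (a i) (r i) x) \<le> h (s * bump (a i) (r i) x)" for x
    proof -
      let ?b = "bump (a i) (r i) x"
      have b01: "0 \<le> ?b" "?b \<le> 1" using bump_bounds[of "a i" "r i" x] by auto
      have "s * (- laplacian (bump (a i) (r i)) x + K * ?b) \<le> s * (A * ?b + K * ?b)"
        using A[of x] s by (intro mult_left_mono add_right_mono) auto
      also have "\<dots> = (A + K) * (s * ?b)" by (simp add: algebra_simps)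
      also have "\<dots> \<le> h (s * ?b)"
      proof (rule s0(2))
        show "0 \<le> s * ?b" using b01 s by simp
        have "s * ?b \<le> s * 1" using b01 s by (intro mult_left_mono) auto
        then show "s * ?b \<le> s0" using s(3) by linarith
      qed
      finally show ?thesis .
    qed
    with s show "\<exists>s. 0 < s \<and> s \<le> e \<and> (\<forall>x. s * (- laplacian (bump (a i) (r i)) x + K * bump (a i) (r i) x) \<le> h (s * bump (a i) (r i) x))"
      by blast
  qed
  from choice[OF this] obtain s where ss: "\<forall>i. 0 < s i \<and> s i \<le> e \<and>
      (\<forall>x. s i * (- laplacian (bump (a i) (r i)) x + K * bump (a i) (r i) x) \<le> h (s i * bump (a i) (r i) x))" ..
  then have s: "0 < s i" "s i \<le> e"
    and sub: "s i * (- laplacian (bump (a i) (r i)) x + K * bump (a i) (r i) x) \<le> h (s i * bump (a i) (r i) x)" for i x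
    by blast+
  define w where "w i x = s i * bump (a i) (r i) x" for i x
  have w: "0 \<le> w i x" "w i x \<le> e" for i x
  proof -
    show "0 \<le> w i x" unfolding w_def using s(1)[of i] bump_bounds(1)[of "a i" "r i" x] by simp
    have "w i x \<le> s i * 1"
      unfolding w_def using s(1)[of i] bump_bounds(2)[of "a i" "r i" x] by (intro mult_left_mono) auto
    then show "w i x \<le> e" using s(2)[of i] by simp
  qed
  have adm_w: "admissible (w i)" and w_sub: "AE x in M. w i x \<le> fst (T (w i) x)" for i
    using subsolution_le_T[OF test_bump[OF r cb] sub] by (simp_all add: w_def[abs_def])
  define u0 where "u0 x = (SUP i. w i x)" for x
  have bdd: "bdd_above (range (\<lambda>i. w i x))" for x by (rule bdd_aboveI2[of _ _ e]) (rule w)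
  have w_le: "w i x \<le> u0 x" for i x unfolding u0_def by (rule cSUP_upper[OF _ bdd]) simp
  have u0: "0 \<le> u0 x" "u0 x \<le> e" for x
    using order_trans[OF w(1) w_le] unfolding u0_def by (blast, intro cSUP_least w(2)) simp
  have u0_pos: "0 < u0 x" if x: "x \<in> \<Omega>" for x
  proof -
    obtain i where "x \<in> ball (a i) (r i)" using subsetD[OF cover x] by blast
    then have "0 < bump (a i) (r i) x" by (simp only: bump_pos_iff[OF r])
    then have "0 < w i x" unfolding w_def using s(1)[of i] by (intro mult_pos_pos)
    then show ?thesis using w_le[of i x] by linarith
  qed
  have u0_meas: "u0 \<in> borel_measurable M"
    unfolding u0_def[abs_def] using adm_w bdd
    by (intro borel_measurable_cSUP) (auto simp: admissible_def)
  have adm_u0: "admissible u0"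
    unfolding admissible_def
  proof
    show "integrable M (\<lambda>x. u0 x ^ (2 * q))"
    proof (rule integrable_const_bound[of _ 1])
      show "AE x in M. norm (u0 x ^ (2 * q)) \<le> 1"
      proof (rule AE_I2)
        fix x
        have "u0 x \<le> 1" using u0(2)[of x] e(2) by linarith
        then show "norm (u0 x ^ (2 * q)) \<le> 1" using u0(1)[of x] by (simp add: power_le_one)
      qed
    qed (use u0_meas in measurable)
  qed fact
  \<comment> \<open>The supremum inherits the subsolution property from monotonicity of
    \<open>T\<close>: each \<open>w i\<close> lies below \<open>T (w i)\<close>, hence below
    \<open>T u0\<close>.\<close>
  have "AE x in M. w i x \<le> fst (T u0 x)" for i
  proof -
    have "AE x in M. fst (T (w i) x) \<le> fst (T u0 x)"
      by (rule T_mono[OF adm_w adm_u0]) (simp add: w_le)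
    with w_sub[of i] show ?thesis by eventually_elim linarith
  qed
  then have "AE x in M. \<forall>i. w i x \<le> fst (T u0 x)" by (simp add: AE_all_countable)
  then have sub0: "AE x in M. u0 x \<le> fst (T u0 x)"
    by eventually_elim (auto simp: u0_def intro!: cSUP_least)
  have "h (u0 x) \<le> d" for x using monoD[OF h_mono u0(2)[of x]] e(3) by linarith
  from small_start[OF adm_u0 this] d have E: "energy_form \<Omega> K (T u0) (T u0) \<le> 2 * d * vol" by simp
  note TW = T(1)[OF adm_u0]
  have 0: "0 \<le> (LINT x|M. (fst (T u0 x))\<^sup>2)" "0 \<le> (LINT x|M. H (fst (T u0 x)))" "0 \<le> energy_form \<Omega> K (T u0) (T u0)"
    using K H_nonneg by (auto intro!: Bochner_Integration.integral_nonneg energy_form_nonneg)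
  have g0: "(LINT x|M. (norm (snd (T u0 x)))\<^sup>2) < rho"
    using E dv(1) 0(1) energy_form_bounds(1)[OF W0_sqint[OF TW] K] unfolding integral_norm_jet[OF W0_sqint[OF TW]]
    by linarith
  have e0: "energy (T u0) < b" unfolding energy_def using E dv(2) 0 by linarith
  from solution_in_well[OF adm_u0 u0(1) sub0 e0 g0] obtain U where U: "U \<in> W0 \<Omega>" "AE x in M. u0 x \<le> fst (U x)"
    "\<forall>V\<in>W0 \<Omega>. energy_form \<Omega> K U V = (LINT x|M. h (fst (U x)) * fst (V x))"
    by (elim bexE conjE) (rule that)
  have "AE x in M. 0 < fst (U x)"
    using U(2) AE_space
  proof eventually_elim
    case (elim x)
    then have "0 < u0 x" by (intro u0_pos) simp
    with elim(1) show ?case by linarith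
  qed
  with U show ?thesis by blast
qed

end

section \<open>The nonlinearity\<close>

text \<open>For positive \<open>s\<close> and \<open>c = lam + K\<close> this is the nonlinearity
  plus \<open>K * s\<close>, with s ln(s^2) written as 2 s ln s. The cut-off at nonpositive
  arguments makes it nonnegative and monotone on the whole line once \<open>c\<close> is
  large.\<close>

definition shifted_nl :: "nat \<Rightarrow> real \<Rightarrow> real \<Rightarrow> real \<Rightarrow> real" where
  "shifted_nl q c \<mu> s = (if s \<le> 0 then 0 else s ^ (2 * q - 1) + c * s + 2 * \<mu> * (s * ln s))"

text \<open>The last quadratic term is the correction from integrating 2 \<mu> s ln s, whose
  primitive is \<mu> s^2 ln s - \<mu> s^2 / 2.\<close>

definition shifted_primitive :: "nat \<Rightarrow> real \<Rightarrow> real \<Rightarrow> real \<Rightarrow> real" where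
  "shifted_primitive q c \<mu> s =
     (if s \<le> 0 then 0 else s ^ (2 * q) / (2 * real q) + c / 2 * s\<^sup>2 + \<mu> * (s\<^sup>2 * ln s) - \<mu> / 2 * s\<^sup>2)"

lemma x_ln_x_tendsto_0: "((\<lambda>s::real. s * ln s) \<longlongrightarrow> 0) (at_right 0)"
  by real_asymp

lemma shifted_nl_tendsto_0:
  assumes q: "q \<ge> 1" shows "(shifted_nl q c \<mu> \<longlongrightarrow> 0) (at 0)"
  unfolding filterlim_at_split
proof
  show "(shifted_nl q c \<mu> \<longlongrightarrow> 0) (at_left 0)"
    by (rule Lim_transform_eventually[of "\<lambda>_. 0"]) (auto simp: shifted_nl_def eventually_at_filter)
  have "((\<lambda>s. s ^ (2 * q - 1) + c * s + 2 * \<mu> * (s * ln s)) \<longlongrightarrow> 0 ^ (2 * q - 1) + c * 0 + 2 * \<mu> * 0) (at_right 0)"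
    by (intro tendsto_intros x_ln_x_tendsto_0)
  moreover have z: "(0::real) ^ (2 * q - 1) = 0" using q by (simp add: zero_power)
  ultimately have "((\<lambda>s. s ^ (2 * q - 1) + c * s + 2 * \<mu> * (s * ln s)) \<longlongrightarrow> 0) (at_right 0)"
    by (simp only: z mult_zero_right add_0_left)
  then show "(shifted_nl q c \<mu> \<longlongrightarrow> 0) (at_right 0)"
    by (rule Lim_transform_eventually) (auto simp: shifted_nl_def eventually_at_filter)
qed

lemma shifted_nl_pos_derivative:
  assumes q: "q \<ge> 1" and s: "s > 0"
  shows "(shifted_nl q c \<mu> has_real_derivative
    real (2 * q - 1) * s ^ (2 * q - 2) + c + 2 * \<mu> * (ln s + 1)) (at s)"
proof -
  have "((\<lambda>s. s ^ (2 * q - 1) + c * s + 2 * \<mu> * (s * ln s)) has_real_derivative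
    real (2 * q - 1) * s ^ (2 * q - 2) + c + 2 * \<mu> * (ln s + 1)) (at s)"
    using s q by (auto intro!: derivative_eq_intros simp: diff_diff_left simp flip: numeral_2_eq_2)
  then show ?thesis
    by (rule has_field_derivative_transform_within_open[of _ _ _ "{0<..}"])
      (use s in \<open>auto simp: shifted_nl_def\<close>)
qed

lemma shifted_nl_continuous:
  assumes q: "q \<ge> 1" shows "continuous_on UNIV (shifted_nl q c \<mu>)"
proof (rule continuous_at_imp_continuous_on, rule ballI)
  fix s :: real
  consider "s > 0" | "s = 0" | "s < 0" by linarith
  then show "isCont (shifted_nl q c \<mu>) s"
  proof cases
    case 1
    then show ?thesis using shifted_nl_pos_derivative[OF q] DERIV_isCont by blast
  next
    case 2
    then show ?thesis using shifted_nl_tendsto_0[OF q] by (simp add: isCont_def shifted_nl_def)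
  next
    case 3
    have "((\<lambda>s. 0) has_real_derivative 0) (at s)" by simp
    then have "(shifted_nl q c \<mu> has_real_derivative 0) (at s)"
      by (rule has_field_derivative_transform_within_open[of _ _ _ "{..<0}"])
        (use 3 in \<open>auto simp: shifted_nl_def\<close>)
    then show ?thesis by (rule DERIV_isCont)
  qed
qed

lemma power_ge_square_minus_one:
  fixes s :: real
  assumes "s \<ge> 0" "k \<ge> 2" shows "s\<^sup>2 - 1 \<le> s ^ k"
proof (cases "s \<ge> 1")
  case True
  then have "s\<^sup>2 \<le> s ^ k" using assms by (intro power_increasing) auto
  then show ?thesis by simp
next
  case False
  then have "s\<^sup>2 \<le> 1" using assms by (simp add: power_le_one)
  moreover have "0 \<le> s ^ k" using assms by simp
  ultimately show ?thesis by linarith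
qed

context
  fixes q :: nat and c \<mu> :: real
  assumes q: "q \<ge> 2" and \<mu>: "\<mu> < 0" and c: "c \<ge> \<mu>\<^sup>2 + 1 - 2 * \<mu>"
begin

text \<open>Origin of the lower bound on \<open>c\<close>: since \<mu> is negative and ln s < s, the
  logarithm contributes at least 2 \<mu> s; with s^(2q-2) \<ge> s^2 - 1 the expression is at least
  (s + \<mu>)^2 - \<mu>^2 - 1 + c + 2 \<mu>. The power carries coefficient 1 so that the estimate
  serves both the sign of the function and that of its derivative.\<close>

lemma shifted_slope_nonneg:
  assumes s: "s > 0"
  shows "0 \<le> s ^ (2 * q - 2) + c + 2 * \<mu> * (ln s + 1)"
proof -
  have "2 * \<mu> * s \<le> 2 * \<mu> * ln s" using \<mu> ln_less_self[OF s] by (simp add: mult_le_cancel_left)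
  moreover have "s\<^sup>2 - 1 \<le> s ^ (2 * q - 2)" using q s by (intro power_ge_square_minus_one) auto
  moreover have "0 \<le> (s + \<mu>)\<^sup>2" by simp
  then have "0 \<le> s\<^sup>2 + 2 * \<mu> * s + \<mu>\<^sup>2" by (simp add: power2_sum algebra_simps)
  ultimately show ?thesis using c by (simp add: distrib_left)
qed

lemma shifted_nl_nonneg: "0 \<le> shifted_nl q c \<mu> s"
proof (cases "s > 0")
  case True
  have "2 * q - 1 = Suc (2 * q - 2)" using q by simp
  then have "s ^ (2 * q - 1) = s ^ (2 * q - 2) * s" by (simp only: power_Suc2)
  then have "shifted_nl q c \<mu> s = (s ^ (2 * q - 2) + c + 2 * \<mu> * ln s) * s"
    using True by (simp add: shifted_nl_def algebra_simps)
  moreover have "0 \<le> s ^ (2 * q - 2) + c + 2 * \<mu> * ln s"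
    using shifted_slope_nonneg[OF True] \<mu> by (simp add: distrib_left)
  ultimately show ?thesis using True by simp
qed (simp add: shifted_nl_def)

lemma shifted_nl_mono: "mono (shifted_nl q c \<mu>)"
proof (rule monoI)
  fix s t :: real assume st: "s \<le> t"
  show "shifted_nl q c \<mu> s \<le> shifted_nl q c \<mu> t"
  proof (cases "s > 0")
    case False
    then have "shifted_nl q c \<mu> s = 0" by (simp add: shifted_nl_def)
    then show ?thesis using shifted_nl_nonneg[of t] by simp
  next
    case True
    show ?thesis
    proof (rule DERIV_nonneg_imp_nondecreasing[OF st])
      fix x assume "s \<le> x" "x \<le> t"
      then have x: "x > 0" using True by simp
      have "1 * x ^ (2 * q - 2) \<le> real (2 * q - 1) * x ^ (2 * q - 2)"
        using q x by (intro mult_right_mono) auto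
      then have "0 \<le> real (2 * q - 1) * x ^ (2 * q - 2) + c + 2 * \<mu> * (ln x + 1)"
        using shifted_slope_nonneg[OF x] by linarith
      then show "\<exists>y. (shifted_nl q c \<mu> has_real_derivative y) (at x) \<and> 0 \<le> y"
        using shifted_nl_pos_derivative[of q x c \<mu>] q x by auto
    qed
  qed
qed

lemma shifted_nl_growth: "shifted_nl q c \<mu> s \<le> (1 + c - 2 * \<mu>) * (1 + \<bar>s\<bar> ^ (2 * q - 1))"
proof -
  have c0: "c \<ge> 0" using c \<mu> zero_le_power2[of \<mu>] by linarith
  show ?thesis
  proof (cases "s > 0")
    case False
    then show ?thesis using c0 \<mu> by (simp add: shifted_nl_def)
  next
    case True
    define P where "P = s ^ (2 * q - 1)"
    have P: "P \<ge> 0" using True by (simp add: P_def)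
    have sP: "s \<le> 1 + P"
    proof (cases "s \<le> 1")
      case False
      then have "s ^ 1 \<le> P" unfolding P_def using q by (intro power_increasing) auto
      then show ?thesis by simp
    qed (use P in simp)
    have "- (s * ln s) \<le> 1"
    proof -
      have "ln (1 / s) \<le> 1 / s - 1" using True by (intro ln_le_minus_one) simp
      then have "s * ln (1 / s) \<le> s * (1 / s - 1)" using True by (intro mult_left_mono) auto
      then show ?thesis using True by (simp add: ln_div right_diff_distrib)
    qed
    then have "2 * \<mu> * (s * ln s) \<le> - 2 * \<mu>"
      using mult_left_mono[of "- (s * ln s)" 1 "- 2 * \<mu>"] \<mu> by simp
    moreover have "c * s \<le> c * (1 + P)" using c0 sP by (intro mult_left_mono)
    moreover have "0 \<le> - 2 * \<mu> * P" using \<mu> P by (simp add: mult_nonpos_nonneg)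
    ultimately have "P + c * s + 2 * \<mu> * (s * ln s) \<le> (1 + c - 2 * \<mu>) * (1 + P)"
      by (simp add: algebra_simps)
    then show ?thesis using True by (simp add: shifted_nl_def P_def)
  qed
qed

text \<open>The quotient by \<open>s\<close> contains c + 2 \<mu> ln s, which tends to infinity at 0
  because \<mu> is negative. The witness is the point where this expression equals
  \<open>A\<close>.\<close>

lemma shifted_nl_slope: "\<exists>d>0. \<forall>s. 0 \<le> s \<and> s \<le> d \<longrightarrow> A * s \<le> shifted_nl q c \<mu> s"
proof (intro exI[of _ "exp ((A - c) / (2 * \<mu>))"] conjI allI impI)
  fix s assume s: "0 \<le> s \<and> s \<le> exp ((A - c) / (2 * \<mu>))"
  show "A * s \<le> shifted_nl q c \<mu> s"
  proof (cases "s = 0")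
    case False
    then have sp: "s > 0" using s by simp
    have "ln s \<le> (A - c) / (2 * \<mu>)"
      using s sp ln_le_cancel_iff[of s "exp ((A - c) / (2 * \<mu>))"] by simp
    then have "A - c \<le> 2 * \<mu> * ln s" using \<mu> by (simp add: field_simps)
    then have "A * s \<le> (c + 2 * \<mu> * ln s) * s" using sp by (intro mult_right_mono) auto
    moreover have "0 \<le> s ^ (2 * q - 1)" using sp by simp
    moreover have "shifted_nl q c \<mu> s = (c + 2 * \<mu> * ln s) * s + s ^ (2 * q - 1)"
      using sp by (simp add: shifted_nl_def algebra_simps)
    ultimately show ?thesis by linarith
  qed (simp add: shifted_nl_def)
qed simp

lemma shifted_primitive_derivative:
  "(shifted_primitive q c \<mu> has_real_derivative shifted_nl q c \<mu> s) (at s)"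
proof -
  let ?f = "\<lambda>s. s ^ (2 * q) / (2 * real q) + c / 2 * s\<^sup>2 + \<mu> * (s\<^sup>2 * ln s) - \<mu> / 2 * s\<^sup>2"
  consider "s > 0" | "s = 0" | "s < 0" by linarith
  then show ?thesis
  proof cases
    case 1
    have d1: "((\<lambda>s. s ^ (2 * q) / (2 * real q)) has_real_derivative s ^ (2 * q - 1)) (at s)"
      using q by (auto intro!: derivative_eq_intros)
    have d2: "((\<lambda>s. s\<^sup>2 * ln s) has_real_derivative 2 * (s * ln s) + s) (at s)"
      using 1 by (auto intro!: derivative_eq_intros simp: power2_eq_square)
    have d3: "((\<lambda>s. k * s\<^sup>2) has_real_derivative k * (2 * s)) (at s)" for k :: real
      by (auto intro!: derivative_eq_intros)
    have "(?f has_real_derivative s ^ (2 * q - 1) + c / 2 * (2 * s) + \<mu> * (2 * (s * ln s) + s) - \<mu> / 2 * (2 * s)) (at s)"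
      by (intro DERIV_add DERIV_diff DERIV_cmult d1 d2 d3)
    moreover have "s ^ (2 * q - 1) + c / 2 * (2 * s) + \<mu> * (2 * (s * ln s) + s) - \<mu> / 2 * (2 * s) = shifted_nl q c \<mu> s"
      using 1 by (simp add: shifted_nl_def algebra_simps)
    ultimately have "(?f has_real_derivative shifted_nl q c \<mu> s) (at s)" by simp
    then show ?thesis
      by (rule has_field_derivative_transform_within_open[of _ _ _ "{0<..}"])
        (use 1 in \<open>auto simp: shifted_primitive_def\<close>)
  next
    case 3
    have "((\<lambda>s. 0) has_real_derivative shifted_nl q c \<mu> s) (at s)" using 3 by (simp add: shifted_nl_def)
    then show ?thesis
      by (rule has_field_derivative_transform_within_open[of _ _ _ "{..<0}"])
        (use 3 in \<open>auto simp: shifted_primitive_def\<close>)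
  next
    case 2
    \<comment> \<open>At the origin each term of the quotient retains a positive power of the
      argument or the factor s ln s, so it tends to 0.\<close>
    have "((\<lambda>h. shifted_primitive q c \<mu> h / h) \<longlongrightarrow> 0) (at 0)"
      unfolding filterlim_at_split
    proof
      show "((\<lambda>h. shifted_primitive q c \<mu> h / h) \<longlongrightarrow> 0) (at_left 0)"
        by (rule Lim_transform_eventually[of "\<lambda>_. 0"]) (auto simp: shifted_primitive_def eventually_at_filter)
      have "((\<lambda>s. s ^ (2 * q - 1) / (2 * real q) + c / 2 * s + \<mu> * (s * ln s) - \<mu> / 2 * s)
          \<longlongrightarrow> 0 ^ (2 * q - 1) / (2 * real q) + c / 2 * 0 + \<mu> * 0 - \<mu> / 2 * 0) (at_right 0)"
        using q by (intro tendsto_intros x_ln_x_tendsto_0) auto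
      moreover have z: "(0::real) ^ (2 * q - 1) = 0" using q by (simp add: zero_power)
      ultimately have L: "((\<lambda>s. s ^ (2 * q - 1) / (2 * real q) + c / 2 * s + \<mu> * (s * ln s) - \<mu> / 2 * s) \<longlongrightarrow> 0) (at_right 0)"
        by (simp only: z mult_zero_right add_0_left div_0 diff_0_right)
      have "s ^ (2 * q - 1) / (2 * real q) + c / 2 * s + \<mu> * (s * ln s) - \<mu> / 2 * s = shifted_primitive q c \<mu> s / s"
        if "s > 0" for s
      proof -
        have "2 * q = Suc (2 * q - 1)" using q by simp
        then have "s ^ (2 * q) = s ^ (2 * q - 1) * s" by (metis power_Suc2)
        then have "shifted_primitive q c \<mu> s = (s ^ (2 * q - 1) / (2 * real q) + c / 2 * s + \<mu> * (s * ln s) - \<mu> / 2 * s) * s"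
          using that by (simp add: shifted_primitive_def algebra_simps power2_eq_square)
        then show ?thesis using that by simp
      qed
      then show "((\<lambda>h. shifted_primitive q c \<mu> h / h) \<longlongrightarrow> 0) (at_right 0)"
        by (intro Lim_transform_eventually[OF L]) (auto simp: eventually_at_filter)
    qed
    then show ?thesis using 2 by (simp add: DERIV_def shifted_primitive_def shifted_nl_def)
  qed
qed

lemma shifted_primitive_convex:
  "shifted_primitive q c \<mu> s + shifted_nl q c \<mu> s * (t - s) \<le> shifted_primitive q c \<mu> t"
proof -
  consider "s < t" | "s = t" | "t < s" by linarith
  then show ?thesis
  proof cases
    case 1
    obtain z where z: "s < z" "z < t"
      and eq: "shifted_primitive q c \<mu> t - shifted_primitive q c \<mu> s = (t - s) * shifted_nl q c \<mu> z"
      using MVT2[OF 1, of "shifted_primitive q c \<mu>" "shifted_nl q c \<mu>"] shifted_primitive_derivative by blast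
    have "shifted_nl q c \<mu> s \<le> shifted_nl q c \<mu> z" using z by (intro monoD[OF shifted_nl_mono]) simp
    then have "(t - s) * shifted_nl q c \<mu> s \<le> (t - s) * shifted_nl q c \<mu> z" using 1 by (intro mult_left_mono) auto
    then show ?thesis using eq by (simp add: mult.commute)
  next
    case 3
    obtain z where z: "t < z" "z < s"
      and eq: "shifted_primitive q c \<mu> s - shifted_primitive q c \<mu> t = (s - t) * shifted_nl q c \<mu> z"
      using MVT2[OF 3, of "shifted_primitive q c \<mu>" "shifted_nl q c \<mu>"] shifted_primitive_derivative by blast
    have "shifted_nl q c \<mu> z \<le> shifted_nl q c \<mu> s" using z by (intro monoD[OF shifted_nl_mono]) simp
    then have "(s - t) * shifted_nl q c \<mu> z \<le> (s - t) * shifted_nl q c \<mu> s" using 3 by (intro mult_left_mono) auto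
    then show ?thesis using eq by (simp add: algebra_simps)
  qed simp
qed

lemma shifted_primitive_nonneg: "0 \<le> shifted_primitive q c \<mu> t"
  using shifted_primitive_convex[of 0 t] by (simp add: shifted_primitive_def shifted_nl_def)

lemma shifted_primitive_measurable: "shifted_primitive q c \<mu> \<in> borel_measurable borel"
  by (intro borel_measurable_continuous_onI continuous_at_imp_continuous_on ballI
      DERIV_isCont[OF shifted_primitive_derivative])

end

text \<open>With \<open>y = s\<^sup>2 exp (a / \<mu>)\<close> the logarithmic part becomes \<open>- \<mu> / 2 * exp (- a / \<mu>) * y * (ln y - 1)\<close>,
  and \<open>y * (ln y - 1) \<ge> - 1\<close>.\<close>

lemma log_term_ge:
  fixes s a \<mu> :: real
  assumes s: "s > 0" and \<mu>: "\<mu> < 0"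
  shows "\<mu> / 2 * exp (- a / \<mu>) \<le> - a / 2 * s\<^sup>2 - \<mu> * (s\<^sup>2 * ln s) + \<mu> / 2 * s\<^sup>2"
proof -
  define y where "y = s\<^sup>2 * exp (a / \<mu>)"
  have y: "y > 0" using s by (simp add: y_def)
  have lny: "ln y = 2 * ln s + a / \<mu>" using s by (simp add: y_def ln_mult ln_realpow)
  have sy: "s\<^sup>2 = y * exp (- a / \<mu>)" by (simp add: y_def exp_minus)
  have "ln (1 / y) \<le> 1 / y - 1" using y by (intro ln_le_minus_one) simp
  then have "y * ln (1 / y) \<le> y * (1 / y - 1)" using y by (intro mult_left_mono) auto
  then have "- 1 \<le> y * (ln y - 1)" using y by (simp add: ln_div right_diff_distrib)
  then have "- \<mu> / 2 * exp (- a / \<mu>) * (- 1) \<le> - \<mu> / 2 * exp (- a / \<mu>) * (y * (ln y - 1))"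
    using \<mu> by (intro mult_left_mono) (auto simp: mult_nonpos_nonneg)
  also have "\<dots> = - \<mu> / 2 * s\<^sup>2 * (ln y - 1)" unfolding sy by simp
  also have "\<dots> = - a / 2 * s\<^sup>2 - \<mu> * (s\<^sup>2 * ln s) + \<mu> / 2 * s\<^sup>2"
    unfolding lny using \<mu> by (simp add: field_simps)
  finally show ?thesis by simp
qed

text \<open>For positive \<open>s\<close> the shift \<open>K\<close> cancels and \<open>lam\<close>
  is split: the part \<sigma> remains as a quadratic term to be paid by the gradient, while
  \<open>lam - \<sigma>\<close> is treated together with the logarithm by
  \<open>log_term_ge\<close>. For the other \<open>s\<close> the left side is nonpositive and the
  right side nonnegative.\<close>

lemma shifted_primitive_le:
  assumes \<mu>: "\<mu> < 0" and K: "K \<ge> 0" and \<sigma>: "\<sigma> \<ge> 0"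
  shows "- (s ^ (2 * q) / (2 * real q)) - \<sigma> / 2 * s\<^sup>2 + \<mu> / 2 * exp (- (lam - \<sigma>) / \<mu>)
    \<le> K / 2 * s\<^sup>2 - shifted_primitive q (lam + K) \<mu> s"
proof (cases "s > 0")
  case True
  then show ?thesis
    using log_term_ge[OF True \<mu>, of "lam - \<sigma>"] by (simp add: shifted_primitive_def algebra_simps add_divide_distrib diff_divide_distrib)
next
  case False
  have "0 \<le> s ^ (2 * q) / (2 * real q)" by (simp add: power_mult)
  moreover have "0 \<le> \<sigma> / 2 * s\<^sup>2" "0 \<le> K / 2 * s\<^sup>2" using K \<sigma> by simp_all
  moreover have "\<mu> / 2 * exp (- (lam - \<sigma>) / \<mu>) \<le> 0" using \<mu> by (simp add: mult_nonpos_nonneg)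
  moreover have "shifted_primitive q (lam + K) \<mu> s = 0" using False by (simp add: shifted_primitive_def)
  ultimately show ?thesis by linarith
qed

section \<open>Existence of a positive solution\<close>

text \<open>On positive values the cut-off in \<open>shifted_nl\<close> is inactive and the terms
  with \<open>K\<close> on both sides cancel, which returns the original equation.\<close>

lemma positive_representative:
  fixes \<Omega> :: "(real^'n) set"
  assumes \<Omega>: "open \<Omega>" and U: "U \<in> W0 \<Omega>" and pos: "AE x in lebesgue_on \<Omega>. 0 < fst (U x)"
    and q: "q \<ge> 1" "two_star CARD('n) = 2 * real q"
    and int: "\<And>V. V \<in> W0 \<Omega> \<Longrightarrow> integrable (lebesgue_on \<Omega>) (\<lambda>x. shifted_nl q (lam + K) \<mu> (fst (U x)) * fst (V x))"
    and eq: "\<And>V. V \<in> W0 \<Omega> \<Longrightarrow>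
      energy_form \<Omega> K U V = (LINT x|lebesgue_on \<Omega>. shifted_nl q (lam + K) \<mu> (fst (U x)) * fst (V x))"
  shows "\<exists>u. positive_solution \<Omega> lam \<mu> u"
proof -
  let ?M = "lebesgue_on \<Omega>"
  have \<Omega>s: "\<Omega> \<in> sets lebesgue" using \<Omega> by (simp add: lebesgue_openin)
  \<comment> \<open>The value 1 on the exceptional null set is an arbitrary positive number.\<close>
  define u where "u x = (if 0 < fst (U x) then fst (U x) else 1)" for x
  have u_pos: "u x > 0" for x by (simp add: u_def)
  have ae: "AE x in ?M. fst (U x) = u x" using pos by eventually_elim (simp add: u_def)
  note [measurable] = sqint_measurable[OF sqint_fst[OF W0_sqint[OF U]]] sqint_measurable[OF sqint_snd[OF W0_sqint[OF U]]]
  have um [measurable]: "u \<in> borel_measurable ?M" unfolding u_def[abs_def] by measurable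
  define U' where "U' x = (u x, snd (U x))" for x
  have U': "U' \<in> W0 \<Omega>"
  proof (rule W0_cong_AE[OF \<Omega>s U])
    show "U' \<in> borel_measurable ?M" unfolding U'_def[abs_def] by (rule borel_measurable_Pair) measurable
    show "AE x in ?M. U x = U' x" using ae by eventually_elim (simp add: U'_def prod_eq_iff)
  qed
  have u_H10: "u \<in> H10 \<Omega>" and gr: "AE x in ?M. wgrad \<Omega> u x = snd (U x)"
    using W0_imp_H10[OF \<Omega> U'] by (simp_all add: U'_def)
  have gm: "wgrad \<Omega> u \<in> borel_measurable ?M"
    using sqint_measurable[OF wgrad_AE(1)[OF \<Omega> sqint_snd[OF W0_sqint[OF U']] W0_weak_gradient[OF \<Omega>s U']]]
    by (simp add: U'_def)
  have nl: "nonlinearity CARD('n) lam \<mu> (u x) = shifted_nl q (lam + K) \<mu> (u x) - K * u x" for x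
  proof -
    have "2 * real q - 2 + 1 = real (2 * q - 1)" using q(1) by (simp add: of_nat_diff)
    then have "u x powr (2 * real q - 2) * u x = u x ^ (2 * q - 1)"
      using u_pos[of x] by (metis powr_realpow powr_add powr_one less_imp_le)
    moreover have "ln ((u x)\<^sup>2) = 2 * ln (u x)" using u_pos[of x] by (simp add: ln_realpow)
    ultimately show ?thesis
      using u_pos[of x] unfolding nonlinearity_def q(2) shifted_nl_def by (simp add: algebra_simps)
  qed
  have "integrable ?M (\<lambda>x. nonlinearity CARD('n) lam \<mu> (u x) * v x) \<and>
      (LINT x|?M. wgrad \<Omega> u x \<bullet> wgrad \<Omega> v x) = (LINT x|?M. nonlinearity CARD('n) lam \<mu> (u x) * v x)"
    if v: "v \<in> H10 \<Omega>" for v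
  proof -
    define V where "V x = (v x, wgrad \<Omega> v x)" for x
    have V: "V \<in> W0 \<Omega>" unfolding V_def by (rule H10_imp_W0[OF \<Omega> v])
    have fV: "fst (V x) = v x" "snd (V x) = wgrad \<Omega> v x" for x by (simp_all add: V_def)
    note i1 = int[OF V, unfolded fV]
    note i2 = sqint_mult[OF sqint_fst[OF W0_sqint[OF U]] sqint_fst[OF W0_sqint[OF V]], unfolded fV]
    have vm [measurable]: "v \<in> borel_measurable ?M" using sqint_measurable[OF sqint_fst[OF W0_sqint[OF V]]] by (simp add: fV)
    have Vgm: "wgrad \<Omega> v \<in> borel_measurable ?M" using sqint_measurable[OF sqint_snd[OF W0_sqint[OF V]]] by (simp add: fV)
    let ?f = "\<lambda>x. shifted_nl q (lam + K) \<mu> (fst (U x)) * v x - K * (fst (U x) * v x)"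
    have fi: "integrable ?M ?f" using i1 i2 by simp
    have fae: "AE x in ?M. ?f x = nonlinearity CARD('n) lam \<mu> (u x) * v x"
      using ae by eventually_elim (simp add: nl left_diff_distrib)
    have nlm: "(\<lambda>x. nonlinearity CARD('n) lam \<mu> (u x) * v x) \<in> borel_measurable ?M"
    proof -
      have "(\<lambda>x. shifted_nl q (lam + K) \<mu> (u x)) \<in> borel_measurable ?M"
        by (rule borel_measurable_continuous_on[OF shifted_nl_continuous[OF q(1)] um])
      then show ?thesis unfolding nl by measurable
    qed
    have "(LINT x|?M. wgrad \<Omega> u x \<bullet> wgrad \<Omega> v x) = (LINT x|?M. snd (U x) \<bullet> snd (V x))"
    proof (rule Bochner_Integration.integral_cong_AE)
      show "AE x in ?M. wgrad \<Omega> u x \<bullet> wgrad \<Omega> v x = snd (U x) \<bullet> snd (V x)"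
        using gr by eventually_elim (simp add: fV)
      show "(\<lambda>x. wgrad \<Omega> u x \<bullet> wgrad \<Omega> v x) \<in> borel_measurable ?M"
        by (rule borel_measurable_inner[OF gm Vgm])
      show "(\<lambda>x. snd (U x) \<bullet> snd (V x)) \<in> borel_measurable ?M"
        using sqint_inner[OF sqint_snd[OF W0_sqint[OF U]] sqint_snd[OF W0_sqint[OF V]]] by (rule borel_measurable_integrable)
    qed
    also have "\<dots> = energy_form \<Omega> K U V - K * (LINT x|?M. fst (U x) * fst (V x))" by (simp add: energy_form_def)
    also have "\<dots> = (LINT x|?M. ?f x)"
      unfolding eq[OF V] fV using i1 i2 by simp
    also have "\<dots> = (LINT x|?M. nonlinearity CARD('n) lam \<mu> (u x) * v x)"
      by (rule Bochner_Integration.integral_cong_AE[OF borel_measurable_integrable[OF fi] nlm fae])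
    finally show ?thesis
      using integrable_cong_AE_imp[OF fi nlm] fae by (simp add: eq_commute)
  qed
  with u_H10 u_pos have "positive_solution \<Omega> lam \<mu> u"
    unfolding positive_solution_def weak_solution_def by blast
  then show ?thesis by (intro exI[of _ u])
qed

text \<open>Common form of both parameter regions: \<open>coercive\<close> leaves the fraction
  \<theta> of the gradient term after paying for \<sigma>, and \<open>well\<close> says that the
  barrier height is positive.\<close>

lemma positive_solution_exists:
  fixes \<Omega> :: "(real^'n) set"
  assumes N: "CARD('n) \<in> {3, 4}" and \<Omega>: "open \<Omega>" "bounded \<Omega>" "\<Omega> \<noteq> {}"
    and S: "sobolev_S TYPE('n) > 0" and \<mu>: "\<mu> < 0" and \<sigma>: "\<sigma> \<ge> 0" and \<theta>: "\<theta> > 0"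
    and coercive: "\<And>F. F \<in> W0 \<Omega> \<Longrightarrow>
      \<sigma> * (LINT x|lebesgue_on \<Omega>. (fst (F x))\<^sup>2) \<le> (1 - \<theta>) * (LINT x|lebesgue_on \<Omega>. (norm (snd (F x)))\<^sup>2)"
    and well: "1 / real CARD('n) * \<theta> powr (real CARD('n) / 2) * sobolev_S TYPE('n) powr (real CARD('n) / 2)
      + \<mu> / 2 * exp (- (lam - \<sigma>) / \<mu>) * measure lebesgue \<Omega> > 0"
  shows "\<exists>u. positive_solution \<Omega> lam \<mu> u"
proof -
  let ?M = "lebesgue_on \<Omega>"
  let ?S = "sobolev_S TYPE('n)"
  define n where "n = real CARD('n)"
  define q :: nat where "q = (if CARD('n) = 3 then 3 else 2)"
  \<comment> \<open>The solution of rho^(q-1) = \<theta> S^q, the maximum point of the lower bound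
    for the energy; 1/(q-1) equals (n-2)/2 and q/(q-1) equals n/2 in both dimensions.\<close>
  define rho where "rho = \<theta> powr ((n - 2) / 2) * ?S powr (n / 2)"
  define b where "b = 1 / n * \<theta> powr (n / 2) * ?S powr (n / 2) + \<mu> / 2 * exp (- (lam - \<sigma>) / \<mu>) * measure lebesgue \<Omega>"
  have \<Omega>s: "\<Omega> \<in> sets lebesgue" using \<Omega> by (simp add: lebesgue_openin)
  have q: "q \<ge> 2" "q \<ge> 1" "q > 0" by (simp_all add: q_def)
  have b: "b > 0" using well by (simp add: b_def n_def)
  have rho: "rho > 0" using \<theta> S by (simp add: rho_def)
  have ts: "two_star CARD('n) = 2 * real q" and nq: "1 / 2 - 1 / (2 * real q) = 1 / n"
    and rq: "rho ^ (q - 1) = \<theta> * ?S ^ q" and \<theta>rho: "\<theta> * rho = \<theta> powr (n / 2) * ?S powr (n / 2)"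
  proof -
    have "\<theta> * \<theta> powr ((n - 2) / 2) = \<theta> powr (1 + (n - 2) / 2)" using \<theta> by (simp add: powr_add)
    also have "1 + (n - 2) / 2 = n / 2" by (simp add: field_simps)
    finally show "\<theta> * rho = \<theta> powr (n / 2) * ?S powr (n / 2)" by (simp add: rho_def)
    consider (three) "CARD('n) = 3" | (four) "CARD('n) = 4" using N by blast
    then have "two_star CARD('n) = 2 * real q \<and> 1 / 2 - 1 / (2 * real q) = 1 / n \<and> rho ^ (q - 1) = \<theta> * ?S ^ q"
    proof cases
      case three
      have "(\<theta> powr (1/2))\<^sup>2 = \<theta>" using \<theta> by (simp add: powr_half_sqrt)
      moreover have "(?S powr (3/2))\<^sup>2 = ?S ^ 3" using S by (simp add: powr_power powr_realpow)
      ultimately show ?thesis using three by (simp add: q_def n_def two_star_def rho_def power_mult_distrib)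
    next
      case four
      have "?S powr 2 = ?S ^ 2" using S by (simp add: powr_realpow)
      then show ?thesis using four \<theta> by (simp add: q_def n_def two_star_def rho_def)
    qed
    then show "two_star CARD('n) = 2 * real q" "1 / 2 - 1 / (2 * real q) = 1 / n" "rho ^ (q - 1) = \<theta> * ?S ^ q" by blast+
  qed
  \<comment> \<open>The threshold for monotonicity of the shifted nonlinearity, enlarged by the
    modulus of \<open>lam\<close> so that both \<open>lam + K\<close> and \<open>K\<close> itself
    reach it.\<close>
  define K where "K = \<mu>\<^sup>2 + 1 - 2 * \<mu> + \<bar>lam\<bar>"
  have K: "K \<ge> 1" and K2: "lam + K \<ge> \<mu>\<^sup>2 + 1 - 2 * \<mu>" using \<mu> zero_le_power2[of \<mu>] unfolding K_def by linarith+
  define C where "C = 1 + (lam + K) - 2 * \<mu>"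
  have C: "C \<ge> 0" using K2 \<mu> zero_le_power2[of \<mu>] unfolding C_def by linarith
  let ?h = "shifted_nl q (lam + K) \<mu>" and ?H = "shifted_primitive q (lam + K) \<mu>"
  note sob = sobolev_W0[OF \<Omega>s _ q(3) ts S]
  let ?k = "\<mu> / 2 * exp (- (lam - \<sigma>) / \<mu>)"
  have lm: "\<Omega> \<in> lmeasurable" using \<Omega> by (intro lmeasurable_open)
  have vol: "measure ?M (space ?M) = measure lebesgue \<Omega>"
    by (simp add: measure_restrict_space \<Omega>s)
  interpret M: finite_measure ?M
  proof (rule finite_measureI)
    from fmeasurableD2[OF lm] show "emeasure ?M (space ?M) \<noteq> \<infinity>"
      by (simp add: emeasure_restrict_space \<Omega>s del: emeasure_completion)
  qed
  have ridge: "b \<le> energy_form \<Omega> K F F / 2 - (LINT x|?M. ?H (fst (F x)))"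
    if F: "F \<in> W0 \<Omega>" and D: "(LINT x|?M. (norm (snd (F x)))\<^sup>2) = rho" for F
  proof -
    have i2: "integrable ?M (\<lambda>x. (fst (F x))\<^sup>2)" using sqint_integrable[OF sqint_fst[OF W0_sqint[OF F]]] by simp
    note ip = sob(1)[OF F]
    have ptw: "- (fst (F x) ^ (2 * q) / (2 * real q)) - \<sigma> / 2 * (fst (F x))\<^sup>2 + ?k \<le> K / 2 * (fst (F x))\<^sup>2 - ?H (fst (F x))" for x
      by (rule shifted_primitive_le[OF \<mu> _ \<sigma>]) (use K in simp)
    have Hint: "integrable ?M (\<lambda>x. ?H (fst (F x)))"
    proof (rule Bochner_Integration.integrable_bound)
      show "integrable ?M (\<lambda>x. K / 2 * (fst (F x))\<^sup>2 + fst (F x) ^ (2 * q) / (2 * real q) + \<sigma> / 2 * (fst (F x))\<^sup>2 - ?k)"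
        by (intro Bochner_Integration.integrable_add Bochner_Integration.integrable_diff integrable_mult_right integrable_divide i2 ip M.integrable_const)
      show "(\<lambda>x. ?H (fst (F x))) \<in> borel_measurable ?M"
        by (rule measurable_compose[OF sqint_measurable[OF sqint_fst[OF W0_sqint[OF F]]] shifted_primitive_measurable[OF q(1) \<mu> K2]])
      show "AE x in ?M. norm (?H (fst (F x))) \<le> norm (K / 2 * (fst (F x))\<^sup>2 + fst (F x) ^ (2 * q) / (2 * real q) + \<sigma> / 2 * (fst (F x))\<^sup>2 - ?k)"
      proof (rule AE_I2)
        fix x
        have "0 \<le> ?H (fst (F x))" by (rule shifted_primitive_nonneg[OF q(1) \<mu> K2])
        with ptw[of x]
        show "norm (?H (fst (F x))) \<le> norm (K / 2 * (fst (F x))\<^sup>2 + fst (F x) ^ (2 * q) / (2 * real q) + \<sigma> / 2 * (fst (F x))\<^sup>2 - ?k)"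
          unfolding real_norm_def by linarith
      qed
    qed
    define P where "P = (LINT x|?M. fst (F x) ^ (2 * q))"
    define I where "I = (LINT x|?M. (fst (F x))\<^sup>2)"
    have "(LINT x|?M. - (fst (F x) ^ (2 * q) / (2 * real q)) - \<sigma> / 2 * (fst (F x))\<^sup>2 + ?k)
        \<le> (LINT x|?M. K / 2 * (fst (F x))\<^sup>2 - ?H (fst (F x)))"
      by (rule integral_mono[OF _ _ ptw])
        (intro Bochner_Integration.integrable_add Bochner_Integration.integrable_diff Bochner_Integration.integrable_minus
          integrable_mult_right integrable_divide i2 ip Hint M.integrable_const)+
    moreover have "(LINT x|?M. - (fst (F x) ^ (2 * q) / (2 * real q)) - \<sigma> / 2 * (fst (F x))\<^sup>2 + ?k)
        = - (P / (2 * real q)) - \<sigma> / 2 * I + ?k * measure lebesgue \<Omega>"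
    proof -
      have "(LINT x|?M. ?k) = ?k * measure lebesgue \<Omega>" unfolding lebesgue_integral_const vol by simp
      then show ?thesis unfolding P_def I_def using i2 ip by (simp del: lebesgue_integral_const)
    qed
    moreover have "(LINT x|?M. K / 2 * (fst (F x))\<^sup>2 - ?H (fst (F x))) = K / 2 * I - (LINT x|?M. ?H (fst (F x)))"
      unfolding I_def using i2 Hint by simp
    ultimately have low: "- (P / (2 * real q)) - \<sigma> / 2 * I + ?k * measure lebesgue \<Omega> \<le> K / 2 * I - (LINT x|?M. ?H (fst (F x)))"
      by linarith
    \<comment> \<open>At this radius the Sobolev bound equals \<theta> rho, so the gradient and
      power terms combine with the factor 1/2 - 1/(2q) = 1/n.\<close>
    have "(rho / ?S) ^ q = \<theta> * rho"
    proof -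
      have "rho ^ q = rho ^ (q - 1) * rho" using q by (simp add: power_eq_if)
      then show ?thesis using rq S by (simp add: power_divide)
    qed
    then have "P \<le> \<theta> * rho" using sob(2)[OF F] D by (simp add: P_def)
    \<comment> \<open>Products are named so that the final inequality is linear in the
      names.\<close>
    define X Y Z I\<sigma> IK where "X = \<theta> * rho" and "Y = \<theta> * rho * (1 / (2 * real q))"
      and "Z = ?k * measure lebesgue \<Omega>" and "I\<sigma> = \<sigma> * I" and "IK = K * I"
    have "P / (2 * real q) \<le> Y" using \<open>P \<le> \<theta> * rho\<close> q by (simp add: Y_def divide_right_mono)
    moreover have "I\<sigma> \<le> rho - X" using coercive[OF F] D by (simp add: I\<sigma>_def X_def I_def left_diff_distrib)
    moreover have "energy_form \<Omega> K F F = rho + IK" unfolding energy_form_self D I_def IK_def ..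
    moreover have "b = X / 2 - Y + Z"
    proof -
      have "X / 2 - Y = 1 / n * (\<theta> * rho)"
        unfolding X_def Y_def nq[symmetric] by (simp add: left_diff_distrib)
      then show ?thesis unfolding \<theta>rho b_def Z_def by (simp add: mult.assoc)
    qed
    moreover have "- (P / (2 * real q)) - I\<sigma> / 2 + Z \<le> IK / 2 - (LINT x|?M. ?H (fst (F x)))"
      using low by (simp add: Z_def I\<sigma>_def IK_def)
    ultimately show ?thesis by linarith
  qed
  interpret well: monotone_iteration \<Omega> q ?S K C rho b ?h ?H
  proof unfold_locales
    show "?h s \<le> C * (1 + \<bar>s\<bar> ^ (2 * q - 1))" for s
      unfolding C_def by (rule shifted_nl_growth[OF q(1) \<mu> K2])
    show "?H s + ?h s * (t - s) \<le> ?H t" for s t by (rule shifted_primitive_convex[OF q(1) \<mu> K2])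
    show "mono ?h" by (rule shifted_nl_mono[OF q(1) \<mu> K2])
    show "0 \<le> ?h s" for s by (rule shifted_nl_nonneg[OF q(1) \<mu> K2])
    show "continuous_on UNIV ?h" by (rule shifted_nl_continuous[OF q(2)])
    show "?H 0 = 0" by (simp add: shifted_primitive_def)
    show "0 \<le> ?H s" for s by (rule shifted_primitive_nonneg[OF q(1) \<mu> K2])
    show "?H \<in> borel_measurable borel" by (rule shifted_primitive_measurable[OF q(1) \<mu> K2])
  qed (use \<Omega> q S K C sob ridge in auto)
  have "?h 0 = 0" by (simp add: shifted_nl_def)
  from well.positive_solution_in_well[OF \<Omega>(3) b rho this shifted_nl_slope[OF q(1) \<mu> K2]]
  obtain U where U: "U \<in> W0 \<Omega>" "AE x in ?M. 0 < fst (U x)"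
    "\<forall>V\<in>W0 \<Omega>. energy_form \<Omega> K U V = (LINT x|?M. ?h (fst (U x)) * fst (V x))"
    by (elim bexE conjE) (rule that)
  show ?thesis
  proof (rule positive_representative[OF \<Omega>(1) U(1,2) q(2) ts])
    show "integrable ?M (\<lambda>x. ?h (fst (U x)) * fst (V x))" if "V \<in> W0 \<Omega>" for V
      by (rule well.h_times(1)[OF well.admissible_W0[OF U(1)] well.admissible_W0[OF that]])
  qed (use U(3) in blast)
qed

text \<open>The infimum of an empty set of reals has no useful value, so a bump function is
  exhibited as a member of the index set; the quotients themselves are nonnegative.\<close>

lemma sobolev_S_nonneg: "sobolev_S TYPE('n::finite) \<ge> 0"
  unfolding sobolev_S_def
proof (rule cINF_greatest)
  define \<phi> :: "real^'n \<Rightarrow> real" where "\<phi> = bump 0 1"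
  have t: "\<phi> \<in> test_functions UNIV" unfolding \<phi>_def by (rule test_bump) auto
  note sq = test_jet_sqint[OF t, of UNIV, simplified]
  have "\<phi> \<in> H1 UNIV"
    unfolding H1_def using sqint_fst[OF sq] sqint_snd[OF sq] smooth_weak_gradient[OF test_smooth[OF t], of UNIV]
    by (auto simp: L2_on_iff_sqint)
  moreover have "\<not> ae_zero UNIV \<phi>"
  proof
    assume "ae_zero UNIV \<phi>"
    then have "AE x in lebesgue. \<phi> x = 0" unfolding ae_zero_def lebesgue_on_UNIV_eq .
    then obtain N where N: "N \<in> null_sets lebesgue" "{x. \<phi> x \<noteq> 0} \<subseteq> N"
      by (auto simp: eventually_ae_filter)
    have "ball 0 1 = {x. \<phi> x \<noteq> 0}" by (simp only: \<phi>_def bump_nz_iff[OF zero_less_one] Collect_mem_eq)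
    with N(2) have "ball 0 1 \<subseteq> N" by (simp only:)
    moreover have "negligible N" using N(1) by (simp only: negligible_iff_null_sets)
    ultimately have "negligible (ball (0::real^'n) 1)" by (rule negligible_subset[rotated])
    then show False using open_not_negligible[of "ball (0::real^'n) 1"] by simp
  qed
  ultimately show "{u \<in> H1 (UNIV :: (real^'n) set). \<not> ae_zero UNIV u} \<noteq> {}" by blast
qed (auto intro!: divide_nonneg_nonneg Bochner_Integration.integral_nonneg)

theorem theorem1p3:
  fixes \<Omega> :: "(real^'n) set" and N :: nat and lam \<mu> :: real
  assumes "N = CARD('n)" and "N \<in> {3, 4}"
    and "bounded_smooth_domain \<Omega>"
    and "(N = 3 \<and> (lam, \<mu>) \<in> B0 \<Omega> \<union> C0 \<Omega>) \<or>
         (N = 4 \<and> (lam, \<mu>) \<in> B0 \<Omega> \<union> C0 \<Omega> \<and> 32 * exp (lam / \<mu>) / (rho_max \<Omega>)\<^sup>2 < 1)"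
  shows "\<exists>u. positive_solution \<Omega> lam \<mu> u"
proof -
  let ?S = "sobolev_S TYPE('n)" and ?n = "real CARD('n)"
  have N: "CARD('n) \<in> {3, 4}" using assms by simp
  have \<Omega>: "open \<Omega>" "bounded \<Omega>" "\<Omega> \<noteq> {}" using assms(3) by (auto simp: bounded_smooth_domain_def)
  have "(lam, \<mu>) \<in> B0 \<Omega> \<union> C0 \<Omega>" using assms(4) by blast
  then obtain \<sigma> \<theta> where \<mu>: "\<mu> < 0" and \<sigma>: "\<sigma> \<ge> 0" and \<theta>: "\<theta> > 0"
    and coercive: "\<forall>F\<in>W0 \<Omega>.
      \<sigma> * (LINT x|lebesgue_on \<Omega>. (fst (F x))\<^sup>2) \<le> (1 - \<theta>) * (LINT x|lebesgue_on \<Omega>. (norm (snd (F x)))\<^sup>2)"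
    and well: "1 / ?n * \<theta> powr (?n / 2) * ?S powr (?n / 2) + \<mu> / 2 * exp (- (lam - \<sigma>) / \<mu>) * measure lebesgue \<Omega> > 0"
  proof (elim UnE)
    assume C: "(lam, \<mu>) \<in> C0 \<Omega>"
    \<comment> \<open>For \<open>C0\<close> all of \<open>lam\<close> goes to the logarithm and the
      whole gradient term is kept, so coercivity is trivial.\<close>
    show thesis by (rule that[of 0 1]) (use C in \<open>simp_all add: C0_def\<close>)
  next
    assume "(lam, \<mu>) \<in> B0 \<Omega>"
    then have B: "0 \<le> lam" "lam < lambda1 \<Omega>" "\<mu> < 0"
      "1 / ?n * ((lambda1 \<Omega> - lam) / lambda1 \<Omega>) powr (?n / 2) * ?S powr (?n / 2) + \<mu> / 2 * measure lebesgue \<Omega> > 0"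
      by (simp_all add: B0_def)
    have l1: "lambda1 \<Omega> > 0" using B by simp
    \<comment> \<open>For \<open>B0\<close> all of \<open>lam\<close> is paid by the Poincare
      inequality, at the price of the fraction \<open>lam / lambda1 \<Omega>\<close> of the gradient
      term. The exponential factor becomes 1, matching the definition of \<open>B0\<close>.\<close>
    show thesis
    proof (rule that[of lam "(lambda1 \<Omega> - lam) / lambda1 \<Omega>"])
      show "\<forall>F\<in>W0 \<Omega>. lam * (LINT x|lebesgue_on \<Omega>. (fst (F x))\<^sup>2)
        \<le> (1 - (lambda1 \<Omega> - lam) / lambda1 \<Omega>) * (LINT x|lebesgue_on \<Omega>. (norm (snd (F x)))\<^sup>2)"
      proof
        fix F assume "F \<in> W0 \<Omega>"
        from poincare_W0[OF \<Omega>(1) this]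
        have "lam / lambda1 \<Omega> * (lambda1 \<Omega> * (LINT x|lebesgue_on \<Omega>. (fst (F x))\<^sup>2))
          \<le> lam / lambda1 \<Omega> * (LINT x|lebesgue_on \<Omega>. (norm (snd (F x)))\<^sup>2)"
          using B l1 by (intro mult_left_mono) auto
        moreover have "1 - (lambda1 \<Omega> - lam) / lambda1 \<Omega> = lam / lambda1 \<Omega>" using l1 by (simp add: field_simps)
        ultimately show "lam * (LINT x|lebesgue_on \<Omega>. (fst (F x))\<^sup>2)
          \<le> (1 - (lambda1 \<Omega> - lam) / lambda1 \<Omega>) * (LINT x|lebesgue_on \<Omega>. (norm (snd (F x)))\<^sup>2)"
          using l1 by simp
      qed
    qed (use B l1 in auto)
  qed
  \<comment> \<open>If \<open>S\<close> vanished, then so would the first summand of \<open>well\<close>; positivity of \<open>S\<close>, that is, the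
    Sobolev inequality itself, is thus part of the hypotheses.\<close>
  have "?S > 0"
  proof (rule ccontr)
    assume "\<not> ?S > 0"
    moreover have "?S \<ge> 0" by (rule sobolev_S_nonneg)
    ultimately have "?S = 0" by simp
    moreover have "\<mu> / 2 * exp (- (lam - \<sigma>) / \<mu>) * measure lebesgue \<Omega> \<le> 0"
      using \<mu> by (simp add: mult_nonpos_nonneg)
    ultimately show False using well by simp
  qed
  show ?thesis
    by (rule positive_solution_exists[OF N \<Omega> \<open>?S > 0\<close> \<mu> \<sigma> \<theta> bspec[OF coercive] well])
qed

end
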